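(* Let $f,g\in\mathrm{Lip}(\Omega)$, where $g$ is not co-boundary to a constant (that is, there are no $v\in \mathrm{C}(\Omega)$ and $c_0\in\mathbb{R}$ with $g=v-v\circ T+c_0$). For $t\in\mathbb{R}$ put $\beta(t):=P(f+tg)-P(f)$. Then for every $c\in\mathbb{R}$, $$\lim_{n\to\infty}\mu_f\Bigl(\Bigl\{x\in\Omega \;:\; \frac{1}{\sqrt n}\sum_{j=0}^{n-1}\bigl(g(T^j(x))-\beta'(0)\bigr)<c\Bigr\}\Bigr)=\int_{-\infty}^{c}d\phi_{0,\beta''(0)}(t),$$ where $\phi_{0,\beta''(0)}$ is the Gaussian distribution on $\mathbb{R}$ with mean $0$ and variance $\sigma^2=\beta''(0)$.
   Context: Let $(M,d_M)$ be a compact metric space with $\mathrm{diam}(M)=1$, $\Omega:=M^{\mathbb{N}}$ with metric $d(x,y)=\sum_{n\ge1}2^{-n}d_M(x_n,y_n)$, and $T:\Omega\to\Omega$ the shift $T((x_n)_{n\ge1})=(x_{n+1})_{n\ge1}$. $\mathrm{C}(\Omega)$ and $\mathrm{Lip}(\Omega)$ are the spaces of real continuous and real Lipschitz functions on $\Omega$. Fix a Borel probability $\nu$ on $M$ with support $M$ (the a priori measure). For $f\in\mathrm{Lip}(\Omega)$ the Ruelle operator is $\mathcal{L}_f(w)(x)=\int_M e^{f(ax)}w(ax)\,d\nu(a)$, where $ax=(a,x_1,x_2,\dots)$. By the Ruelle-Perron-Frobenius (RPF) theorem there are $\lambda_f>0$, a strictly positive $w_f\in\mathrm{Lip}(\Omega)$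 and a Borel probability $\rho_f$ on $\Omega$ with $\mathcal{L}_f w_f=\lambda_f w_f$, $\mathcal{L}_f^*\rho_f=\lambda_f\rho_f$, normalized by $\int w_f\,d\rho_f=1$. The pressure is $P(f):=\log\lambda_f$; the map $t\mapsto P(f+tg)$ is analytic. The normalization of $f$ is $N(f)=f+\log w_f-\log(w_f\circ T)-\log\lambda_f$, which satisfies $\mathcal{L}_{N(f)}1=1$. The Lipschitz-Gibbs probability $\mu_f$ is the unique Borel probability with $\mathcal{L}_{N(f)}^*\mu_f=\mu_f$; it is $T$-invariant and $d\mu_f=w_f\,d\rho_f$. The Gaussian distribution with mean $\alpha$ and variance $\sigma^2>0$ is $d\phi_{\alpha,\sigma^2}(t)=\frac{1}{\sqrt{2\pi\sigma^2}}e^{-(t-\alpha)^2/(2\sigma^2)}dt$. *)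

theory Defs
  imports "HOL-Analysis.Analysis" "HOL-Probability.Probability"
begin

text \<open>
  The compact metric space \<open>M\<close> is a type \<^typ>\<open>'a\<close> of class \<^class>\<open>metric_space\<close>, with compactness of
  \<^term>\<open>UNIV :: 'a set\<close> assumed where needed, and \<open>\<Omega>\<close> is the type \<^typ>\<open>nat \<Rightarrow> 'a\<close>, indexed
  from \<open>0\<close>. The topology and Borel sigma-algebra on \<^typ>\<open>nat \<Rightarrow> 'a\<close> are those of the product topology
  from the library; by \<open>mtopology_seq_dist\<close> below it is the topology of the metric \<open>d\<close>. The library's
  own \<^const>\<open>dist\<close> on \<^typ>\<open>nat \<Rightarrow> 'a\<close> is a different metric, with different Lipschitz functions, and
  is not used.
\<close>

definition seq_dist :: "(nat \<Rightarrow> 'a::metric_space) \<Rightarrow> (nat \<Rightarrow> 'a) \<Rightarrow> real" where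
  "seq_dist x y = (\<Sum>n. (1/2) ^ Suc n * dist (x n) (y n))"

definition shift :: "(nat \<Rightarrow> 'a) \<Rightarrow> (nat \<Rightarrow> 'a)" where
  "shift x = (\<lambda>n. x (Suc n))"

definition prepend :: "'a \<Rightarrow> (nat \<Rightarrow> 'a) \<Rightarrow> (nat \<Rightarrow> 'a)" where
  "prepend a x = case_nat a x"

definition Lip :: "((nat \<Rightarrow> 'a::metric_space) \<Rightarrow> real) set" where
  "Lip = {f. \<exists>L. \<forall>x y. \<bar>f x - f y\<bar> \<le> L * seq_dist x y}"

definition borel_prob :: "'b::topological_space measure \<Rightarrow> bool" where
  "borel_prob \<mu> \<longleftrightarrow> prob_space \<mu> \<and> sets \<mu> = sets borel"

definition measure_support :: "'b::topological_space measure \<Rightarrow> 'b set" where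
  "measure_support \<mu> = {x. \<forall>U. open U \<longrightarrow> x \<in> U \<longrightarrow> emeasure \<mu> U > 0}"

definition ruelle ::
  "'a::metric_space measure \<Rightarrow> ((nat \<Rightarrow> 'a) \<Rightarrow> real) \<Rightarrow> ((nat \<Rightarrow> 'a) \<Rightarrow> real) \<Rightarrow> (nat \<Rightarrow> 'a) \<Rightarrow> real"
where
  "ruelle \<nu> f w x = (\<integral>a. exp (f (prepend a x)) * w (prepend a x) \<partial>\<nu>)"

text \<open>
  \<open>dual_eigenmeasure \<nu> f c \<rho>\<close> is the equation \<open>\<L>\<^sub>f\<^sup>* \<rho> = c \<rho>\<close> between functionals on \<open>C(\<Omega>)\<close>.
\<close>

definition dual_eigenmeasure ::
  "'a::metric_space measure \<Rightarrow> ((nat \<Rightarrow> 'a) \<Rightarrow> real) \<Rightarrow> real \<Rightarrow> (nat \<Rightarrow> 'a) measure \<Rightarrow> bool"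
where
  "dual_eigenmeasure \<nu> f c \<rho> \<longleftrightarrow>
     (\<forall>w. continuous_on UNIV w \<longrightarrow> (\<integral>x. ruelle \<nu> f w x \<partial>\<rho>) = c * (\<integral>x. w x \<partial>\<rho>))"

definition is_RPF ::
  "'a::metric_space measure \<Rightarrow> ((nat \<Rightarrow> 'a) \<Rightarrow> real) \<Rightarrow>
     real \<times> ((nat \<Rightarrow> 'a) \<Rightarrow> real) \<times> (nat \<Rightarrow> 'a) measure \<Rightarrow> bool"
where
  "is_RPF \<nu> f = (\<lambda>(l, w, \<rho>).
     l > 0 \<and> w \<in> Lip \<and> (\<forall>x. w x > 0) \<and> borel_prob \<rho> \<and>
     (\<forall>x. ruelle \<nu> f w x = l * w x) \<and> dual_eigenmeasure \<nu> f l \<rho> \<and>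
     (\<integral>x. w x \<partial>\<rho>) = 1)"

text \<open>
  For Lipschitz \<open>f\<close> the triple exists (and is unique) by the Ruelle-Perron-Frobenius theorem, which is
  not assumed here.
\<close>

definition RPF ::
  "'a::metric_space measure \<Rightarrow> ((nat \<Rightarrow> 'a) \<Rightarrow> real) \<Rightarrow>
     real \<times> ((nat \<Rightarrow> 'a) \<Rightarrow> real) \<times> (nat \<Rightarrow> 'a) measure"
where
  "RPF \<nu> f = (SOME p. is_RPF \<nu> f p)"

definition RPF_eigenvalue :: "'a::metric_space measure \<Rightarrow> ((nat \<Rightarrow> 'a) \<Rightarrow> real) \<Rightarrow> real" where
  "RPF_eigenvalue \<nu> f = fst (RPF \<nu> f)"

definition RPF_eigenfunction ::
  "'a::metric_space measure \<Rightarrow> ((nat \<Rightarrow> 'a) \<Rightarrow> real) \<Rightarrow> (nat \<Rightarrow> 'a) \<Rightarrow> real"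
where
  "RPF_eigenfunction \<nu> f = fst (snd (RPF \<nu> f))"

definition pressure :: "'a::metric_space measure \<Rightarrow> ((nat \<Rightarrow> 'a) \<Rightarrow> real) \<Rightarrow> real" where
  "pressure \<nu> f = ln (RPF_eigenvalue \<nu> f)"

definition normalization ::
  "'a::metric_space measure \<Rightarrow> ((nat \<Rightarrow> 'a) \<Rightarrow> real) \<Rightarrow> (nat \<Rightarrow> 'a) \<Rightarrow> real"
where
  "normalization \<nu> f x =
     f x + ln (RPF_eigenfunction \<nu> f x) - ln (RPF_eigenfunction \<nu> f (shift x))
       - ln (RPF_eigenvalue \<nu> f)"

definition gibbs ::
  "'a::metric_space measure \<Rightarrow> ((nat \<Rightarrow> 'a) \<Rightarrow> real) \<Rightarrow> (nat \<Rightarrow> 'a) measure"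
where
  "gibbs \<nu> f = (THE \<mu>. borel_prob \<mu> \<and> dual_eigenmeasure \<nu> (normalization \<nu> f) 1 \<mu>)"

definition coboundary_to_constant :: "((nat \<Rightarrow> 'a::metric_space) \<Rightarrow> real) \<Rightarrow> bool" where
  "coboundary_to_constant g \<longleftrightarrow>
     (\<exists>v c. continuous_on UNIV v \<and> (\<forall>x. g x = v x - v (shift x) + c))"

definition pressure_diff ::
  "'a::metric_space measure \<Rightarrow> ((nat \<Rightarrow> 'a) \<Rightarrow> real) \<Rightarrow> ((nat \<Rightarrow> 'a) \<Rightarrow> real) \<Rightarrow> real \<Rightarrow> real"
where
  "pressure_diff \<nu> f g t = pressure \<nu> (\<lambda>x. f x + t * g x) - pressure \<nu> f"

text \<open>The second parameter is the variance; \<^const>\<open>normal_density\<close> takes the standard deviation.\<close>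

definition gaussian :: "real \<Rightarrow> real \<Rightarrow> real measure" where
  "gaussian \<alpha> v = density lborel (normal_density \<alpha> (sqrt v))"


lemma dist_le_1:
  assumes "compact (UNIV :: 'a::metric_space set)" "diameter (UNIV :: 'a set) = 1"
  shows "dist (a::'a) b \<le> 1"
  using diameter_bounded_bound[OF compact_imp_bounded[OF assms(1)], of a b] assms(2) by simp

lemma summable_seq_dist:
  assumes "compact (UNIV :: 'a::metric_space set)" "diameter (UNIV :: 'a set) = 1"
  shows "summable (\<lambda>n. (1/2) ^ Suc n * dist (x n) (y n :: 'a))"
proof (rule summable_comparison_test')
  show "summable (\<lambda>n. (1/2::real) ^ Suc n)" by (simp add: summable_geometric)
  show "norm ((1/2) ^ Suc n * dist (x n) (y n :: 'a)) \<le> (1/2::real) ^ Suc n" for n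
    using dist_le_1[OF assms, of "x n" "y n"] by (simp add: mult_left_le)
qed

lemma seq_dist_ge:
  assumes "compact (UNIV :: 'a::metric_space set)" "diameter (UNIV :: 'a set) = 1"
  shows "(1/2) ^ Suc n * dist (x n) (y n :: 'a) \<le> seq_dist x y"
  using sum_le_suminf[OF summable_seq_dist[OF assms], of "{n}" x y] by (simp add: seq_dist_def)

lemma Metric_space_seq_dist:
  assumes "compact (UNIV :: 'a::metric_space set)" "diameter (UNIV :: 'a set) = 1"
  shows "Metric_space UNIV (seq_dist :: (nat \<Rightarrow> 'a) \<Rightarrow> _)"
proof
  note S = summable_seq_dist[OF assms]
  fix x y z :: "nat \<Rightarrow> 'a"
  show "0 \<le> seq_dist x y" unfolding seq_dist_def by (rule suminf_nonneg[OF S]) simp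
  show "seq_dist x y = seq_dist y x" by (simp add: seq_dist_def dist_commute)
  show "seq_dist x y = 0 \<longleftrightarrow> x = y"
  proof
    assume z: "seq_dist x y = 0"
    have "dist (x n) (y n) = 0" for n
      using seq_dist_ge[OF assms, of n x y] z
      by (metis zero_le_dist mult_le_0_iff order_antisym_conv zero_less_divide_1_iff
          zero_less_numeral zero_less_power linorder_not_less)
    then show "x = y" by auto
  qed (simp add: seq_dist_def)
  have "seq_dist x z \<le> (\<Sum>n. (1/2) ^ Suc n * dist (x n) (y n) + (1/2) ^ Suc n * dist (y n) (z n))"
    unfolding seq_dist_def
    by (intro suminf_le S summable_add)
       (metis dist_triangle distrib_left mult_left_mono zero_le_divide_1_iff zero_le_numeral zero_le_power)
  also have "\<dots> = seq_dist x y + seq_dist y z"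
    unfolding seq_dist_def by (rule suminf_add[symmetric]; rule S)
  finally show "seq_dist x z \<le> seq_dist x y + seq_dist y z" .
qed

lemma continuous_on_seq_dist:
  assumes "compact (UNIV :: 'a::metric_space set)" "diameter (UNIV :: 'a set) = 1"
  shows "continuous_on UNIV (\<lambda>y. seq_dist x (y :: nat \<Rightarrow> 'a))"
proof -
  have "uniform_limit UNIV (\<lambda>n y. \<Sum>i<n. (1/2) ^ Suc i * dist (x i) (y i :: 'a))
          (\<lambda>y. \<Sum>i. (1/2) ^ Suc i * dist (x i) (y i)) sequentially"
  proof (rule Weierstrass_m_test)
    show "norm ((1/2) ^ Suc n * dist (x n) (y n :: 'a)) \<le> (1/2::real) ^ Suc n" for n y
      using dist_le_1[OF assms, of "x n" "y n"] by (simp add: mult_left_le)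
  qed (simp add: summable_geometric)
  then show ?thesis
    unfolding seq_dist_def
    by (rule uniform_limit_theorem[rotated])
       (auto intro!: always_eventually continuous_intros continuous_on_product_coordinates)
qed

lemma mtopology_seq_dist:
  assumes "compact (UNIV :: 'a::metric_space set)" "diameter (UNIV :: 'a set) = 1"
  shows "Metric_space.mtopology UNIV (seq_dist :: (nat \<Rightarrow> 'a) \<Rightarrow> _) = euclidean"
proof -
  interpret Metric_space UNIV "seq_dist :: (nat \<Rightarrow> 'a) \<Rightarrow> _"
    by (rule Metric_space_seq_dist[OF assms])
  have ball: "mball x r = {y. seq_dist x y < r}" for x r by (auto simp: mball_def)
  have "openin mtopology U \<longleftrightarrow> open U" for U
  proof
    assume U: "openin mtopology U"
    have "\<exists>V. open V \<and> x \<in> V \<and> V \<subseteq> U" if "x \<in> U" for x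
    proof -
      obtain r where r: "r > 0" "mball x r \<subseteq> U" using U \<open>x \<in> U\<close> by (auto simp: openin_mtopology)
      have "open {y. seq_dist x y < r}"
        by (rule open_Collect_less[OF continuous_on_seq_dist[OF assms]]) simp
      then show ?thesis using r by (intro exI[of _ "mball x r"]) (auto simp: ball)
    qed
    then show "open U" by (subst open_subopen) blast
  next
    assume U: "open U"
    have "\<exists>r>0. mball x r \<subseteq> U" if "x \<in> U" for x
    proof -
      obtain X where X: "x \<in> Pi\<^sub>E UNIV X" "\<And>i. open (X i)" "finite {i. X i \<noteq> UNIV}" "Pi\<^sub>E UNIV X \<subseteq> U"
        using product_topology_open_contains_basis[of "\<lambda>_. euclidean" UNIV U x] U \<open>x \<in> U\<close>
        by (auto simp: open_fun_def)
      define F where "F = {i. X i \<noteq> UNIV}"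
      have "\<exists>e>0. ball (x i) e \<subseteq> X i" for i
        using X(1) X(2)[of i] by (meson PiE_mem UNIV_I open_contains_ball)
      then obtain e where e: "\<And>i. e i > 0" "\<And>i. ball (x i) (e i) \<subseteq> X i" by metis
      define r where "r = Min (insert 1 ((\<lambda>i. (1/2) ^ Suc i * e i) ` F))"
      have fin: "finite F" using X(3) by (simp add: F_def)
      have "r > 0" unfolding r_def using fin e(1) by (subst Min_gr_iff) auto
      moreover have "y \<in> U" if "seq_dist x y < r" for y
      proof -
        have "y i \<in> X i" for i
        proof (cases "i \<in> F")
          case True
          have "(1/2) ^ Suc i * dist (x i) (y i) \<le> seq_dist x y" by (rule seq_dist_ge[OF assms])
          also have "\<dots> < r" by fact
          also have "r \<le> (1/2) ^ Suc i * e i" unfolding r_def using fin True by (intro Min_le) auto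
          finally have "dist (x i) (y i) < e i" by (subst (asm) mult_less_cancel_left_pos) auto
          then show ?thesis using e(2)[of i] by auto
        qed (simp add: F_def)
        then show ?thesis using X(4) by (auto simp: PiE_def extensional_def)
      qed
      ultimately show ?thesis by (auto simp: ball)
    qed
    then show "openin mtopology U" by (auto simp: openin_mtopology)
  qed
  then show ?thesis by (simp add: topology_eq)
qed

end

theory Submission
  imports Defs
begin

text \<open>
  For a normalized potential the transfer operator contracts the cone of log-Lipschitz functions
  modulo constants. The same contraction for a sequence of normalized potentials, applied to the
  ratios of consecutive iterates of \<open>1\<close>, gives the eigenfunction of a general potential; the invariant
  measure comes from the limit functional by Riesz representation.

  Poisson's equation gives Gordin's decomposition \<open>g = m + h + u \<circ> T - u\<close> with \<open>h\<close> in the kernel of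
  the normalized operator \<open>\<L>\<close>, and a \<open>q\<close> with \<open>\<L> (h\<^sup>2 + q) = \<sigma>\<^sup>2 + q\<close>. Then
  \<open>exp (z u) (1 + z\<^sup>2 q / 2)\<close> is an eigenfunction of \<open>w \<mapsto> \<L> (exp (z (g - m)) w)\<close> for the eigenvalue
  \<open>exp (z\<^sup>2 \<sigma>\<^sup>2 / 2)\<close> up to an error of order \<open>z\<^sup>3\<close>. For real \<open>z\<close>, integrated against the eigenmeasure
  of \<open>f + z g\<close>, this is the second order expansion of the pressure, which convexity allows to
  differentiate twice; so no spectral perturbation theory is needed. For imaginary \<open>z\<close> of size
  \<open>1 / sqrt n\<close>, iterated \<open>n\<close> times, it is the limit of the characteristic functions.
\<close>

section \<open>Representing measures of positive functionals\<close>

text \<open>The statement contains a choice (\<open>RPF\<close>), a definite description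
  (\<open>gibbs\<close>) and the total function \<open>deriv\<close>. So the eigendata, the
  existence and uniqueness of the invariant measure and the differentiability of the pressure must
  be established before these terms carry any information. All contraction comes from one fact:
  prepending a letter halves \<open>seq_dist\<close>, so the operator of an
  \<open>A\<close>-Lipschitz potential turns the log-Lipschitz constant \<open>K\<close> into
  \<open>(A + K) / 2\<close>. For normalized potentials the resulting rate depends on
  \<open>A\<close> alone, which is why it survives a potential that changes at every step. A second
  derivative at \<open>0\<close> requires the first one near \<open>0\<close>. It is obtained by
  making the expansion at each base point \<open>f + t * g\<close>, with a decomposition of
  \<open>g\<close> that depends on \<open>t\<close>; how it varies with \<open>t\<close> is
  controlled through convexity only. Full support of \<open>\<nu>\<close> and the hypothesis on
  \<open>g\<close> enter once, together: they exclude variance zero.\<close>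

text \<open>
  The infimum of the costs of countable covers by nonnegative continuous functions is an outer
  measure for which open sets are measurable; this yields the Riesz measure through Caratheodory.
\<close>

definition fun_covers :: "'b::topological_space set \<Rightarrow> (nat \<Rightarrow> 'b \<Rightarrow> real) set" where
  "fun_covers A = {s. (\<forall>n. continuous_on UNIV (s n)) \<and> (\<forall>n x. 0 \<le> s n x) \<and>
     (\<forall>x\<in>A. 1 \<le> (\<Sum>n. ennreal (s n x)))}"

definition riesz_outer :: "(('b::topological_space \<Rightarrow> real) \<Rightarrow> real) \<Rightarrow> 'b set \<Rightarrow> ennreal" where
  "riesz_outer \<Lambda> A = (INF s\<in>fun_covers A. \<Sum>n. ennreal (\<Lambda> (s n)))"

locale positive_functional =
  fixes \<Lambda> :: "('b::metric_space \<Rightarrow> real) \<Rightarrow> real"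
  assumes compact_UNIV: "compact (UNIV :: 'b set)"
    and add: "\<And>\<phi> \<psi>. continuous_on UNIV \<phi> \<Longrightarrow> continuous_on UNIV \<psi> \<Longrightarrow>
      \<Lambda> (\<lambda>x. \<phi> x + \<psi> x) = \<Lambda> \<phi> + \<Lambda> \<psi>"
    and scale: "\<And>\<phi> c. continuous_on UNIV \<phi> \<Longrightarrow> \<Lambda> (\<lambda>x. c * \<phi> x) = c * \<Lambda> \<phi>"
    and nonneg: "\<And>\<phi>. continuous_on UNIV \<phi> \<Longrightarrow> (\<And>x. 0 \<le> \<phi> x) \<Longrightarrow> 0 \<le> \<Lambda> \<phi>"
    and one: "\<Lambda> (\<lambda>_. 1) = 1"
begin

lemma diff:
  assumes "continuous_on UNIV \<phi>" "continuous_on UNIV \<psi>"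
  shows "\<Lambda> (\<lambda>x. \<phi> x - \<psi> x) = \<Lambda> \<phi> - \<Lambda> \<psi>"
  using add[OF assms(1), of "\<lambda>x. - 1 * \<psi> x"] scale[OF assms(2), of "-1"] assms
  by (simp add: continuous_on_minus)

lemma mono:
  assumes "continuous_on UNIV \<phi>" "continuous_on UNIV \<psi>" "\<And>x. \<phi> x \<le> \<psi> x"
  shows "\<Lambda> \<phi> \<le> \<Lambda> \<psi>"
  using nonneg[of "\<lambda>x. \<psi> x - \<phi> x"] diff[of \<psi> \<phi>] assms by (simp add: continuous_on_diff)

lemma zero: "\<Lambda> (\<lambda>_. 0) = 0"
  using scale[of "\<lambda>_. 1" 0] by simp

lemma sum:
  assumes "finite I" "\<And>i. i \<in> I \<Longrightarrow> continuous_on UNIV (\<phi> i)"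
  shows "\<Lambda> (\<lambda>x. \<Sum>i\<in>I. \<phi> i x) = (\<Sum>i\<in>I. \<Lambda> (\<phi> i))"
  using assms
proof (induction I rule: finite_induct)
  case (insert i I)
  have "\<Lambda> (\<lambda>x. \<Sum>j\<in>insert i I. \<phi> j x) = \<Lambda> (\<lambda>x. \<phi> i x + (\<Sum>j\<in>I. \<phi> j x))"
    using insert.hyps by simp
  also have "\<dots> = \<Lambda> (\<phi> i) + \<Lambda> (\<lambda>x. \<Sum>j\<in>I. \<phi> j x)"
    by (intro add continuous_on_sum insert.prems) auto
  finally show ?case using insert by simp
qed (simp add: zero)

lemma riesz_outer_le:
  assumes "continuous_on UNIV \<phi>" "\<And>x. 0 \<le> \<phi> x" "\<And>x. x \<in> A \<Longrightarrow> 1 \<le> \<phi> x"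
  shows "riesz_outer \<Lambda> A \<le> ennreal (\<Lambda> \<phi>)"
proof -
  define s where "s n = (if n = 0 then \<phi> else (\<lambda>_. 0))" for n :: nat
  have "(\<Sum>n. ennreal (s n x)) = ennreal (\<phi> x)" for x
    by (subst suminf_finite[of "{0}"]) (auto simp: s_def)
  then have "s \<in> fun_covers A"
    using assms by (auto simp: fun_covers_def s_def intro!: ennreal_leI simp flip: ennreal_1)
  moreover have "(\<Sum>n. ennreal (\<Lambda> (s n))) = ennreal (\<Lambda> \<phi>)"
    by (subst suminf_finite[of "{0}"]) (auto simp: s_def zero)
  ultimately show ?thesis unfolding riesz_outer_def by (metis INF_lower)
qed

lemma riesz_outer_cover: "s \<in> fun_covers A \<Longrightarrow> riesz_outer \<Lambda> A \<le> (\<Sum>n. ennreal (\<Lambda> (s n)))"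
  unfolding riesz_outer_def by (rule INF_lower)

text \<open>Doubly indexed families arise both when covers of countably many sets are united and
  when every function of a cover is cut by a partition of unity; \<open>prod_decode\<close> flattens
  them.\<close>

lemma riesz_outer_cover2:
  assumes "\<And>k n. continuous_on UNIV (s k n)" "\<And>k n x. 0 \<le> s k n x"
    and "\<And>x. x \<in> A \<Longrightarrow> 1 \<le> (\<Sum>k. \<Sum>n. ennreal (s k n x))"
  shows "riesz_outer \<Lambda> A \<le> (\<Sum>k. \<Sum>n. ennreal (\<Lambda> (s k n)))"
proof -
  define t where "t i = s (fst (prod_decode i)) (snd (prod_decode i))" for i
  have 1: "(\<Sum>i. ennreal (t i x)) = (\<Sum>k. \<Sum>n. ennreal (s k n x))" for x
    using suminf_ennreal_2dimen[of "\<lambda>k. \<Sum>n. ennreal (s k n x)" "\<lambda>(k,n). ennreal (s k n x)"]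
    by (simp add: t_def case_prod_unfold)
  have 2: "(\<Sum>i. ennreal (\<Lambda> (t i))) = (\<Sum>k. \<Sum>n. ennreal (\<Lambda> (s k n)))"
    using suminf_ennreal_2dimen[of "\<lambda>k. \<Sum>n. ennreal (\<Lambda> (s k n))" "\<lambda>(k,n). ennreal (\<Lambda> (s k n))"]
    by (simp add: t_def case_prod_unfold)
  have "t \<in> fun_covers A" using assms by (simp add: fun_covers_def 1) (simp add: t_def)
  from riesz_outer_cover[OF this] show ?thesis by (simp add: 2)
qed

lemma riesz_outer_le_1: "riesz_outer \<Lambda> A \<le> 1"
  using riesz_outer_le[of "\<lambda>_. 1" A] by (simp add: one)

lemma riesz_outer_mono: "A \<subseteq> B \<Longrightarrow> riesz_outer \<Lambda> A \<le> riesz_outer \<Lambda> B"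
  unfolding riesz_outer_def by (rule INF_superset_mono) (auto simp: fun_covers_def)

lemma riesz_outer_empty: "riesz_outer \<Lambda> {} = 0"
  using riesz_outer_le[of "\<lambda>_. 0" "{}"] by (simp add: zero)

lemma outer_measure_space_riesz_outer: "outer_measure_space UNIV (riesz_outer \<Lambda>)"
proof -
  have "riesz_outer \<Lambda> (\<Union>i. A i) \<le> (\<Sum>i. riesz_outer \<Lambda> (A i))" for A :: "nat \<Rightarrow> 'b set"
  proof (rule ennreal_le_epsilon)
    fix e :: real assume e: "0 < e"
    have "\<exists>s\<in>fun_covers (A i). (\<Sum>n. ennreal (\<Lambda> (s n))) \<le> riesz_outer \<Lambda> (A i) + ennreal (e * (1/2) ^ Suc i)" for i
    proof -
      \<comment> \<open>Finiteness, from \<open>riesz_outer_le_1\<close>, makes the inequality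
        strict, so an actual cover comes this close to the infimum.\<close>
      have "riesz_outer \<Lambda> (A i) < riesz_outer \<Lambda> (A i) + ennreal (e * (1/2) ^ Suc i)"
        using e riesz_outer_le_1[of "A i"]
        by (cases "riesz_outer \<Lambda> (A i)") (auto simp: ennreal_less_iff top_unique simp flip: ennreal_plus)
      then show ?thesis
        unfolding riesz_outer_def INF_less_iff by (auto intro: less_imp_le)
    qed
    then obtain s where s: "\<And>i. s i \<in> fun_covers (A i)"
      "\<And>i. (\<Sum>n. ennreal (\<Lambda> (s i n))) \<le> riesz_outer \<Lambda> (A i) + ennreal (e * (1/2) ^ Suc i)"
      by metis
    have "riesz_outer \<Lambda> (\<Union>i. A i) \<le> (\<Sum>i. \<Sum>n. ennreal (\<Lambda> (s i n)))"
    proof (rule riesz_outer_cover2)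
      fix x assume "x \<in> (\<Union>i. A i)"
      then obtain i where "x \<in> A i" by blast
      then have "1 \<le> (\<Sum>n. ennreal (s i n x))" using s(1)[of i] by (auto simp: fun_covers_def)
      also have "\<dots> \<le> (\<Sum>i. \<Sum>n. ennreal (s i n x))"
        using sum_le_suminf[of "\<lambda>i. \<Sum>n. ennreal (s i n x)" "{i}"] by simp
      finally show "1 \<le> (\<Sum>i. \<Sum>n. ennreal (s i n x))" .
    qed (use s(1) in \<open>auto simp: fun_covers_def\<close>)
    also have "\<dots> \<le> (\<Sum>i. riesz_outer \<Lambda> (A i) + ennreal (e * (1/2) ^ Suc i))"
      by (intro suminf_le s(2)) auto
    also have "\<dots> = (\<Sum>i. riesz_outer \<Lambda> (A i)) + (\<Sum>i. ennreal (e * (1/2) ^ Suc i))"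
      by (intro suminf_add[symmetric]) auto
    also have "(\<Sum>i. ennreal (e * (1/2) ^ Suc i)) = ennreal e"
    proof (rule suminf_ennreal_eq)
      show "(\<lambda>i. e * (1/2) ^ Suc i) sums e" using sums_mult[OF power_half_series, of e] by simp
    qed (use e in auto)
    finally show "riesz_outer \<Lambda> (\<Union>i. A i) \<le> (\<Sum>i. riesz_outer \<Lambda> (A i)) + ennreal e" .
  qed
  then show ?thesis
    by (auto simp: outer_measure_space_def positive_def increasing_def countably_subadditive_def
        riesz_outer_empty riesz_outer_mono)
qed

text \<open>The functions \<open>\<psi> k\<close> increase to the indicator of \<open>U\<close>, so
  their increments \<open>D k\<close> form a partition of unity on \<open>U\<close>. They cut a
  cover \<open>s\<close> of \<open>B\<close> in two: the products \<open>D k x * s n x\<close> cover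
  \<open>U \<inter> B\<close>, and for each \<open>K\<close> the products
  \<open>(1 - \<psi> K x) * s n x\<close> cover \<open>B - U\<close>, because
  \<open>\<psi> K\<close> vanishes off \<open>U\<close>. By additivity of \<open>\<Lambda>\<close>
  the two costs up to level \<open>K\<close> add up to the cost of \<open>s\<close>.\<close>

lemma open_in_lambda_system:
  assumes "open U"
  shows "U \<in> lambda_system UNIV UNIV (riesz_outer \<Lambda>)"
proof (cases "U = UNIV")
  \<comment> \<open>Separate because \<open>infdist x {}\<close> is \<open>0\<close>, so the
    cut-offs used below would vanish identically.\<close>
  case True
  then show ?thesis by (simp add: lambda_system_def riesz_outer_empty)
next
  case False
  define \<psi> where "\<psi> k x = min 1 (real k * infdist x (- U))" for k :: nat and x
  have \<psi>: "continuous_on UNIV (\<psi> k)" "0 \<le> \<psi> k x" "\<psi> k x \<le> 1" for k x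
    unfolding \<psi>_def by (auto intro!: continuous_intros simp: infdist_nonneg)
  have \<psi>_mono: "\<psi> k x \<le> \<psi> (Suc k) x" for k x
    unfolding \<psi>_def by (intro min.mono mult_right_mono infdist_nonneg) auto
  have \<psi>_out: "\<psi> k x = 0" if "x \<notin> U" for k x using that by (simp add: \<psi>_def)
  have \<psi>_0: "\<psi> 0 x = 0" for x by (simp add: \<psi>_def)
  define D where "D k x = \<psi> (Suc k) x - \<psi> k x" for k x
  have D: "continuous_on UNIV (D k)" "0 \<le> D k x" for k x
    unfolding D_def using \<psi>(1) \<psi>_mono by (auto intro!: continuous_intros)
  have D_sum: "(\<Sum>k<K. D k x) = \<psi> K x" for K x
    unfolding D_def using sum_lessThan_telescope[of "\<lambda>k. \<psi> k x" K] by (simp add: \<psi>_0)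
  have D_total: "(\<Sum>k. ennreal (D k x)) = 1" if x: "x \<in> U" for x
  proof -
    have pos: "0 < infdist x (- U)"
      using False \<open>open U\<close> x by (intro infdist_pos_not_in_closed) auto
    then obtain K where K: "1 < real K * infdist x (- U)" using reals_Archimedean3 by blast
    have "\<psi> k x = 1" if "k \<ge> K" for k
    proof -
      have "real K * infdist x (- U) \<le> real k * infdist x (- U)"
        using that pos by (intro mult_right_mono) auto
      then show ?thesis using K by (simp add: \<psi>_def)
    qed
    then have "(\<lambda>k. \<psi> k x) \<longlonglongrightarrow> 1"
      by (intro tendsto_eventually) (auto simp: eventually_sequentially)
    then have "(\<lambda>k. D k x) sums 1" by (simp add: sums_def D_sum)
    then show ?thesis using suminf_ennreal_eq[OF D(2)] by simp
  qed
  have "riesz_outer \<Lambda> (U \<inter> B) + riesz_outer \<Lambda> (B - U) \<le> riesz_outer \<Lambda> B" for B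
  proof -
    have "riesz_outer \<Lambda> (U \<inter> B) + riesz_outer \<Lambda> (B - U) \<le> (\<Sum>n. ennreal (\<Lambda> (s n)))"
      if "s \<in> fun_covers B" for s
    proof -
      have s: "continuous_on UNIV (s n)" "0 \<le> s n x" for n x using that by (auto simp: fun_covers_def)
      have s1: "1 \<le> (\<Sum>n. ennreal (s n x))" if "x \<in> B" for x
        using that \<open>s \<in> fun_covers B\<close> by (auto simp: fun_covers_def)
      have "riesz_outer \<Lambda> (U \<inter> B) \<le> (\<Sum>k. \<Sum>n. ennreal (\<Lambda> (\<lambda>x. D k x * s n x)))"
      proof (rule riesz_outer_cover2)
        fix x assume x: "x \<in> U \<inter> B"
        have "(\<Sum>k. \<Sum>n. ennreal (D k x * s n x)) = (\<Sum>k. ennreal (D k x) * (\<Sum>n. ennreal (s n x)))"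
          using D s by (simp add: ennreal_mult)
        also have "\<dots> = (\<Sum>n. ennreal (s n x))" using x by (simp add: D_total)
        finally show "1 \<le> (\<Sum>k. \<Sum>n. ennreal (D k x * s n x))" using s1 x by simp
      qed (use D s in \<open>auto intro!: continuous_intros\<close>)
      then have "riesz_outer \<Lambda> (U \<inter> B) + riesz_outer \<Lambda> (B - U)
          \<le> (\<Sum>k. \<Sum>n. ennreal (\<Lambda> (\<lambda>x. D k x * s n x))) + riesz_outer \<Lambda> (B - U)"
        by (rule add_right_mono)
      \<comment> \<open>The sum over \<open>k\<close> is bounded through its partial sums, so finite
        additivity of \<open>\<Lambda>\<close> suffices.\<close>
      also have "\<dots> \<le> (\<Sum>n. ennreal (\<Lambda> (s n)))"
      proof (rule ennreal_suminf_bound_add)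
        fix K
        have c: "continuous_on UNIV (\<lambda>x. \<psi> K x * s n x)" "continuous_on UNIV (\<lambda>x. (1 - \<psi> K x) * s n x)"
          "continuous_on UNIV (\<lambda>x. D k x * s n x)" for n k
          using \<psi>(1) s(1) D(1) by (auto intro!: continuous_intros)
        have "(\<Sum>k<K. \<Sum>n. ennreal (\<Lambda> (\<lambda>x. D k x * s n x)))
            = (\<Sum>n. \<Sum>k<K. ennreal (\<Lambda> (\<lambda>x. D k x * s n x)))"
          by (rule suminf_sum[symmetric]) auto
        also have "\<dots> = (\<Sum>n. ennreal (\<Lambda> (\<lambda>x. \<psi> K x * s n x)))"
        proof (rule suminf_cong)
          fix n
          have "(\<Sum>k<K. ennreal (\<Lambda> (\<lambda>x. D k x * s n x))) = ennreal (\<Sum>k<K. \<Lambda> (\<lambda>x. D k x * s n x))"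
            by (intro sum_ennreal nonneg c) (simp add: D s)
          also have "(\<Sum>k<K. \<Lambda> (\<lambda>x. D k x * s n x)) = \<Lambda> (\<lambda>x. \<Sum>k<K. D k x * s n x)"
            by (intro sum[symmetric] c) auto
          finally show "(\<Sum>k<K. ennreal (\<Lambda> (\<lambda>x. D k x * s n x))) = ennreal (\<Lambda> (\<lambda>x. \<psi> K x * s n x))"
            by (simp add: D_sum flip: sum_distrib_right)
        qed
        finally have "(\<Sum>k<K. \<Sum>n. ennreal (\<Lambda> (\<lambda>x. D k x * s n x))) + riesz_outer \<Lambda> (B - U)
            = (\<Sum>n. ennreal (\<Lambda> (\<lambda>x. \<psi> K x * s n x))) + riesz_outer \<Lambda> (B - U)" by simp
        also have "\<dots> \<le> (\<Sum>n. ennreal (\<Lambda> (\<lambda>x. \<psi> K x * s n x)))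
            + (\<Sum>n. ennreal (\<Lambda> (\<lambda>x. (1 - \<psi> K x) * s n x)))"
        proof (intro add_left_mono riesz_outer_cover)
          show "(\<lambda>n x. (1 - \<psi> K x) * s n x) \<in> fun_covers (B - U)"
            using c s \<psi> s1 by (auto simp: fun_covers_def \<psi>_out)
        qed
        also have "\<dots> = (\<Sum>n. ennreal (\<Lambda> (\<lambda>x. \<psi> K x * s n x)) + ennreal (\<Lambda> (\<lambda>x. (1 - \<psi> K x) * s n x)))"
          by (intro suminf_add) auto
        also have "\<dots> = (\<Sum>n. ennreal (\<Lambda> (s n)))"
        proof (rule suminf_cong)
          fix n
          have "\<Lambda> (\<lambda>x. \<psi> K x * s n x) + \<Lambda> (\<lambda>x. (1 - \<psi> K x) * s n x)
              = \<Lambda> (\<lambda>x. \<psi> K x * s n x + (1 - \<psi> K x) * s n x)"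
            by (rule add[symmetric]) (rule c)+
          also have "\<dots> = \<Lambda> (s n)" by (simp add: algebra_simps)
          finally show "ennreal (\<Lambda> (\<lambda>x. \<psi> K x * s n x)) + ennreal (\<Lambda> (\<lambda>x. (1 - \<psi> K x) * s n x)) = ennreal (\<Lambda> (s n))"
            using nonneg[OF c(1)[of n]] nonneg[OF c(2)[of n]] s \<psi>
            by (simp flip: ennreal_plus)
        qed
        finally show "(\<Sum>k<K. \<Sum>n. ennreal (\<Lambda> (\<lambda>x. D k x * s n x))) + riesz_outer \<Lambda> (B - U)
            \<le> (\<Sum>n. ennreal (\<Lambda> (s n)))" .
      qed
      finally show ?thesis .
    qed
    then show ?thesis unfolding riesz_outer_def[of _ B] by (rule INF_greatest)
  qed
  moreover have "riesz_outer \<Lambda> B \<le> riesz_outer \<Lambda> (U \<inter> B) + riesz_outer \<Lambda> (B - U)" for B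
  proof -
    interpret algebra UNIV "UNIV :: 'b set set" by (auto simp: algebra_iff_Un)
    have "subadditive UNIV (riesz_outer \<Lambda>)"
      using outer_measure_space_riesz_outer
      by (intro countably_subadditive_subadditive) (auto simp: outer_measure_space_def)
    from subadditiveD[OF this, of "U \<inter> B" "B - U"] have
      "riesz_outer \<Lambda> (U \<inter> B \<union> (B - U)) \<le> riesz_outer \<Lambda> (U \<inter> B) + riesz_outer \<Lambda> (B - U)"
      by auto
    moreover have "U \<inter> B \<union> (B - U) = B" by auto
    ultimately show ?thesis by simp
  qed
  ultimately have "riesz_outer \<Lambda> (U \<inter> B) + riesz_outer \<Lambda> (B - U) = riesz_outer \<Lambda> B" for B
    by (simp add: antisym)
  then show ?thesis
    by (auto simp: lambda_system_def Diff_eq Int_commute)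
qed

text \<open>Compactness turns a pointwise cover into a uniform one: the open sets
  \<open>V N\<close>, on which \<open>N\<close> terms already exceed \<open>1 - e\<close>, exhaust
  the space, so a single finite partial sum dominates the constant \<open>1 - e\<close> and
  positivity applies.\<close>

lemma riesz_outer_UNIV: "riesz_outer \<Lambda> UNIV = 1"
proof (rule antisym[OF riesz_outer_le_1])
  have "1 \<le> (\<Sum>n. ennreal (\<Lambda> (s n)))" if "s \<in> fun_covers UNIV" for s
  proof -
    have s: "continuous_on UNIV (s n)" "0 \<le> s n x" "1 \<le> (\<Sum>n. ennreal (s n x))" for n x
      using that by (auto simp: fun_covers_def)
    have "ennreal (1 - e) \<le> (\<Sum>n. ennreal (\<Lambda> (s n)))" if e: "0 < e" "e < 1" for e
    proof -
      define V where "V N = {x. 1 - e < (\<Sum>n<N. s n x)}" for N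
      have "open (V N)" for N
        unfolding V_def by (intro open_Collect_less continuous_on_sum continuous_on_const s)
      moreover have "\<exists>N. x \<in> V N" for x
      proof -
        have "ennreal (1 - e) < (\<Sum>n. ennreal (s n x))"
          using s(3)[of x] e by (auto intro: less_le_trans[rotated] simp: ennreal_less_one_iff)
        then have "ennreal (1 - e) < (SUP N. \<Sum>n<N. ennreal (s n x))"
          by (simp add: suminf_eq_SUP)
        then obtain N where "ennreal (1 - e) < (\<Sum>n<N. ennreal (s n x))"
          by (auto simp: less_SUP_iff)
        then have "1 - e < (\<Sum>n<N. s n x)" using e s
          by (simp add: sum_nonneg ennreal_less_iff)
        then show ?thesis by (auto simp: V_def)
      qed
      ultimately have "UNIV \<subseteq> (\<Union>N. V N)" "\<And>N. open (V N)" by auto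
      then obtain F where F: "finite F" "UNIV \<subseteq> (\<Union>N\<in>F. V N)"
        by (metis compactE_image[OF compact_UNIV])
      define N where "N = Max (insert 0 F)"
      have "1 - e \<le> (\<Sum>n<N. s n x)" for x
      proof -
        obtain K where K: "K \<in> F" "x \<in> V K" using F(2) by blast
        have "(\<Sum>n<K. s n x) \<le> (\<Sum>n<N. s n x)"
          using K(1) F(1) by (intro sum_mono2) (auto simp: N_def s intro: less_le_trans)
        then show ?thesis using K(2) by (simp add: V_def)
      qed
      then have "\<Lambda> (\<lambda>x. (1 - e) * 1) \<le> \<Lambda> (\<lambda>x. \<Sum>n<N. s n x)"
        by (intro mono continuous_on_sum s continuous_intros) auto
      then have "1 - e \<le> (\<Sum>n<N. \<Lambda> (s n))"
        using sum[of "{..<N}" s] scale[of "\<lambda>_. 1" "1 - e"] s(1) by (simp add: one)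
      then have "ennreal (1 - e) \<le> (\<Sum>n<N. ennreal (\<Lambda> (s n)))"
        using nonneg[OF s(1)] s(2) by (simp add: sum_nonneg ennreal_leI)
      also have "\<dots> \<le> (\<Sum>n. ennreal (\<Lambda> (s n)))" by (intro sum_le_suminf) auto
      finally show ?thesis .
    qed
    note lower = this
    show ?thesis
    proof (rule ennreal_le_epsilon)
      fix e :: real assume e: "0 < e"
      define d where "d = min e (1/2)"
      have "(1::ennreal) = ennreal (1 - d) + ennreal d"
        using e by (simp add: d_def flip: ennreal_plus)
      also have "\<dots> \<le> (\<Sum>n. ennreal (\<Lambda> (s n))) + ennreal e"
        using e by (intro add_mono lower ennreal_leI) (auto simp: d_def)
      finally show "1 \<le> (\<Sum>n. ennreal (\<Lambda> (s n))) + ennreal e" .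
    qed
  qed
  then show "1 \<le> riesz_outer \<Lambda> UNIV" unfolding riesz_outer_def by (rule INF_greatest)
qed

section \<open>The Riesz measure on Borel sets and its integrals\<close>

definition riesz_measure :: "'b measure" where
  "riesz_measure = measure_of UNIV (sets borel) (riesz_outer \<Lambda>)"

lemma sets_riesz_measure [simp]: "sets riesz_measure = sets borel"
  using sets.sigma_sets_eq[of "borel :: 'b measure"]
  by (simp add: riesz_measure_def sets_measure_of space_borel)

lemma space_riesz_measure [simp]: "space riesz_measure = UNIV"
  by (simp add: riesz_measure_def space_measure_of)

lemma emeasure_riesz_measure:
  assumes "A \<in> sets borel"
  shows "emeasure riesz_measure A = riesz_outer \<Lambda> A"
proof -
  interpret sigma_algebra UNIV "UNIV :: 'b set set" using sigma_algebra_Pow[of "UNIV :: 'b set"] by simp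
  let ?L = "lambda_system UNIV UNIV (riesz_outer \<Lambda>)"
  have L: "measure_space UNIV ?L (riesz_outer \<Lambda>)"
    by (rule caratheodory_lemma[OF outer_measure_space_riesz_outer])
  have "sigma_sets UNIV {S :: 'b set. open S} \<subseteq> ?L"
    using L open_in_lambda_system
    by (intro sigma_algebra.sigma_sets_subset) (auto simp: measure_space_def)
  then have sub: "sets borel \<subseteq> ?L" by (simp add: borel_def)
  have "countably_additive (sets borel) (riesz_outer \<Lambda>)"
    using L sub unfolding measure_space_def countably_additive_def by blast
  moreover have "positive (sets borel) (riesz_outer \<Lambda>)" by (simp add: positive_def riesz_outer_empty)
  ultimately show ?thesis
    using assms sets_riesz_measure by (intro emeasure_measure_of[OF riesz_measure_def]) auto
qed

lemma borel_prob_riesz_measure: "borel_prob riesz_measure"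
  by (auto simp: borel_prob_def emeasure_riesz_measure riesz_outer_UNIV intro!: prob_spaceI)

text \<open>The region below \<open>\<phi>\<close> is cut into \<open>N\<close> horizontal layers of
  height \<open>1 / N\<close>. Where layer \<open>Suc i\<close> is nonzero, layer \<open>i\<close>
  is full, so \<open>N * \<psi> i\<close> is a cover of that set and the integral of layer
  \<open>Suc i\<close> is at most \<open>\<Lambda> (\<psi> i)\<close>. The offset by one layer costs
  only the bottom layer, at most \<open>1 / N\<close>.\<close>

lemma integral_riesz_measure_le:
  assumes \<phi>: "continuous_on UNIV \<phi>" "\<And>x. 0 \<le> \<phi> x" "\<And>x. \<phi> x \<le> 1"
  shows "(\<integral>x. \<phi> x \<partial>riesz_measure) \<le> \<Lambda> \<phi>"
proof (rule field_le_epsilon)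
  fix e :: real assume e: "0 < e"
  interpret prob_space riesz_measure using borel_prob_riesz_measure by (simp add: borel_prob_def)
  have [measurable]: "\<psi> \<in> borel_measurable riesz_measure" if "continuous_on UNIV \<psi>" for \<psi> :: "'b \<Rightarrow> real"
    using borel_measurable_continuous_onI[OF that] by (simp cong: measurable_cong_sets)
  obtain N :: nat where N: "N > 0" "1 / real N < e"
    using reals_Archimedean[OF e] by (auto simp: inverse_eq_divide intro: that[of "Suc _"])
  define \<psi> where "\<psi> i x = min (max (\<phi> x - real i / N) 0) (1 / N)" for i :: nat and x
  have \<psi>: "continuous_on UNIV (\<psi> i)" "0 \<le> \<psi> i x" "\<psi> i x \<le> 1 / N" for i x
    unfolding \<psi>_def by (auto intro!: continuous_intros \<phi>(1))
  have slices: "(\<Sum>i<K. \<psi> i x) = min (\<phi> x) (real K / N)" for K x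
  proof (induction K)
    case (Suc K)
    have split: "min p a + min (max (p - a) 0) d = min p (a + d)" if "0 < d" for p a d :: real
      using that by auto
    show ?case
      unfolding sum.lessThan_Suc Suc unfolding \<psi>_def using split[of "1 / real N" "\<phi> x" "real K / real N"] N
      by (simp add: add_divide_distrib add.commute)
  qed (simp add: \<phi>)
  have \<phi>_eq: "\<phi> = (\<lambda>x. \<Sum>i<N. \<psi> i x)" using N \<phi>(3) by (auto simp: slices min_def antisym)
  have int: "integrable riesz_measure (\<psi> i)" for i
    using \<psi> by (intro integrable_const_bound[of _ "1 / N"]) auto
  have 0: "(\<integral>x. \<psi> 0 x \<partial>riesz_measure) \<le> 1 / N"
    using integral_mono[OF int[of 0], of "\<lambda>_. 1 / N"] \<psi>(3) prob_space by simp
  have step: "(\<integral>x. \<psi> (Suc i) x \<partial>riesz_measure) \<le> \<Lambda> (\<psi> i)" for i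
  proof -
    define A where "A = {x. real (Suc i) / N < \<phi> x}"
    have "open A" unfolding A_def by (intro open_Collect_less continuous_on_const \<phi>(1))
    then have A: "A \<in> sets borel" by auto
    have "riesz_outer \<Lambda> A \<le> ennreal (\<Lambda> (\<lambda>x. real N * \<psi> i x))"
    proof (rule riesz_outer_le)
      fix x assume "x \<in> A"
      then have "\<psi> i x = 1 / N" using N by (simp add: A_def \<psi>_def field_simps)
      then show "1 \<le> real N * \<psi> i x" using N by simp
    qed (use \<psi> in \<open>auto intro!: continuous_intros\<close>)
    then have "emeasure riesz_measure A \<le> ennreal (real N * \<Lambda> (\<psi> i))"
      using A \<psi> by (simp add: emeasure_riesz_measure scale)
    then have m: "prob A \<le> real N * \<Lambda> (\<psi> i)"
      using nonneg[OF \<psi>(1)[of i] \<psi>(2)] by (simp add: emeasure_eq_measure)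
    have "(\<integral>x. \<psi> (Suc i) x \<partial>riesz_measure) \<le> (\<integral>x. 1 / N * indicator A x \<partial>riesz_measure)"
    proof (rule integral_mono[OF int])
      show "integrable riesz_measure (\<lambda>x. 1 / real N * indicator A x)"
        using A by (intro integrable_mult_right integrable_real_indicator) (auto simp: emeasure_eq_measure)
      show "\<psi> (Suc i) x \<le> 1 / real N * indicator A x" for x
        using \<psi>(3)[of "Suc i" x] by (auto simp: A_def \<psi>_def indicator_def max_def)
    qed
    also have "\<dots> = prob A / N" using A by simp
    also have "\<dots> \<le> \<Lambda> (\<psi> i)" using m N by (simp add: field_simps)
    finally show ?thesis .
  qed
  obtain K where K: "N = Suc K" using N gr0_implies_Suc by blast
  have "(\<integral>x. \<phi> x \<partial>riesz_measure) = (\<Sum>i<N. \<integral>x. \<psi> i x \<partial>riesz_measure)"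
    by (subst \<phi>_eq) (rule Bochner_Integration.integral_sum, rule int)
  also have "\<dots> = (\<integral>x. \<psi> 0 x \<partial>riesz_measure) + (\<Sum>i<K. \<integral>x. \<psi> (Suc i) x \<partial>riesz_measure)"
    unfolding K by (rule sum.lessThan_Suc_shift)
  also have "\<dots> \<le> 1 / N + (\<Sum>i<K. \<Lambda> (\<psi> i))" by (intro add_mono 0 sum_mono step)
  also have "\<dots> \<le> e + (\<Sum>i<N. \<Lambda> (\<psi> i))"
    using N(2) nonneg[OF \<psi>(1)[of K] \<psi>(2)] by (simp add: K)
  also have "(\<Sum>i<N. \<Lambda> (\<psi> i)) = \<Lambda> \<phi>" by (subst \<phi>_eq) (rule sum[symmetric], auto intro: \<psi>)
  finally show "(\<integral>x. \<phi> x \<partial>riesz_measure) \<le> \<Lambda> \<phi> + e" by simp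
qed

text \<open>One inequality for functions with values between \<open>0\<close> and \<open>1\<close>
  is enough: an affine rescaling brings both \<open>\<phi>\<close> and \<open>- \<phi>\<close> into
  that range, and the two resulting inequalities are opposite.\<close>

lemma integral_riesz_measure:
  assumes \<phi>: "continuous_on UNIV \<phi>"
  shows "(\<integral>x. \<phi> x \<partial>riesz_measure) = \<Lambda> \<phi>"
proof -
  interpret prob_space riesz_measure using borel_prob_riesz_measure by (simp add: borel_prob_def)
  have "bounded (range \<phi>)" using compact_continuous_image[OF \<phi> compact_UNIV] by (rule compact_imp_bounded)
  then obtain B where B: "B > 0" "\<And>x. \<bar>\<phi> x\<bar> \<le> B" by (auto simp: bounded_pos)
  have [measurable]: "\<phi> \<in> borel_measurable riesz_measure"
    using borel_measurable_continuous_onI[OF \<phi>] by (simp cong: measurable_cong_sets)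
  have int: "integrable riesz_measure \<phi>" using B by (intro integrable_const_bound[of _ B]) auto
  have le: "(\<integral>x. \<psi> x \<partial>riesz_measure) \<le> \<Lambda> \<psi>" if \<psi>: "\<psi> = (\<lambda>x. c * \<phi> x)" "c = 1 \<or> c = -1" for \<psi> c
  proof -
    let ?\<chi> = "\<lambda>x. 1/2 + c / (2 * B) * \<phi> x"
    have "\<bar>c / (2 * B) * \<phi> x\<bar> \<le> 1 / 2" for x
      using B \<psi>(2) by (auto simp: abs_mult divide_simps)
    note bd = abs_le_D1[OF this] abs_le_D2[OF this]
    have "0 \<le> ?\<chi> x \<and> ?\<chi> x \<le> 1" for x using bd[of x] by linarith
    then have "(\<integral>x. ?\<chi> x \<partial>riesz_measure) \<le> \<Lambda> ?\<chi>"
      by (intro integral_riesz_measure_le) (use B in \<open>auto intro!: continuous_intros \<phi>\<close>)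
    moreover have "(\<integral>x. ?\<chi> x \<partial>riesz_measure) = 1/2 + c / (2 * B) * (\<integral>x. \<phi> x \<partial>riesz_measure)"
      using int prob_space by simp
    moreover have "\<Lambda> ?\<chi> = 1/2 + c / (2 * B) * \<Lambda> \<phi>"
    proof -
      have "\<Lambda> ?\<chi> = \<Lambda> (\<lambda>_. 1/2 * 1) + \<Lambda> (\<lambda>x. c / (2 * B) * \<phi> x)"
        using add[of "\<lambda>_. 1/2" "\<lambda>x. c / (2 * B) * \<phi> x", OF _ continuous_on_mult_left[OF \<phi>]] by simp
      then show ?thesis using scale[of "\<lambda>_. 1" "1/2"] by (simp only: scale[OF \<phi>] one) simp
    qed
    ultimately have "c * (\<integral>x. \<phi> x \<partial>riesz_measure) \<le> c * \<Lambda> \<phi>"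
      using B by (simp add: divide_simps split: if_splits)
    then show ?thesis using scale[OF \<phi>, of c] \<psi>(1) by simp
  qed
  show ?thesis
    using le[of "\<lambda>x. 1 * \<phi> x" 1] le[of "\<lambda>x. -1 * \<phi> x" "-1"] scale[OF \<phi>, of "-1"] by simp
qed

end

section \<open>Integration over compact spaces\<close>

lemma compact_continuous_bounded:
  fixes \<phi> :: "'b::topological_space \<Rightarrow> 'c::real_normed_vector"
  assumes "compact (UNIV :: 'b set)" "continuous_on UNIV \<phi>"
  obtains B where "B > 0" "\<And>x. norm (\<phi> x) \<le> B"
  using compact_imp_bounded[OF compact_continuous_image[OF assms(2,1)]]
  by (auto simp: bounded_pos)

lemma borel_prob_measurable:
  "borel_prob \<mu> \<Longrightarrow> continuous_on UNIV \<phi> \<Longrightarrow> \<phi> \<in> borel_measurable \<mu>"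
  using borel_measurable_continuous_onI[of \<phi>] by (simp add: borel_prob_def cong: measurable_cong_sets)

lemma borel_prob_integrable_bound:
  fixes \<phi> :: "'b::topological_space \<Rightarrow> 'c::{banach,second_countable_topology}"
  assumes "borel_prob \<mu>" "continuous_on UNIV \<phi>" "\<And>x. norm (\<phi> x) \<le> B"
  shows "integrable \<mu> \<phi>"
proof -
  interpret prob_space \<mu> using assms(1) by (simp add: borel_prob_def)
  show ?thesis
    using assms borel_prob_measurable by (intro integrable_const_bound[of _ B]) auto
qed

lemma borel_prob_integrable:
  fixes \<phi> :: "'b::topological_space \<Rightarrow> 'c::{banach,second_countable_topology}"
  assumes "compact (UNIV :: 'b set)" "borel_prob \<mu>" "continuous_on UNIV \<phi>"
  shows "integrable \<mu> \<phi>"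
  by (rule compact_continuous_bounded[OF assms(1,3)]) (rule borel_prob_integrable_bound[OF assms(2,3)])

lemma borel_prob_integral_const: "borel_prob \<mu> \<Longrightarrow> (\<integral>x. c \<partial>\<mu>) = (c :: 'c::{banach,second_countable_topology})"
  using prob_space.prob_space[of \<mu>] by (simp add: borel_prob_def)

lemma borel_prob_space: "borel_prob \<mu> \<Longrightarrow> space \<mu> = UNIV"
  using sets_eq_imp_space_eq[of \<mu> borel] by (simp add: borel_prob_def)

lemma borel_prob_integral_norm_le:
  fixes \<phi> :: "'b::topological_space \<Rightarrow> 'c::{banach,second_countable_topology}"
  assumes "borel_prob \<mu>" "continuous_on UNIV \<phi>" "\<And>x. norm (\<phi> x) \<le> B"
  shows "norm (\<integral>x. \<phi> x \<partial>\<mu>) \<le> B"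
proof -
  have "norm (\<integral>x. \<phi> x \<partial>\<mu>) \<le> (\<integral>x. norm (\<phi> x) \<partial>\<mu>)" by (rule integral_norm_bound)
  also have "\<dots> \<le> (\<integral>x. B \<partial>\<mu>)"
    using assms by (intro integral_mono integrable_norm borel_prob_integrable_bound[OF assms])
      (auto simp: borel_prob_def prob_space.finite_measure finite_measure.integrable_const)
  finally show ?thesis unfolding borel_prob_integral_const[OF assms(1)] .
qed

text \<open>Closed sets generate the Borel sets and are stable under intersection, and the indicator
  of a nonempty one is the limit of the continuous functions
  \<open>max 0 (1 - real n * infdist x C)\<close>.\<close>

lemma borel_prob_eqI:
  fixes \<mu> \<mu>' :: "'b::metric_space measure"
  assumes \<mu>: "borel_prob \<mu>" "borel_prob \<mu>'"
    and eq: "\<And>\<phi> :: 'b \<Rightarrow> real. continuous_on UNIV \<phi> \<Longrightarrow> (\<integral>x. \<phi> x \<partial>\<mu>) = (\<integral>x. \<phi> x \<partial>\<mu>')"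
  shows "\<mu> = \<mu>'"
proof (rule measure_eqI_generator_eq)
  interpret \<mu>: prob_space \<mu> using \<mu>(1) by (simp add: borel_prob_def)
  interpret \<mu>': prob_space \<mu>' using \<mu>(2) by (simp add: borel_prob_def)
  fix C :: "'b set" assume "C \<in> {C. closed C}"
  then have C: "closed C" by simp
  show "emeasure \<mu> C = emeasure \<mu>' C"
  proof (cases "C = {}")
    case False
    define \<psi> where "\<psi> n x = max 0 (1 - real n * infdist x C)" for n :: nat and x
    have \<psi>: "continuous_on UNIV (\<psi> n)" for n
      unfolding \<psi>_def by (intro continuous_intros)
    have bound: "norm (\<psi> n x) \<le> 1" for n x
      unfolding \<psi>_def by (simp add: infdist_nonneg)
    have lim: "(\<lambda>n. \<psi> n x) \<longlonglongrightarrow> indicator C x" for x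
    proof (cases "x \<in> C")
      case True
      then show ?thesis by (simp add: \<psi>_def)
    next
      case False
      then have pos: "0 < infdist x C"
        using C \<open>C \<noteq> {}\<close> by (intro infdist_pos_not_in_closed)
      then obtain K where K: "1 < real K * infdist x C" using reals_Archimedean3 by blast
      have "\<psi> k x = 0" if "k \<ge> K" for k
      proof -
        have "real K * infdist x C \<le> real k * infdist x C"
          using that pos by (intro mult_right_mono) auto
        then show ?thesis using K by (simp add: \<psi>_def)
      qed
      then show ?thesis using False
        by (intro tendsto_eventually) (auto simp: eventually_sequentially)
    qed
    have conv: "(\<lambda>n. \<integral>x. \<psi> n x \<partial>M) \<longlonglongrightarrow> measure M C" if M: "borel_prob M" for M
    proof -
      interpret M: prob_space M using M by (simp add: borel_prob_def)
      have CM: "C \<in> sets M" using M C by (simp add: borel_prob_def)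
      have "(\<lambda>n. \<integral>x. \<psi> n x \<partial>M) \<longlonglongrightarrow> (\<integral>x. indicator C x \<partial>M)"
        by (rule integral_dominated_convergence[where w = "\<lambda>_. 1"])
          (use lim bound CM borel_prob_measurable[OF M \<psi>] in auto)
      then show ?thesis using CM by simp
    qed
    have "measure \<mu> C = measure \<mu>' C"
      using conv[OF \<mu>(1)] conv[OF \<mu>(2)] by (simp add: eq[OF \<psi>] LIMSEQ_unique)
    then show ?thesis by (simp add: \<mu>.emeasure_eq_measure \<mu>'.emeasure_eq_measure)
  qed simp
next
  show "sets \<mu> = sigma_sets UNIV {C. closed C}" "sets \<mu>' = sigma_sets UNIV {C. closed C}"
    using \<mu> by (simp_all add: borel_prob_def borel_eq_closed)
  show "Int_stable {C :: 'b set. closed C}" by (auto simp: Int_stable_def)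
  show "range (\<lambda>_. UNIV) \<subseteq> {C :: 'b set. closed C}" by auto
  show "emeasure \<mu> UNIV \<noteq> \<infinity>" 
    using \<mu>(1) by (auto simp: borel_prob_def prob_space.finite_measure finite_measure.emeasure_finite)
qed auto

section \<open>The shift space and the transfer operator\<close>

lemma prepend_0 [simp]: "prepend a x 0 = a"
  by (simp add: prepend_def)

lemma shift_prepend [simp]: "shift (prepend a x) = x"
  by (simp add: shift_def prepend_def)

lemma prepend_shift: "prepend (x 0) (shift x) = x"
  by (auto simp: shift_def prepend_def fun_eq_iff split: nat.split)

lemma continuous_on_prepend: "continuous_on UNIV (\<lambda>x. prepend a x)"
  unfolding prepend_def
proof (rule continuous_on_coordinatewise_then_product)
  show "continuous_on UNIV (\<lambda>x. case i of 0 \<Rightarrow> a | Suc n \<Rightarrow> x n)" for i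
    by (cases i) (auto intro: continuous_on_product_coordinates)
qed

lemma continuous_on_prepend_left: "continuous_on UNIV (\<lambda>a. prepend a x)"
  unfolding prepend_def
proof (rule continuous_on_coordinatewise_then_product)
  show "continuous_on UNIV (\<lambda>a. case i of 0 \<Rightarrow> a | Suc n \<Rightarrow> x n)" for i
    by (cases i) auto
qed

lemma continuous_on_shift: "continuous_on UNIV shift"
  unfolding shift_def
  by (rule continuous_on_coordinatewise_then_product) (auto intro: continuous_on_product_coordinates)

lemmas continuous_on_prepend_leftI = continuous_on_compose2[OF _ continuous_on_prepend_left subset_UNIV]
lemmas continuous_on_shiftI = continuous_on_compose2[OF _ continuous_on_shift subset_UNIV]

text \<open>The value type is left open because the same operator acts on real functions for the
  pressure and on complex ones for characteristic functions.\<close>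

definition transfer ::
  "'a::metric_space measure \<Rightarrow> ((nat \<Rightarrow> 'a) \<Rightarrow> real) \<Rightarrow> ((nat \<Rightarrow> 'a) \<Rightarrow> 'b::{banach,second_countable_topology}) \<Rightarrow>
    (nat \<Rightarrow> 'a) \<Rightarrow> 'b"
where
  "transfer \<nu> F w x = (\<integral>a. exp (F (prepend a x)) *\<^sub>R w (prepend a x) \<partial>\<nu>)"

lemma ruelle_eq_transfer: "ruelle \<nu> f w = transfer \<nu> f w"
  by (simp add: ruelle_def transfer_def fun_eq_iff)

definition normalized :: "'a::metric_space measure \<Rightarrow> ((nat \<Rightarrow> 'a) \<Rightarrow> real) \<Rightarrow> bool" where
  "normalized \<nu> F \<longleftrightarrow> continuous_on UNIV F \<and> (\<forall>x. transfer \<nu> F (\<lambda>_. 1 :: real) x = 1)"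

definition seq_lipschitz :: "real \<Rightarrow> ((nat \<Rightarrow> 'a::metric_space) \<Rightarrow> real) \<Rightarrow> bool" where
  "seq_lipschitz L f \<longleftrightarrow> (\<forall>x y. \<bar>f x - f y\<bar> \<le> L * seq_dist x y)"

text \<open>Since \<open>shift\<close> undoes \<open>prepend\<close>, the factor is constant under
  the integral. This is how coboundary terms and Birkhoff sums leave the operator.\<close>

lemma transfer_shift_mult:
  fixes \<phi> :: "_ \<Rightarrow> 'b::{real_normed_field,banach,second_countable_topology}"
  shows "transfer \<nu> F (\<lambda>x. \<phi> (shift x) * w x) x = \<phi> x * transfer \<nu> F w x"
  by (simp add: transfer_def flip: mult_scaleR_right)

lemma abs_ln_diff_le:
  fixes a b c :: real
  assumes "0 < c" "c \<le> a" "c \<le> b"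
  shows "\<bar>ln a - ln b\<bar> \<le> \<bar>a - b\<bar> / c"
proof -
  have le: "ln s - ln t \<le> \<bar>s - t\<bar> / c" if "c \<le> s" "c \<le> t" for s t
  proof -
    have "ln s - ln t = ln (s / t)" using that assms by (subst ln_divide_pos) auto
    also have "\<dots> \<le> s / t - 1" using that assms by (intro ln_le_minus_one) auto
    also have "\<dots> = (s - t) / t" using that assms by (simp add: field_simps)
    also have "\<dots> \<le> \<bar>s - t\<bar> / t" using that assms by (intro divide_right_mono) auto
    also have "\<dots> \<le> \<bar>s - t\<bar> / c" using that assms by (intro divide_left_mono) auto
    finally show ?thesis .
  qed
  show ?thesis using le[of a b] le[of b a] assms unfolding abs_minus_commute[of b] by linarith
qed

locale full_shift =
  fixes \<nu> :: "'a::metric_space measure"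
  assumes compact_alphabet: "compact (UNIV :: 'a set)"
    and diameter_alphabet: "diameter (UNIV :: 'a set) = 1"
    and borel_prob_\<nu>: "borel_prob \<nu>"
begin

sublocale \<nu>: prob_space \<nu>
  using borel_prob_\<nu> by (simp add: borel_prob_def)

lemma compact_sequences: "compact (UNIV :: (nat \<Rightarrow> 'a) set)"
proof -
  have "compact_space (product_topology (\<lambda>_::nat. euclidean :: 'a topology) UNIV)"
    using compact_alphabet
    by (simp add: compact_space_product_topology) (simp add: compact_space_def)
  then show ?thesis by (simp only: euclidean_product_topology compact_space_def topspace_euclidean compactin_euclidean_iff)
qed

lemma continuous_bounded:
  fixes \<phi> :: "(nat \<Rightarrow> 'a) \<Rightarrow> 'c::real_normed_vector"
  assumes "continuous_on UNIV \<phi>"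
  obtains B where "B > 0" "\<And>x. norm (\<phi> x) \<le> B"
  by (rule compact_continuous_bounded[OF compact_sequences assms]) (rule that)

lemmas integrable_continuous = borel_prob_integrable[OF compact_sequences]

section \<open>The metric under prepending and shifting\<close>

lemma seq_dist_nonneg: "0 \<le> seq_dist x (y :: nat \<Rightarrow> 'a)"
  using seq_dist_ge[OF compact_alphabet diameter_alphabet, of 0 x y]
  by (smt (verit) divide_nonneg_nonneg mult_nonneg_nonneg power_divide power_one zero_le_dist zero_le_power)

lemma seq_dist_commute: "seq_dist x (y :: nat \<Rightarrow> 'a) = seq_dist y x"
  by (simp add: seq_dist_def dist_commute)

lemma seq_dist_split: "seq_dist x (y :: nat \<Rightarrow> 'a) = dist (x 0) (y 0) / 2 + seq_dist (shift x) (shift y) / 2"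
proof -
  note S = summable_seq_dist[OF compact_alphabet diameter_alphabet]
  have "seq_dist x y = (\<Sum>n. (1/2) ^ Suc (Suc n) * dist (x (Suc n)) (y (Suc n))) + dist (x 0) (y 0) / 2"
    using suminf_split_head[OF S, of x y] by (simp add: seq_dist_def)
  also have "(\<Sum>n. (1/2) ^ Suc (Suc n) * dist (x (Suc n)) (y (Suc n)))
      = (\<Sum>n. 1/2 * ((1/2) ^ Suc n * dist (shift x n) (shift y n)))"
    by (simp add: shift_def)
  also have "\<dots> = 1/2 * seq_dist (shift x) (shift y)"
    unfolding seq_dist_def by (rule suminf_mult[OF S])
  finally show ?thesis by simp
qed

text \<open>This factor \<open>1/2\<close> drives all contraction estimates below.\<close>

lemma seq_dist_prepend: "seq_dist (prepend a x) (prepend a y :: nat \<Rightarrow> 'a) = seq_dist x y / 2"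
  by (subst seq_dist_split) simp

lemma seq_dist_shift_le: "seq_dist (shift x) (shift y :: nat \<Rightarrow> 'a) \<le> 2 * seq_dist x y"
  by (subst (2) seq_dist_split) simp

lemma seq_dist_le_1: "seq_dist x (y :: nat \<Rightarrow> 'a) \<le> 1"
proof -
  note S = summable_seq_dist[OF compact_alphabet diameter_alphabet]
  have "seq_dist x y \<le> (\<Sum>n. (1/2) ^ Suc n)"
    unfolding seq_dist_def
    using dist_le_1[OF compact_alphabet diameter_alphabet]
    by (intro suminf_le S) (auto simp: mult_left_le summable_geometric)
  also have "\<dots> = 1" using power_half_series by (rule sums_unique[symmetric])
  finally show ?thesis .
qed

lemma seq_dist_self [simp]: "seq_dist x (x :: nat \<Rightarrow> 'a) = 0"
  by (simp add: seq_dist_def)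

lemma seq_lipschitz_continuous:
  assumes "seq_lipschitz L (f :: (nat \<Rightarrow> 'a) \<Rightarrow> real)"
  shows "continuous_on UNIV f"
proof -
  have "(f \<longlongrightarrow> f x) (at x)" for x
  proof (rule LIM_zero_cancel, rule Lim_null_comparison)
    have "norm (f y - f x) \<le> L * seq_dist x y" for y
      using assms unfolding seq_dist_commute[of x y] by (simp add: seq_lipschitz_def)
    then show "\<forall>\<^sub>F y in at x. norm (f y - f x) \<le> L * seq_dist x y" by simp
    have "((\<lambda>y. L * seq_dist x y) \<longlongrightarrow> L * seq_dist x x) (at x)"
      using continuous_on_seq_dist[OF compact_alphabet diameter_alphabet]
      by (intro tendsto_mult tendsto_const) (simp add: continuous_on_def del: seq_dist_self)
    then show "((\<lambda>y. L * seq_dist x y) \<longlongrightarrow> 0) (at x)" by simp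
  qed
  then show ?thesis by (simp add: continuous_on_def)
qed

section \<open>The algebra of Lipschitz functions\<close>

lemma Lip_iff: "f \<in> Lip \<longleftrightarrow> (\<exists>L>0. seq_lipschitz L (f :: (nat \<Rightarrow> 'a) \<Rightarrow> real))"
proof
  assume "f \<in> Lip"
  then obtain L where L: "\<And>x y. \<bar>f x - f y\<bar> \<le> L * seq_dist x y" by (auto simp: Lip_def)
  have "\<bar>f x - f y\<bar> \<le> max L 1 * seq_dist x y" for x y
    using L[of x y] mult_right_mono[OF max.cobounded1[of L 1] seq_dist_nonneg[of x y]] by linarith
  then show "\<exists>L>0. seq_lipschitz L f" by (intro exI[of _ "max L 1"]) (auto simp: seq_lipschitz_def)
qed (auto simp: Lip_def seq_lipschitz_def)

lemma LipE:
  assumes "(f :: (nat \<Rightarrow> 'a) \<Rightarrow> real) \<in> Lip"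
  obtains L where "L > 0" "seq_lipschitz L f"
  using assms by (auto simp: Lip_iff)

lemma LipI: "(\<And>x y. \<bar>f x - f y\<bar> \<le> L * seq_dist x y) \<Longrightarrow> f \<in> Lip"
  by (auto simp: Lip_def)

lemma Lip_continuous: "(f :: (nat \<Rightarrow> 'a) \<Rightarrow> real) \<in> Lip \<Longrightarrow> continuous_on UNIV f"
  using seq_lipschitz_continuous by (auto simp: Lip_iff)

lemma Lip_const: "(\<lambda>_ :: nat \<Rightarrow> 'a. c :: real) \<in> Lip"
  by (rule LipI[of _ 0]) simp

lemma Lip_add:
  assumes "(f :: (nat \<Rightarrow> 'a) \<Rightarrow> real) \<in> Lip" "g \<in> Lip"
  shows "(\<lambda>x. f x + g x) \<in> Lip"
proof -
  obtain L M where "\<And>x y. \<bar>f x - f y\<bar> \<le> L * seq_dist x y" "\<And>x y. \<bar>g x - g y\<bar> \<le> M * seq_dist x y"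
    using assms by (auto simp: Lip_def)
  then show ?thesis
    by (intro LipI[of _ "L + M"]) (smt (verit) distrib_right)
qed

lemma Lip_mult:
  assumes "(f :: (nat \<Rightarrow> 'a) \<Rightarrow> real) \<in> Lip" "g \<in> Lip"
  shows "(\<lambda>x. f x * g x) \<in> Lip"
proof -
  obtain L where L: "\<And>x y. \<bar>f x - f y\<bar> \<le> L * seq_dist x y" using assms by (auto simp: Lip_def)
  obtain M where M: "\<And>x y. \<bar>g x - g y\<bar> \<le> M * seq_dist x y" using assms by (auto simp: Lip_def)
  obtain A where A: "A > 0" "\<And>x. \<bar>f x\<bar> \<le> A" using continuous_bounded[OF Lip_continuous[OF assms(1)]] by auto
  obtain B where B: "B > 0" "\<And>x. \<bar>g x\<bar> \<le> B" using continuous_bounded[OF Lip_continuous[OF assms(2)]] by auto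
  show ?thesis
  proof (rule LipI)
    fix x y
    have "f x * g x - f y * g y = f x * (g x - g y) + (f x - f y) * g y" by (simp add: algebra_simps)
    then have "\<bar>f x * g x - f y * g y\<bar> \<le> \<bar>f x\<bar> * \<bar>g x - g y\<bar> + \<bar>f x - f y\<bar> * \<bar>g y\<bar>"
      by (metis abs_mult abs_triangle_ineq)
    also have "\<dots> \<le> A * (M * seq_dist x y) + (L * seq_dist x y) * B"
      using A B L M 
      by (intro add_mono mult_mono) (auto intro: order_trans[OF abs_ge_zero L] less_imp_le)
    also have "\<dots> = (A * M + L * B) * seq_dist x y" by (simp add: algebra_simps)
    finally show "\<bar>f x * g x - f y * g y\<bar> \<le> (A * M + L * B) * seq_dist x y" .
  qed
qed

lemma Lip_cmult: "(f :: (nat \<Rightarrow> 'a) \<Rightarrow> real) \<in> Lip \<Longrightarrow> (\<lambda>x. c * f x) \<in> Lip"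
  by (intro Lip_mult Lip_const)

lemma Lip_diff: "(f :: (nat \<Rightarrow> 'a) \<Rightarrow> real) \<in> Lip \<Longrightarrow> g \<in> Lip \<Longrightarrow> (\<lambda>x. f x - g x) \<in> Lip"
  using Lip_add[of f "\<lambda>x. -1 * g x"] Lip_cmult[of g "-1"] by simp

lemma Lip_shift:
  assumes "(f :: (nat \<Rightarrow> 'a) \<Rightarrow> real) \<in> Lip"
  shows "(\<lambda>x. f (shift x)) \<in> Lip"
proof -
  obtain L where L: "L > 0" "seq_lipschitz L f" using assms by (rule LipE)
  show ?thesis
  proof (rule LipI)
    fix x y
    have "\<bar>f (shift x) - f (shift y)\<bar> \<le> L * seq_dist (shift x) (shift y)"
      using L by (simp add: seq_lipschitz_def)
    also have "\<dots> \<le> L * (2 * seq_dist x y)" using L by (intro mult_left_mono seq_dist_shift_le) auto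
    finally show "\<bar>f (shift x) - f (shift y)\<bar> \<le> (L * 2) * seq_dist x y" by simp
  qed
qed

lemma Lip_compose:
  assumes f: "(f :: (nat \<Rightarrow> 'a) \<Rightarrow> real) \<in> Lip" and "0 \<le> C"
    and h: "\<And>x y. \<bar>h (f x) - h (f y)\<bar> \<le> C * \<bar>f x - f y\<bar>"
  shows "(\<lambda>x. h (f x)) \<in> Lip"
proof -
  obtain L where L: "\<And>x y. \<bar>f x - f y\<bar> \<le> L * seq_dist x y" using f by (auto simp: Lip_def)
  have "\<bar>h (f x) - h (f y)\<bar> \<le> (C * L) * seq_dist x y" for x y
    using h[of x y] mult_left_mono[OF L[of x y] \<open>0 \<le> C\<close>] by (simp add: mult.assoc)
  then show ?thesis by (rule LipI)
qed

lemma Lip_exp: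
  assumes f: "(f :: (nat \<Rightarrow> 'a) \<Rightarrow> real) \<in> Lip"
  shows "(\<lambda>x. exp (f x)) \<in> Lip"
proof -
  obtain B where B: "\<And>x. \<bar>f x\<bar> \<le> B" using continuous_bounded[OF Lip_continuous[OF f]] by auto
  have le: "exp s - exp t \<le> exp B * \<bar>s - t\<bar>" if "\<bar>s\<bar> \<le> B" for s t :: real
  proof -
    have "exp s - exp t = exp s * (1 - exp (t - s))" by (simp add: algebra_simps flip: exp_add)
    also have "\<dots> \<le> exp s * (s - t)" 
      using exp_ge_add_one_self[of "t - s"] by (intro mult_left_mono exp_ge_zero) linarith
    also have "\<dots> \<le> exp s * \<bar>s - t\<bar>" by (intro mult_left_mono) auto
    also have "\<dots> \<le> exp B * \<bar>s - t\<bar>" using that by (intro mult_right_mono) auto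
    finally show ?thesis .
  qed
  show ?thesis
  proof (rule Lip_compose[OF f, of "exp B"])
    show "\<bar>exp (f x) - exp (f y)\<bar> \<le> exp B * \<bar>f x - f y\<bar>" for x y
      using le[OF B, of x "f y"] le[OF B, of y "f x"] unfolding abs_minus_commute[of "f y"] by linarith
  qed auto
qed

lemma Lip_ln:
  assumes f: "(f :: (nat \<Rightarrow> 'a) \<Rightarrow> real) \<in> Lip" and pos: "\<And>x. 0 < f x"
  shows "(\<lambda>x. ln (f x)) \<in> Lip"
proof -
  obtain z where z: "\<And>x. f z \<le> f x"
    using continuous_attains_inf[OF compact_sequences _ Lip_continuous[OF f]] by auto
  show ?thesis
    by (rule Lip_compose[OF f, of "1 / f z"])
      (use abs_ln_diff_le[OF pos[of z] z z] pos[of z] in \<open>auto simp: less_imp_le\<close>)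
qed

section \<open>Continuity, linearity and monotonicity of the transfer operator\<close>

lemma continuous_branch:
  fixes w :: "(nat \<Rightarrow> 'a) \<Rightarrow> 'b::real_normed_vector"
  assumes "continuous_on UNIV F" "continuous_on UNIV w"
  shows "continuous_on UNIV (\<lambda>a. exp (F (prepend a x)) *\<^sub>R w (prepend a x))"
  using continuous_on_prepend_leftI[OF assms(1)] continuous_on_prepend_leftI[OF assms(2)]
  by (intro continuous_intros) auto

lemma integrable_branch:
  fixes w :: "(nat \<Rightarrow> 'a) \<Rightarrow> 'b::{banach,second_countable_topology}"
  assumes "continuous_on UNIV F" "continuous_on UNIV w"
  shows "integrable \<nu> (\<lambda>a. exp (F (prepend a x)) *\<^sub>R w (prepend a x))"
  by (rule borel_prob_integrable[OF compact_alphabet borel_prob_\<nu> continuous_branch[OF assms]])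

lemma measurable_branch:
  fixes w :: "(nat \<Rightarrow> 'a) \<Rightarrow> 'b::{banach,second_countable_topology}"
  assumes "continuous_on UNIV F" "continuous_on UNIV w"
  shows "(\<lambda>a. exp (F (prepend a x)) *\<^sub>R w (prepend a x)) \<in> borel_measurable \<nu>"
  using integrable_branch[OF assms] by (rule borel_measurable_integrable)

lemma transfer_tendsto:
  fixes W :: "nat \<Rightarrow> (nat \<Rightarrow> 'a) \<Rightarrow> 'b::{banach,second_countable_topology}"
  assumes F: "continuous_on UNIV F" and W: "\<And>n. continuous_on UNIV (W n)" "continuous_on UNIV w"
    and lim: "\<And>x. (\<lambda>n. W n x) \<longlonglongrightarrow> w x" and B: "\<And>n x. norm (W n x) \<le> B"
  shows "(\<lambda>n. transfer \<nu> F (W n) x) \<longlonglongrightarrow> transfer \<nu> F w x"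
proof -
  obtain C where C: "C > 0" "\<And>x. norm (F x) \<le> C" using continuous_bounded[OF F] by blast
  show ?thesis
    unfolding transfer_def
  proof (rule integral_dominated_convergence[where w = "\<lambda>_. exp C * B"])
    show "AE a in \<nu>. (\<lambda>n. exp (F (prepend a x)) *\<^sub>R W n (prepend a x))
        \<longlonglongrightarrow> exp (F (prepend a x)) *\<^sub>R w (prepend a x)"
      by (intro AE_I2 tendsto_intros lim)
    show "AE a in \<nu>. norm (exp (F (prepend a x)) *\<^sub>R W n (prepend a x)) \<le> exp C * B" for n
      using C(2) B by (intro AE_I2) (auto intro!: mult_mono simp: abs_le_iff)
  qed (use F W in \<open>auto intro: measurable_branch\<close>)
qed

lemma continuous_transfer:
  fixes w :: "(nat \<Rightarrow> 'a) \<Rightarrow> 'b::{banach,second_countable_topology}"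
  assumes F: "continuous_on UNIV F" and w: "continuous_on UNIV w"
  shows "continuous_on UNIV (transfer \<nu> F w)"
proof -
  obtain C where C: "C > 0" "\<And>x. norm (F x) \<le> C" using continuous_bounded[OF F] by blast
  obtain B where B: "B > 0" "\<And>x. norm (w x) \<le> B" using continuous_bounded[OF w] by blast
  \<comment> \<open>The product topology is first countable, so continuity may be tested along
    sequences, where dominated convergence applies.\<close>
  have "(\<lambda>n. transfer \<nu> F w (s n)) \<longlonglongrightarrow> transfer \<nu> F w x" if s: "s \<longlonglongrightarrow> x" for s x
    unfolding transfer_def
  proof (rule integral_dominated_convergence[where w = "\<lambda>_. exp C * B"])
    have "(\<lambda>n. prepend a (s n)) \<longlonglongrightarrow> prepend a x" for a
      using continuous_on_tendsto_compose[OF continuous_on_prepend s] by auto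
    then show "AE a in \<nu>. (\<lambda>n. exp (F (prepend a (s n))) *\<^sub>R w (prepend a (s n)))
        \<longlonglongrightarrow> exp (F (prepend a x)) *\<^sub>R w (prepend a x)"
      by (intro AE_I2 tendsto_intros continuous_on_tendsto_compose[OF F] continuous_on_tendsto_compose[OF w]) auto
    show "AE a in \<nu>. norm (exp (F (prepend a (s n))) *\<^sub>R w (prepend a (s n))) \<le> exp C * B" for n
      using C(2) B by (intro AE_I2) (auto intro!: mult_mono simp: abs_le_iff)
  qed (use F w in \<open>auto intro: measurable_branch\<close>)
  then show ?thesis
    unfolding continuous_on_eq_continuous_within continuous_within_sequentially
    by (auto simp: o_def)
qed

lemma transfer_add:
  fixes w v :: "(nat \<Rightarrow> 'a) \<Rightarrow> 'b::{banach,second_countable_topology}"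
  assumes "continuous_on UNIV F" "continuous_on UNIV w" "continuous_on UNIV v"
  shows "transfer \<nu> F (\<lambda>x. w x + v x) x = transfer \<nu> F w x + transfer \<nu> F v x"
  using assms by (simp add: transfer_def scaleR_add_right integrable_branch)

lemma transfer_diff:
  fixes w v :: "(nat \<Rightarrow> 'a) \<Rightarrow> 'b::{banach,second_countable_topology}"
  assumes "continuous_on UNIV F" "continuous_on UNIV w" "continuous_on UNIV v"
  shows "transfer \<nu> F (\<lambda>x. w x - v x) x = transfer \<nu> F w x - transfer \<nu> F v x"
  using assms by (simp add: transfer_def scaleR_diff_right integrable_branch)

lemma transfer_mult:
  fixes c :: "'b::{real_normed_field,banach,second_countable_topology}"
  shows "transfer \<nu> F (\<lambda>x. c * w x) x = c * transfer \<nu> F w x"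
  using transfer_shift_mult[of \<nu> F "\<lambda>_. c"] .

lemma transfer_of_real:
  assumes "continuous_on UNIV F" "continuous_on UNIV w"
  shows "transfer \<nu> F (\<lambda>x. of_real (w x) :: 'b::{real_normed_field,banach,second_countable_topology}) x
    = of_real (transfer \<nu> F w x)"
proof -
  have "transfer \<nu> F (\<lambda>x. of_real (w x) :: 'b) x
      = (\<integral>a. of_real (exp (F (prepend a x)) * w (prepend a x)) \<partial>\<nu>)"
    by (simp add: transfer_def scaleR_conv_of_real)
  also have "\<dots> = of_real (\<integral>a. exp (F (prepend a x)) * w (prepend a x) \<partial>\<nu>)"
    using integrable_branch[OF assms] by (intro integral_of_real) simp
  finally show ?thesis by (simp add: transfer_def)
qed

lemma transfer_mono:
  fixes w v :: "(nat \<Rightarrow> 'a) \<Rightarrow> real"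
  assumes "continuous_on UNIV F" "continuous_on UNIV w" "continuous_on UNIV v" "\<And>x. w x \<le> v x"
  shows "transfer \<nu> F w x \<le> transfer \<nu> F v x"
  unfolding transfer_def using assms
  by (intro integral_mono integrable_branch) (auto intro: scaleR_left_mono)

lemma transfer_shift:
  fixes \<phi> :: "_ \<Rightarrow> 'b::{banach,second_countable_topology}"
  assumes "normalized \<nu> F"
  shows "transfer \<nu> F (\<lambda>x. \<phi> (shift x)) x = \<phi> x"
proof -
  have "transfer \<nu> F (\<lambda>x. \<phi> (shift x)) x = transfer \<nu> F (\<lambda>_. 1 :: real) x *\<^sub>R \<phi> x"
    using assms integrable_branch[of F "\<lambda>_. 1 :: real" x]
    by (simp add: transfer_def normalized_def)
  then show ?thesis using assms by (simp add: normalized_def)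
qed

lemma transfer_const:
  fixes c :: "'b::{banach,second_countable_topology}"
  assumes "normalized \<nu> F"
  shows "transfer \<nu> F (\<lambda>_. c) x = c"
  by (rule transfer_shift[OF assms])

lemma transfer_norm_le:
  fixes w :: "(nat \<Rightarrow> 'a) \<Rightarrow> 'b::{banach,second_countable_topology}"
  assumes F: "normalized \<nu> F" and w: "continuous_on UNIV w"
    and B: "\<And>x. norm (w x) \<le> B"
  shows "norm (transfer \<nu> F w x) \<le> B"
proof -
  have "norm (transfer \<nu> F w x) \<le> (\<integral>a. norm (exp (F (prepend a x)) *\<^sub>R w (prepend a x)) \<partial>\<nu>)"
    unfolding transfer_def by (rule integral_norm_bound)
  also have "\<dots> = transfer \<nu> F (\<lambda>x. norm (w x)) x" by (simp add: transfer_def)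
  also have "\<dots> \<le> transfer \<nu> F (\<lambda>_. B) x" 
    using F w B by (intro transfer_mono) (auto intro: continuous_intros simp: normalized_def)
  also have "\<dots> = B" by (rule transfer_const[OF F])
  finally show ?thesis .
qed

end

section \<open>Cones of log-Lipschitz functions\<close>

text \<open>The condition that \<open>ln (w x)\<close> is \<open>K\<close>-Lipschitz, written
  multiplicatively because this form passes through an integral.\<close>

definition cone :: "real \<Rightarrow> ((nat \<Rightarrow> 'a::metric_space) \<Rightarrow> real) \<Rightarrow> bool" where
  "cone K w \<longleftrightarrow> (\<forall>x. 0 < w x) \<and> (\<forall>x y. w x \<le> exp (K * seq_dist x y) * w y)"

context full_shift
begin

lemma cone_ln_Lipschitz:
  assumes "cone K (w :: (nat \<Rightarrow> 'a) \<Rightarrow> real)"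
  shows "seq_lipschitz K (\<lambda>x. ln (w x))"
proof -
  have "ln (w x) - ln (w y) \<le> K * seq_dist x y" for x y
  proof -
    have "ln (w x) \<le> ln (exp (K * seq_dist x y) * w y)" using assms by (simp add: cone_def)
    also have "\<dots> = K * seq_dist x y + ln (w y)" using assms by (simp add: cone_def ln_mult_pos)
    finally show ?thesis by simp
  qed
  then show ?thesis
    unfolding seq_lipschitz_def abs_le_iff by (metis minus_diff_eq seq_dist_commute)
qed

lemma cone_continuous:
  assumes "cone K (w :: (nat \<Rightarrow> 'a) \<Rightarrow> real)"
  shows "continuous_on UNIV w"
proof -
  have "continuous_on UNIV (\<lambda>x. exp (ln (w x)))"
    by (intro continuous_intros seq_lipschitz_continuous[OF cone_ln_Lipschitz[OF assms]])
  then show ?thesis using assms by (simp add: cone_def)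
qed

lemma cone_mono: "cone K (w :: (nat \<Rightarrow> 'a) \<Rightarrow> real) \<Longrightarrow> K \<le> K' \<Longrightarrow> cone K' w"
  unfolding cone_def
  by (meson exp_le_cancel_iff less_imp_le mult_right_mono order_trans seq_dist_nonneg)

lemma cone_one: "0 \<le> K \<Longrightarrow> cone K (\<lambda>_ :: nat \<Rightarrow> 'a. 1)"
  by (simp add: cone_def seq_dist_nonneg)

lemma transfer_pos:
  assumes F: "continuous_on UNIV F" and w: "continuous_on UNIV w" "\<And>x. (0::real) < w x"
  shows "0 < transfer \<nu> F w x"
proof -
  have "continuous_on UNIV (\<lambda>x. exp (F x) * w x)" using F w by (intro continuous_intros)
  then obtain z where z: "\<And>x. exp (F z) * w z \<le> exp (F x) * w x"
    using continuous_attains_inf[OF compact_sequences] by auto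
  have "0 < exp (F z) * w z" using w by simp
  also have "\<dots> = (\<integral>a. exp (F z) * w z \<partial>\<nu>)" using \<nu>.prob_space by simp
  also have "\<dots> \<le> transfer \<nu> F w x"
    unfolding transfer_def using z by (intro integral_mono integrable_branch F w) auto
  finally show ?thesis .
qed

text \<open>Branch by branch: prepending halves the distance \<open>d\<close> of \<open>x\<close>
  and \<open>y\<close>, so exchanging them costs \<open>exp (A * d / 2)\<close> in the weight and
  \<open>exp (K * d / 2)\<close> in \<open>w\<close>. Hence the constant \<open>A\<close> is
  preserved, and \<open>2 * A\<close> improves to \<open>3/2 * A\<close>; the contraction rests on
  this slack.\<close>

lemma cone_transfer:
  assumes F: "seq_lipschitz A F" and w: "cone K (w :: (nat \<Rightarrow> 'a) \<Rightarrow> real)"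
  shows "cone ((A + K) / 2) (transfer \<nu> F w)"
  unfolding cone_def
proof (intro conjI allI)
  note cF = seq_lipschitz_continuous[OF F] and cw = cone_continuous[OF w]
  show "0 < transfer \<nu> F w x" for x using w by (intro transfer_pos cF cw) (simp add: cone_def)
  fix x y :: "nat \<Rightarrow> 'a"
  let ?e = "exp ((A + K) / 2 * seq_dist x y)"
  have "transfer \<nu> F w x \<le> (\<integral>a. ?e * (exp (F (prepend a y)) *\<^sub>R w (prepend a y)) \<partial>\<nu>)"
    unfolding transfer_def
  proof (intro integral_mono integrable_mult_right integrable_branch cF cw)
    fix a
    have "F (prepend a x) \<le> F (prepend a y) + A * (seq_dist x y / 2)"
      using F unfolding seq_lipschitz_def abs_le_iff by (metis diff_le_eq add.commute seq_dist_prepend)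
    moreover have "w (prepend a x) \<le> exp (K * (seq_dist x y / 2)) * w (prepend a y)"
      using w unfolding cone_def by (metis seq_dist_prepend)
    ultimately have "exp (F (prepend a x)) * w (prepend a x)
        \<le> exp (F (prepend a y) + A * (seq_dist x y / 2)) * (exp (K * (seq_dist x y / 2)) * w (prepend a y))"
      using w by (intro mult_mono) (auto simp: cone_def less_imp_le)
    also have "\<dots> = ?e * (exp (F (prepend a y)) * w (prepend a y))"
    proof -
      have "exp (F (prepend a y) + A * (seq_dist x y / 2)) * exp (K * (seq_dist x y / 2)) = ?e * exp (F (prepend a y))"
        unfolding exp_add[symmetric] by (simp add: field_simps)
      then show ?thesis unfolding mult.assoc[symmetric] by simp
    qed
    finally show "exp (F (prepend a x)) *\<^sub>R w (prepend a x)
        \<le> ?e * (exp (F (prepend a y)) *\<^sub>R w (prepend a y))" by simp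
  qed
  then show "transfer \<nu> F w x \<le> ?e * transfer \<nu> F w y"
    by (simp add: transfer_def)
qed

text \<open>The gap between \<open>3/2 * A\<close> and \<open>2 * A\<close> pays for the removal of
  \<open>\<eta>\<close>. With \<open>s = exp (A * d / 2)\<close> for the distance \<open>d\<close>,
  the two constants give the factors \<open>s ^ 3\<close> and \<open>s ^ 4\<close>, and
  \<open>4 * \<eta> \<le> w y\<close> reduces the claim to
  \<open>s ^ 3 \<le> (3 * s ^ 4 + 1) / 4\<close>, the inequality of means for three copies of
  \<open>s ^ 4\<close> and one \<open>1\<close>.\<close>

lemma cone_diff_const:
  assumes w: "cone (3/2 * A) (w :: (nat \<Rightarrow> 'a) \<Rightarrow> real)" and "0 \<le> A"
    and \<eta>: "0 \<le> \<eta>" "\<And>x. 4 * \<eta> \<le> w x"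
  shows "cone (2 * A) (\<lambda>x. w x - \<eta>)"
  unfolding cone_def
proof (intro conjI allI)
  show "0 < w x - \<eta>" for x
  proof (cases "\<eta> = 0")
    case False
    then show ?thesis using \<eta>(2)[of x] \<eta>(1) by linarith
  qed (use w in \<open>simp add: cone_def\<close>)
  fix x y :: "nat \<Rightarrow> 'a"
  define s where "s = exp (A * seq_dist x y / 2)"
  have s3: "exp (3/2 * A * seq_dist x y) = s ^ 3" and s4: "exp (2 * A * seq_dist x y) = s ^ 4"
    unfolding s_def by (simp_all flip: exp_of_nat_mult)
  have "s ^ 3 \<le> (3 * s ^ 4 + 1) / 4"
  proof -
    have "3 * s ^ 4 + 1 - 4 * s ^ 3 = (s - 1)\<^sup>2 * (2 * s\<^sup>2 + (s + 1)\<^sup>2)"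
      by (simp add: power2_eq_square power3_eq_cube power4_eq_xxxx algebra_simps)
    also have "0 \<le> (s - 1)\<^sup>2 * (2 * s\<^sup>2 + (s + 1)\<^sup>2)" by simp
    finally show ?thesis by simp
  qed
  then have "s ^ 3 * w y \<le> (3 * s ^ 4 + 1) / 4 * w y"
    using w by (intro mult_right_mono) (auto simp: cone_def less_imp_le)
  moreover have "w x \<le> s ^ 3 * w y" using w s3 by (metis cone_def)
  moreover have "(s ^ 4 - 1) * (4 * \<eta>) \<le> (s ^ 4 - 1) * w y"
    using \<eta> \<open>0 \<le> A\<close> seq_dist_nonneg[of x y] by (intro mult_left_mono) (simp_all flip: s4)
  ultimately have "w x - \<eta> \<le> s ^ 4 * (w y - \<eta>)" by (simp add: field_simps)
  then show "w x - \<eta> \<le> exp (2 * A * seq_dist x y) * (w y - \<eta>)" by (simp add: s4)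
qed

lemma transfer_ge:
  assumes "normalized \<nu> F" "continuous_on UNIV w" "\<And>y. (c::real) \<le> w y"
  shows "c \<le> transfer \<nu> F w x"
  using transfer_mono[of F "\<lambda>_. c" w x] assms transfer_const[OF assms(1), of c x]
  by (simp add: normalized_def)

lemma transfer_le:
  assumes "normalized \<nu> F" "continuous_on UNIV w" "\<And>y. w y \<le> (c::real)"
  shows "transfer \<nu> F w x \<le> c"
  using transfer_mono[of F w "\<lambda>_. c" x] assms transfer_const[OF assms(1), of c x]
  by (simp add: normalized_def)

text \<open>
  A function of the cone is at least \<open>exp (- 2 * A)\<close> times its maximum, and a quarter of the minimum
  of its image can be split off as a constant without leaving the cone. So the cone part of the
  iterates shrinks geometrically, and only this part oscillates.
\<close>

lemma cone_contraction:
  fixes v :: "nat \<Rightarrow> (nat \<Rightarrow> 'a) \<Rightarrow> real"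
  assumes "0 \<le> A" and F: "\<And>n. seq_lipschitz A (F n)" "\<And>n. normalized \<nu> (F n)"
    and v0: "cone (2 * A) (v 0)" "\<And>x. v 0 x \<le> W"
    and v: "\<And>n. v (Suc n) = transfer \<nu> (F n) (v n)"
  shows "\<bar>v n x - v n y\<bar> \<le> (exp (2 * A * seq_dist x y) - 1) * (W * (1 - exp (- 2 * A) / 4) ^ n)"
proof -
  let ?\<theta> = "1 - exp (- 2 * A) / 4"
  have \<theta>: "0 \<le> ?\<theta>" using \<open>0 \<le> A\<close> exp_le_one_iff[of "-2 * A"] by linarith
  \<comment> \<open>\<open>b\<close> collects the constants removed so far, which normalized
    operators reproduce unchanged; \<open>r\<close> is the part that still oscillates.\<close>
  have "\<exists>b r. cone (2 * A) r \<and> (\<forall>x. v n x = b + r x) \<and> (\<forall>x. r x \<le> W * ?\<theta> ^ n)"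
  proof (induction n)
    case 0
    show ?case using v0 by (intro exI[of _ 0] exI[of _ "v 0"]) auto
  next
    case (Suc n)
    then obtain b r where r: "cone (2 * A) r" "\<And>x. v n x = b + r x" "\<And>x. r x \<le> W * ?\<theta> ^ n"
      by blast
    note cr = cone_continuous[OF r(1)]
    obtain z where z: "\<And>x. r x \<le> r z"
      using continuous_attains_sup[OF compact_sequences _ cr] by auto
    have rz: "0 < r z" using r(1) by (simp add: cone_def)
    have low: "exp (- 2 * A) * r z \<le> r x" for x
    proof -
      have "r z \<le> exp (2 * A * seq_dist z x) * r x" using r(1) by (simp add: cone_def)
      also have "\<dots> \<le> exp (2 * A) * r x"
        using r(1) \<open>0 \<le> A\<close> seq_dist_le_1[of z x]
        by (intro mult_right_mono) (auto simp: cone_def less_imp_le mult_left_le)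
      finally have "exp (- 2 * A) * r z \<le> exp (- 2 * A) * (exp (2 * A) * r x)" by (intro mult_left_mono) auto
      then show ?thesis by (simp flip: mult.assoc exp_add)
    qed
    define \<eta> where "\<eta> = exp (- 2 * A) * r z / 4"
    define r' where "r' x = transfer \<nu> (F n) r x - \<eta>" for x
    have "cone (3/2 * A) (transfer \<nu> (F n) r)"
      using cone_transfer[OF F(1)[of n] r(1)] by simp
    then have "cone (2 * A) r'"
      unfolding r'_def \<eta>_def
      using transfer_ge[OF F(2) cr low] rz \<open>0 \<le> A\<close> by (intro cone_diff_const) auto
    moreover have "v (Suc n) x = (b + \<eta>) + r' x" for x
    proof -
      have "v n = (\<lambda>x. b + r x)" using r(2) by auto
      then show ?thesis
        using transfer_add[of "F n" "\<lambda>_. b" r x] cr F(2)[of n] transfer_const[OF F(2), of n b x]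
        by (simp add: v r'_def normalized_def)
    qed
    moreover have "r' x \<le> W * ?\<theta> ^ Suc n" for x
    proof -
      have "r' x \<le> r z * ?\<theta>"
        using transfer_le[OF F(2) cr z, of n x] by (simp add: r'_def \<eta>_def algebra_simps)
      also have "\<dots> \<le> W * ?\<theta> ^ n * ?\<theta>" using \<theta> r(3) by (intro mult_right_mono) auto
      finally show ?thesis by (simp add: mult_ac)
    qed
    ultimately show ?case by blast
  qed
  then obtain b r where r: "cone (2 * A) r" "\<And>x. v n x = b + r x" "\<And>x. r x \<le> W * ?\<theta> ^ n"
    by blast
  have le: "r x - r y \<le> (exp (2 * A * seq_dist x y) - 1) * (W * ?\<theta> ^ n)" for x y
  proof -
    have "r x - r y \<le> (exp (2 * A * seq_dist x y) - 1) * r y"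
      using r(1) by (auto simp: cone_def algebra_simps)
    also have "\<dots> \<le> (exp (2 * A * seq_dist x y) - 1) * (W * ?\<theta> ^ n)"
      using \<open>0 \<le> A\<close> seq_dist_nonneg[of x y] by (intro mult_left_mono r) auto
    finally show ?thesis .
  qed
  show ?thesis using le[of x y] le[of y x] unfolding seq_dist_commute[of y] r(2) by linarith
qed

text \<open>Small oscillation alone would allow the mean level to drift. A normalized operator keeps
  values between the bounds of its argument, so all later iterates stay in the interval around
  \<open>v n y\<close> and the level converges as well.\<close>

lemma markov_convergence:
  fixes v :: "nat \<Rightarrow> (nat \<Rightarrow> 'a) \<Rightarrow> real"
  assumes "0 \<le> A" and F: "\<And>n. seq_lipschitz A (F n)" "\<And>n. normalized \<nu> (F n)"
    and v0: "cone (2 * A) (v 0)" and v: "\<And>n. v (Suc n) = transfer \<nu> (F n) (v n)"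
  obtains C \<theta> l where "0 \<le> C" "0 \<le> \<theta>" "\<theta> < 1"
    "\<And>n x y. \<bar>v n x - v n y\<bar> \<le> C * \<theta> ^ n * seq_dist x y" "\<And>n x. \<bar>v n x - l\<bar> \<le> C * \<theta> ^ n"
proof -
  obtain W where W: "0 < W" "\<And>x. norm (v 0 x) \<le> W"
    using continuous_bounded[OF cone_continuous[OF v0]] by blast
  define \<theta> where "\<theta> = 1 - exp (- 2 * A) / 4"
  \<comment> \<open>From \<open>exp t - 1 \<le> exp (2 * A) * t\<close> for
    \<open>0 \<le> t \<le> 2 * A\<close>, with \<open>t = 2 * A * seq_dist x y\<close>.\<close>
  define C where "C = 2 * A * exp (2 * A) * W"
  have \<theta>: "0 \<le> \<theta>" "\<theta> < 1" using \<open>0 \<le> A\<close> exp_le_one_iff[of "-2 * A"] unfolding \<theta>_def by (linarith, simp)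
  have C: "0 \<le> C" using \<open>0 \<le> A\<close> W by (simp add: C_def)
  have lip: "\<bar>v n x - v n y\<bar> \<le> C * \<theta> ^ n * seq_dist x y" for n x y
  proof -
    let ?s = "2 * A * seq_dist x y"
    have s: "0 \<le> ?s" "?s \<le> 2 * A"
      using \<open>0 \<le> A\<close> seq_dist_nonneg[of x y] seq_dist_le_1[of x y] by (auto simp: mult_left_le)
    have "exp ?s - 1 = exp ?s * (1 - exp (- ?s))" by (simp add: algebra_simps flip: exp_add)
    also have "\<dots> \<le> exp ?s * ?s" using exp_ge_add_one_self[of "- ?s"] by (intro mult_left_mono exp_ge_zero) linarith
    also have "\<dots> \<le> exp (2 * A) * ?s" using s by (intro mult_right_mono) auto
    finally have e: "exp ?s - 1 \<le> exp (2 * A) * ?s" .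
    have "v 0 x \<le> W" for x using W(2)[of x] by simp
    from cone_contraction[OF \<open>0 \<le> A\<close> F v0 this v]
    have "\<bar>v n x - v n y\<bar> \<le> (exp ?s - 1) * (W * \<theta> ^ n)" unfolding \<theta>_def .
    also have "\<dots> \<le> (exp (2 * A) * ?s) * (W * \<theta> ^ n)" using e W \<theta> by (intro mult_right_mono) auto
    finally show ?thesis by (simp add: C_def mult_ac)
  qed
  have cont: "continuous_on UNIV (v n)" for n
  proof (induction n)
    case (Suc n)
    then show ?case unfolding v using F(2)[of n] by (intro continuous_transfer) (auto simp: normalized_def)
  qed (rule cone_continuous[OF v0])
  have osc: "\<bar>v m x - v n y\<bar> \<le> C * \<theta> ^ n" if "n \<le> m" for n m x y
    using that
  proof (induction m arbitrary: x rule: dec_induct)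
    case base
    have "C * \<theta> ^ n * seq_dist x y \<le> C * \<theta> ^ n" using C \<theta> seq_dist_le_1[of x y] by (simp add: mult_left_le)
    then show ?case using lip[of n x y] by linarith
  next
    case (step m)
    then have "v n y - C * \<theta> ^ n \<le> v m x" "v m x \<le> v n y + C * \<theta> ^ n" for x
      by (auto simp: abs_le_iff algebra_simps)
    then show ?case
      using transfer_ge[OF F(2)[of m] cont[of m], of "v n y - C * \<theta> ^ n" x]
        transfer_le[OF F(2)[of m] cont[of m], of "v n y + C * \<theta> ^ n" x]
      by (simp add: v abs_le_iff)
  qed
  have lim0: "(\<lambda>n. C * \<theta> ^ n) \<longlonglongrightarrow> 0"
    using LIMSEQ_realpow_zero[OF \<theta>] tendsto_mult_right_zero by blast
  define x0 :: "nat \<Rightarrow> 'a" where "x0 = undefined"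
  have "Cauchy (\<lambda>n. v n x0)"
  proof (rule metric_CauchyI)
    fix e :: real assume "0 < e"
    then obtain N where N: "\<And>n. n \<ge> N \<Longrightarrow> C * \<theta> ^ n < e"
      using order_tendstoD(2)[OF lim0] by (auto simp: eventually_sequentially)
    have "dist (v m x0) (v n x0) < e" if "N \<le> n" "n \<le> m" for n m
      using osc[OF that(2), of x0 x0] N[OF that(1)] by (simp add: dist_real_def)
    then have "\<forall>m\<ge>N. \<forall>n\<ge>N. dist (v m x0) (v n x0) < e"
      by (metis dist_commute nle_le)
    then show "\<exists>M. \<forall>m\<ge>M. \<forall>n\<ge>M. dist (v m x0) (v n x0) < e" ..
  qed
  then obtain l where l: "(\<lambda>n. v n x0) \<longlonglongrightarrow> l" by (auto simp: Cauchy_convergent_iff convergent_def)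
  have "\<bar>v n y - l\<bar> \<le> C * \<theta> ^ n" for n y
  proof (rule LIMSEQ_le_const2)
    show "(\<lambda>m. \<bar>v n y - v m x0\<bar>) \<longlonglongrightarrow> \<bar>v n y - l\<bar>" by (intro tendsto_intros l)
    show "\<exists>N. \<forall>m\<ge>N. \<bar>v n y - v m x0\<bar> \<le> C * \<theta> ^ n"
      using osc by (metis abs_minus_commute)
  qed
  then show ?thesis using that C \<theta> lip by blast
qed

section \<open>The Ruelle-Perron-Frobenius theorem\<close>

text \<open>The iterates \<open>W n\<close> of \<open>1\<close> stay in the cone of constant
  \<open>A\<close>. Their ratios \<open>\<phi> n\<close> evolve under the normalized potentials
  \<open>F n\<close>, which share a Lipschitz constant, and so tend geometrically to a number
  \<open>l\<close>. Hence \<open>ln (W n x) - n * ln l\<close> has summable increments, and its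
  limit is the logarithm of an eigenfunction.\<close>

lemma eigenfunction_exists:
  assumes "f \<in> Lip"
  obtains l V where "0 < l" "V \<in> Lip" "\<And>x. transfer \<nu> f (\<lambda>x. exp (V x)) x = l * exp (V x)"
proof -
  obtain A where A: "A > 0" "seq_lipschitz A f" using assms by (rule LipE)
  note cf = seq_lipschitz_continuous[OF A(2)]
  define W where "W n = (transfer \<nu> f ^^ n) (\<lambda>_. 1 :: real)" for n
  have W_0: "W 0 = (\<lambda>_. 1)" and W_Suc: "W (Suc n) = transfer \<nu> f (W n)" for n
    by (simp_all add: W_def)
  have W: "cone A (W n)" for n
  proof (induction n)
    case 0
    show ?case using A by (simp add: W_0 cone_one)
  next
    case (Suc n)
    show ?case using cone_transfer[OF A(2) Suc] by (simp add: W_Suc)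
  qed
  have W_pos: "0 < W n x" for n x using W by (simp add: cone_def)
  have W_ln: "\<bar>ln (W n x) - ln (W n y)\<bar> \<le> A * seq_dist x y" for n x y
    using cone_ln_Lipschitz[OF W] by (simp add: seq_lipschitz_def)
  define F where "F n x = f x + ln (W n x) - ln (W (Suc n) (shift x))" for n x
  \<comment> \<open>The three terms contribute \<open>A\<close>, \<open>A\<close> and, because the
    shift may double distances, \<open>2 * A\<close>.\<close>
  have F_lip: "seq_lipschitz (4 * A) (F n)" for n
    unfolding seq_lipschitz_def
  proof (intro allI)
    fix x y
    have "\<bar>ln (W (Suc n) (shift x)) - ln (W (Suc n) (shift y))\<bar> \<le> A * (2 * seq_dist x y)"
      by (rule order_trans[OF W_ln]) (use A seq_dist_shift_le in \<open>auto intro: mult_left_mono\<close>)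
    moreover have "\<bar>f x - f y\<bar> \<le> A * seq_dist x y" using A by (simp add: seq_lipschitz_def)
    ultimately show "\<bar>F n x - F n y\<bar> \<le> 4 * A * seq_dist x y"
      using W_ln[of n x y] unfolding F_def by linarith
  qed
  have F_exp: "exp (F n (prepend a x)) = exp (f (prepend a x)) * W n (prepend a x) / W (Suc n) x" for n a x
    using W_pos by (simp add: F_def exp_diff exp_add)
  have F_norm: "normalized \<nu> (F n)" for n
  proof -
    have "transfer \<nu> (F n) (\<lambda>_. 1 :: real) x = transfer \<nu> f (W n) x / W (Suc n) x" for x
      by (simp add: transfer_def F_exp)
    then show ?thesis
      using W_pos seq_lipschitz_continuous[OF F_lip] by (simp add: normalized_def W_Suc[symmetric] less_imp_neq[symmetric])
  qed
  define \<phi> where "\<phi> n x = W (Suc n) x / W n x" for n x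
  have \<phi>_Suc: "\<phi> (Suc n) = transfer \<nu> (F n) (\<phi> n)" for n
  proof
    fix x
    have "transfer \<nu> (F n) (\<phi> n) x = (\<integral>a. exp (f (prepend a x)) * W (Suc n) (prepend a x) / W (Suc n) x \<partial>\<nu>)"
      using W_pos by (simp add: transfer_def F_exp \<phi>_def less_imp_neq[symmetric])
    also have "\<dots> = transfer \<nu> f (W (Suc n)) x / W (Suc n) x" by (simp add: transfer_def)
    finally show "\<phi> (Suc n) x = transfer \<nu> (F n) (\<phi> n) x" by (simp add: \<phi>_def W_Suc)
  qed
  have \<phi>_0: "\<phi> 0 = W (Suc 0)" by (simp add: \<phi>_def W_0 fun_eq_iff)
  have \<phi>_cone: "cone (2 * (4 * A)) (\<phi> 0)" unfolding \<phi>_0 by (rule cone_mono[OF W]) (use A in auto)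
  obtain C \<theta> l where C: "0 \<le> C" and \<theta>: "0 \<le> \<theta>" "\<theta> < 1" and l: "\<And>n x. \<bar>\<phi> n x - l\<bar> \<le> C * \<theta> ^ n"
    by (rule markov_convergence[of "4 * A" F \<phi>, OF _ F_lip F_norm \<phi>_cone \<phi>_Suc]) (use A in auto)
  have \<phi>_cont: "continuous_on UNIV (\<phi> n)" for n
    unfolding \<phi>_def using W_pos cone_continuous[OF W]
    by (intro continuous_intros) (auto simp: less_imp_neq[symmetric])
  obtain z where z: "\<And>x. \<phi> 0 z \<le> \<phi> 0 x"
    using continuous_attains_inf[OF compact_sequences _ \<phi>_cont[of 0]] by auto
  define c where "c = \<phi> 0 z"
  have c: "0 < c" using W_pos by (simp add: c_def \<phi>_0)
  \<comment> \<open>Averages preserve lower bounds, so all ratios stay above the minimum of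
    \<open>\<phi> 0\<close>, and \<open>ln\<close> is Lipschitz on the values that occur.\<close>
  have \<phi>_ge: "c \<le> \<phi> n x" for n x
  proof (induction n arbitrary: x)
    case (Suc n)
    then show ?case unfolding \<phi>_Suc by (intro transfer_ge F_norm \<phi>_cont)
  qed (simp add: c_def z)
  have lim0: "(\<lambda>n. C * \<theta> ^ n) \<longlonglongrightarrow> 0"
    using LIMSEQ_realpow_zero[OF \<theta>] tendsto_mult_right_zero by blast
  have l_ge: "c \<le> l"
  proof (rule LIMSEQ_le_const)
    show "(\<lambda>n. l + C * \<theta> ^ n) \<longlonglongrightarrow> l" using tendsto_add[OF tendsto_const[of l] lim0] by simp
    have "c \<le> l + C * \<theta> ^ n" for n using \<phi>_ge[of n z] l[of n z] by linarith
    then show "\<exists>N. \<forall>n\<ge>N. c \<le> l + C * \<theta> ^ n" by blast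
  qed
  define V where "V n x = ln (W n x) - real n * ln l" for n x
  have V_step: "\<bar>V (Suc n) x - V n x\<bar> \<le> C / c * \<theta> ^ n" for n x
  proof -
    have "V (Suc n) x - V n x = ln (\<phi> n x) - ln l"
      using W_pos by (simp add: V_def \<phi>_def ln_divide_pos algebra_simps)
    then have "\<bar>V (Suc n) x - V n x\<bar> \<le> \<bar>\<phi> n x - l\<bar> / c"
      using abs_ln_diff_le[OF c \<phi>_ge l_ge] by simp
    also have "\<dots> \<le> (C * \<theta> ^ n) / c" using l c by (intro divide_right_mono) auto
    finally show ?thesis by simp
  qed
  have geo: "summable (\<lambda>n. C / c * \<theta> ^ n)" using \<theta> by (intro summable_mult summable_geometric) auto
  \<comment> \<open>The telescoping sum has no initial term because \<open>W 0 = 1\<close> makes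
    \<open>V 0\<close> vanish.\<close>
  have V_sum: "(\<Sum>k<n. V (Suc k) x - V k x) = V n x" for n x
    using sum_lessThan_telescope[of "\<lambda>k. V k x" n] by (simp add: V_def W_0)
  define Vl where "Vl x = (\<Sum>k. V (Suc k) x - V k x)" for x
  have V_lim: "(\<lambda>n. V n x) \<longlonglongrightarrow> Vl x" for x
  proof -
    have "summable (\<lambda>k. V (Suc k) x - V k x)"
      by (rule summable_comparison_test'[OF geo]) (use V_step in auto)
    from summable_LIMSEQ[OF this] show ?thesis by (simp add: V_sum Vl_def)
  qed
  define B where "B = (\<Sum>n. C / c * \<theta> ^ n)"
  have V_bound: "\<bar>V n x\<bar> \<le> B" for n x
  proof -
    have "\<bar>\<Sum>k<n. V (Suc k) x - V k x\<bar> \<le> (\<Sum>k<n. C / c * \<theta> ^ k)"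
      by (rule order_trans[OF sum_abs]) (intro sum_mono V_step)
    also have "\<dots> \<le> B" unfolding B_def using C c \<theta> by (intro sum_le_suminf geo) auto
    finally show ?thesis unfolding V_sum .
  qed
  have Vl_lip: "seq_lipschitz A Vl"
    unfolding seq_lipschitz_def
  proof (intro allI LIMSEQ_le_const2)
    fix x y
    show "(\<lambda>n. \<bar>V n x - V n y\<bar>) \<longlonglongrightarrow> \<bar>Vl x - Vl y\<bar>" by (intro tendsto_intros V_lim)
    show "\<exists>N. \<forall>n\<ge>N. \<bar>V n x - V n y\<bar> \<le> A * seq_dist x y" using W_ln by (simp add: V_def)
  qed
  have V_cont: "continuous_on UNIV (\<lambda>x. exp (V n x))" for n
    unfolding V_def
    by (intro continuous_on_exp continuous_on_diff continuous_on_const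
        seq_lipschitz_continuous[OF cone_ln_Lipschitz[OF W]])
  have step: "transfer \<nu> f (\<lambda>x. exp (V n x)) x = l * exp (V (Suc n) x)" for n x
  proof -
    have "exp (V n x) = W n x / l ^ n" for n x
      using W_pos c l_ge by (simp add: V_def exp_diff exp_of_nat_mult)
    then show ?thesis using c l_ge by (simp add: transfer_def W_Suc)
  qed
  have "transfer \<nu> f (\<lambda>x. exp (Vl x)) x = l * exp (Vl x)" for x
  proof (rule LIMSEQ_unique)
    show "(\<lambda>n. transfer \<nu> f (\<lambda>x. exp (V n x)) x) \<longlonglongrightarrow> transfer \<nu> f (\<lambda>x. exp (Vl x)) x"
    proof (rule transfer_tendsto[OF cf V_cont])
      show "continuous_on UNIV (\<lambda>x. exp (Vl x))"
        using seq_lipschitz_continuous[OF Vl_lip] by (intro continuous_intros)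
      show "(\<lambda>n. exp (V n x)) \<longlonglongrightarrow> exp (Vl x)" for x by (intro tendsto_intros V_lim)
      show "norm (exp (V n x)) \<le> exp B" for n x using V_bound[of n x] by simp
    qed
    show "(\<lambda>n. transfer \<nu> f (\<lambda>x. exp (V n x)) x) \<longlonglongrightarrow> l * exp (Vl x)"
      unfolding step by (intro tendsto_intros LIMSEQ_Suc V_lim)
  qed
  moreover have "Vl \<in> Lip" using Vl_lip A by (auto simp: Lip_iff)
  ultimately show ?thesis using that[of l Vl] c l_ge by auto
qed

text \<open>A large additive constant puts any Lipschitz function into the cone, and a normalized
  operator carries this constant along unchanged.\<close>

lemma spectral_gap:
  assumes F: "F \<in> Lip" "normalized \<nu> F" and w: "w \<in> Lip"
  obtains C \<theta> l where "0 \<le> C" "0 \<le> \<theta>" "\<theta> < (1::real)"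
    "\<And>n x y. \<bar>(transfer \<nu> F ^^ n) w x - (transfer \<nu> F ^^ n) w y\<bar> \<le> C * \<theta> ^ n * seq_dist x y"
    "\<And>n x. \<bar>(transfer \<nu> F ^^ n) w x - l\<bar> \<le> C * \<theta> ^ n"
proof -
  obtain A where A: "A > 0" "seq_lipschitz A F" using F(1) by (rule LipE)
  obtain M where M: "M > 0" "seq_lipschitz M w" using w by (rule LipE)
  obtain B where B: "B > 0" "\<And>x. norm (w x) \<le> B" using continuous_bounded[OF Lip_continuous[OF w]] by blast
  have cF: "continuous_on UNIV F" using F(2) by (simp add: normalized_def)
  \<comment> \<open>Chosen so that \<open>w x + c \<ge> M / (2 * A)\<close>, which converts the
    additive modulus \<open>M * seq_dist x y\<close> into the relative one
    \<open>2 * A * seq_dist x y\<close>.\<close>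
  define c where "c = B + M / (2 * A)"
  define v where "v n x = (transfer \<nu> F ^^ n) w x + c" for n x
  have w_ge: "M / (2 * A) \<le> w x + c" for x using B(2)[of x] by (simp add: c_def)
  have cone: "cone (2 * A) (v 0)"
    unfolding cone_def
  proof (intro conjI allI)
    have "0 < M / (2 * A)" using A M by simp
    then show "0 < v 0 x" for x using w_ge[of x] by (simp add: v_def)
    fix x y
    have "w x \<le> w y + M * seq_dist x y" using M(2) unfolding seq_lipschitz_def by (metis abs_le_D1 diff_le_eq add.commute)
    moreover have "M * seq_dist x y \<le> 2 * A * (w y + c) * seq_dist x y"
      using w_ge[of y] A seq_dist_nonneg by (intro mult_right_mono) (auto simp: field_simps)
    ultimately have "v 0 x \<le> (1 + 2 * A * seq_dist x y) * (w y + c)" by (simp add: v_def algebra_simps)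
    also have "\<dots> \<le> exp (2 * A * seq_dist x y) * (w y + c)"
      using exp_ge_add_one_self w_ge[of y] \<open>0 < M / (2 * A)\<close> by (intro mult_right_mono) auto
    finally show "v 0 x \<le> exp (2 * A * seq_dist x y) * v 0 y" by (simp add: v_def)
  qed
  have cont: "continuous_on UNIV ((transfer \<nu> F ^^ n) w)" for n
    by (induction n) (use cF Lip_continuous[OF w] in \<open>auto intro: continuous_transfer\<close>)
  have step: "v (Suc n) = transfer \<nu> F (v n)" for n
  proof
    fix x
    have "transfer \<nu> F (v n) x = transfer \<nu> F ((transfer \<nu> F ^^ n) w) x + transfer \<nu> F (\<lambda>_. c) x"
      unfolding v_def by (rule transfer_add[OF cF cont]) simp
    then show "v (Suc n) x = transfer \<nu> F (v n) x" by (simp add: v_def transfer_const[OF F(2)])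
  qed
  obtain C \<theta> l where C: "0 \<le> C" and \<theta>: "0 \<le> \<theta>" "\<theta> < 1"
    and lip: "\<And>n x y. \<bar>v n x - v n y\<bar> \<le> C * \<theta> ^ n * seq_dist x y" and l: "\<And>n x. \<bar>v n x - l\<bar> \<le> C * \<theta> ^ n"
    by (rule markov_convergence[of A "\<lambda>_. F" v, OF less_imp_le[OF A(1)] A(2) F(2) cone step]) blast
  show ?thesis
  proof (rule that[OF C \<theta>])
    show "\<bar>(transfer \<nu> F ^^ n) w x - (transfer \<nu> F ^^ n) w y\<bar> \<le> C * \<theta> ^ n * seq_dist x y" for n x y
      using lip[of n x y] by (simp add: v_def)
    show "\<bar>(transfer \<nu> F ^^ n) w x - (l - c)\<bar> \<le> C * \<theta> ^ n" for n x
      using l[of n x] by (simp add: v_def algebra_simps)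
  qed
qed

end

lemma borel_prob_integral_pos:
  fixes \<phi> :: "'b::topological_space \<Rightarrow> real"
  assumes "compact (UNIV :: 'b set)" "borel_prob \<mu>" "continuous_on UNIV \<phi>" "\<And>x. 0 < \<phi> x"
  shows "0 < (\<integral>x. \<phi> x \<partial>\<mu>)"
proof -
  obtain z where z: "\<And>x. \<phi> z \<le> \<phi> x" using continuous_attains_inf[OF assms(1) _ assms(3)] by auto
  have "0 < \<phi> z" by fact
  also have "\<dots> = (\<integral>x. \<phi> z \<partial>\<mu>)" using assms(2) by (simp only: borel_prob_integral_const)
  also have "\<dots> \<le> (\<integral>x. \<phi> x \<partial>\<mu>)"
    using z by (intro integral_mono borel_prob_integrable assms continuous_on_const)
  finally show ?thesis .
qed

context full_shift
begin

text \<open>By Stone-Weierstrass: the Lipschitz functions form an algebra, and the distance in one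
  coordinate to a fixed letter separates points.\<close>

lemma Lip_dense:
  assumes w: "continuous_on UNIV (w :: (nat \<Rightarrow> 'a) \<Rightarrow> real)" and e: "0 < e"
  obtains g where "g \<in> Lip" "\<And>x. \<bar>w x - g x\<bar> < e"
proof -
  have sep: "\<exists>f. f \<in> Lip \<and> f x \<noteq> f y" if "x \<noteq> y" for x y :: "nat \<Rightarrow> 'a"
  proof -
    obtain n where n: "x n \<noteq> y n" using \<open>x \<noteq> y\<close> by (auto simp: fun_eq_iff)
    have "(\<lambda>z. dist (x n) (z n)) \<in> Lip"
    proof (rule LipI)
      fix z z' :: "nat \<Rightarrow> 'a"
      have "\<bar>dist (x n) (z n) - dist (x n) (z' n)\<bar> \<le> dist (z n) (z' n)"
        by (metis abs_dist_diff_le dist_commute)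
      also have "\<dots> \<le> 2 ^ Suc n * seq_dist z z'"
        using seq_dist_ge[OF compact_alphabet diameter_alphabet, of n z z']
        by (simp add: power_divide field_simps)
      finally show "\<bar>dist (x n) (z n) - dist (x n) (z' n)\<bar> \<le> 2 ^ Suc n * seq_dist z z'" .
    qed
    then show ?thesis using n by (intro exI[of _ "\<lambda>z. dist (x n) (z n)"]) auto
  qed
  have "\<exists>g. g \<in> Lip \<and> (\<forall>x\<in>UNIV. \<bar>w x - g x\<bar> < e)"
    by (rule Stone_Weierstrass_HOL[where P = "\<lambda>g. g \<in> Lip"])
      (use compact_sequences Lip_const Lip_continuous Lip_add Lip_mult sep w e in auto)
  then show ?thesis using that by blast
qed

section \<open>Invariant measures\<close>

lemma continuous_iterate:
  fixes w :: "(nat \<Rightarrow> 'a) \<Rightarrow> 'b::{banach,second_countable_topology}"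
  assumes "continuous_on UNIV F" "continuous_on UNIV w"
  shows "continuous_on UNIV ((transfer \<nu> F ^^ n) w)"
  by (induction n) (use assms in \<open>auto intro: continuous_transfer\<close>)

lemma iterate_add:
  fixes w v :: "(nat \<Rightarrow> 'a) \<Rightarrow> 'b::{banach,second_countable_topology}"
  assumes "continuous_on UNIV F" "continuous_on UNIV w" "continuous_on UNIV v"
  shows "(transfer \<nu> F ^^ n) (\<lambda>x. w x + v x) = (\<lambda>x. (transfer \<nu> F ^^ n) w x + (transfer \<nu> F ^^ n) v x)"
  by (induction n) (use assms in \<open>auto simp: transfer_add continuous_iterate\<close>)

lemma iterate_diff:
  fixes w v :: "(nat \<Rightarrow> 'a) \<Rightarrow> 'b::{banach,second_countable_topology}"
  assumes "continuous_on UNIV F" "continuous_on UNIV w" "continuous_on UNIV v"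
  shows "(transfer \<nu> F ^^ n) (\<lambda>x. w x - v x) = (\<lambda>x. (transfer \<nu> F ^^ n) w x - (transfer \<nu> F ^^ n) v x)"
  by (induction n) (use assms in \<open>auto simp: transfer_diff continuous_iterate\<close>)

lemma iterate_mult:
  fixes c :: "'b::{real_normed_field,banach,second_countable_topology}"
  shows "(transfer \<nu> F ^^ n) (\<lambda>x. c * w x) = (\<lambda>x. c * (transfer \<nu> F ^^ n) w x)"
  by (induction n) (auto simp: transfer_mult)

lemma iterate_const: "normalized \<nu> F \<Longrightarrow> (transfer \<nu> F ^^ n) (\<lambda>_. c :: real) = (\<lambda>_. c)"
  by (induction n) (auto simp: transfer_const)

lemma iterate_norm_le:
  fixes w :: "(nat \<Rightarrow> 'a) \<Rightarrow> 'b::{banach,second_countable_topology}"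
  assumes "normalized \<nu> F" "continuous_on UNIV w" "\<And>x. norm (w x) \<le> B"
  shows "norm ((transfer \<nu> F ^^ n) w x) \<le> B"
proof (induction n arbitrary: x)
  case (Suc n)
  then show ?case
    using assms by (auto intro!: transfer_norm_le continuous_iterate simp: normalized_def)
qed (use assms in simp)

lemma iterate_nonneg:
  assumes "normalized \<nu> F" "continuous_on UNIV w" "\<And>x. (0::real) \<le> w x"
  shows "0 \<le> (transfer \<nu> F ^^ n) w x"
proof (induction n arbitrary: x)
  case (Suc n)
  then show ?case
    using assms by (auto intro!: transfer_ge continuous_iterate simp: normalized_def)
qed (use assms in simp)

text \<open>Uniform approximation by Lipschitz functions survives iteration, because a normalized
  operator does not increase the supremum norm. Convergence therefore extends to continuous
  functions, though without a rate.\<close>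

lemma iterate_convergent:
  assumes F: "F \<in> Lip" "normalized \<nu> F" and w: "continuous_on UNIV (w :: (nat \<Rightarrow> 'a) \<Rightarrow> real)"
  obtains l where "\<And>x. (\<lambda>n. (transfer \<nu> F ^^ n) w x) \<longlonglongrightarrow> l"
proof -
  let ?L = "\<lambda>n. transfer \<nu> F ^^ n"
  have cF: "continuous_on UNIV F" using F(2) by (simp add: normalized_def)
  have near: "\<exists>c N. \<forall>n\<ge>N. \<forall>x. \<bar>?L n w x - c\<bar> < e" if "0 < e" for e
  proof -
    obtain g where g: "g \<in> Lip" "\<And>x. \<bar>w x - g x\<bar> < e / 2"
      by (rule Lip_dense[OF w half_gt_zero[OF \<open>0 < e\<close>]]) blast
    obtain C \<theta> c where \<theta>: "0 \<le> \<theta>" "\<theta> < (1::real)" and c: "\<And>n x. \<bar>?L n g x - c\<bar> \<le> C * \<theta> ^ n"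
      using spectral_gap[OF F g(1)] by metis
    have lim0: "(\<lambda>n. C * \<theta> ^ n) \<longlonglongrightarrow> 0"
      using LIMSEQ_realpow_zero[OF \<theta>] tendsto_mult_right_zero by blast
    obtain N where N: "\<And>n. n \<ge> N \<Longrightarrow> C * \<theta> ^ n < e / 2"
      using order_tendstoD(2)[OF lim0 half_gt_zero[OF \<open>0 < e\<close>]] unfolding eventually_sequentially by blast
    have "\<bar>?L n w x - c\<bar> < e" if "n \<ge> N" for n x
    proof -
      have "norm (?L n (\<lambda>x. w x - g x) x) \<le> e / 2"
        using g(2) by (intro iterate_norm_le F continuous_on_diff w Lip_continuous g(1)) (simp add: less_imp_le)
      then have "\<bar>?L n w x - ?L n g x\<bar> \<le> e / 2" by (simp add: iterate_diff[OF cF w Lip_continuous[OF g(1)]])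
      then show ?thesis using c[of n x] N[OF that] by linarith
    qed
    then show ?thesis by blast
  qed
  define x0 :: "nat \<Rightarrow> 'a" where "x0 = undefined"
  have "Cauchy (\<lambda>n. ?L n w x0)"
  proof (rule metric_CauchyI)
    fix e :: real assume "0 < e"
    then obtain c N where N: "\<And>n x. n \<ge> N \<Longrightarrow> \<bar>?L n w x - c\<bar> < e / 2" using near[of "e / 2"] by auto
    have "dist (?L m w x0) (?L n w x0) < e" if "m \<ge> N" "n \<ge> N" for m n
      using N[OF that(1), of x0] N[OF that(2), of x0] unfolding dist_real_def by linarith
    then show "\<exists>M. \<forall>m\<ge>M. \<forall>n\<ge>M. dist (?L m w x0) (?L n w x0) < e" by blast
  qed
  then obtain l where l: "(\<lambda>n. ?L n w x0) \<longlonglongrightarrow> l" by (auto simp: Cauchy_convergent_iff convergent_def)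
  have "(\<lambda>n. ?L n w x) \<longlonglongrightarrow> l" for x
  proof -
    have "(\<lambda>n. ?L n w x - ?L n w x0) \<longlonglongrightarrow> 0"
    proof (rule LIMSEQ_I)
      fix e :: real assume "0 < e"
      then obtain c N where N: "\<And>n x. n \<ge> N \<Longrightarrow> \<bar>?L n w x - c\<bar> < e / 2" using near[of "e / 2"] by auto
      have "norm (?L n w x - ?L n w x0 - 0) < e" if "n \<ge> N" for n
        using N[OF that, of x] N[OF that, of x0] unfolding real_norm_def by linarith
      then show "\<exists>N. \<forall>n\<ge>N. norm (?L n w x - ?L n w x0 - 0) < e" by blast
    qed
    from tendsto_add[OF this l] show ?thesis by simp
  qed
  then show ?thesis by (rule that)
qed

lemma dual_iterate:
  assumes "normalized \<nu> F" "dual_eigenmeasure \<nu> F 1 \<mu>" "continuous_on UNIV (w :: (nat \<Rightarrow> 'a) \<Rightarrow> real)"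
  shows "(\<integral>x. (transfer \<nu> F ^^ n) w x \<partial>\<mu>) = (\<integral>x. w x \<partial>\<mu>)"
proof (induction n)
  case (Suc n)
  have "continuous_on UNIV ((transfer \<nu> F ^^ n) w)"
    using assms by (intro continuous_iterate) (auto simp: normalized_def)
  then show ?case using assms(2) Suc by (simp add: dual_eigenmeasure_def ruelle_eq_transfer)
qed simp

lemma dual_integral_limit:
  assumes F: "normalized \<nu> F" and \<mu>: "borel_prob \<mu>" "dual_eigenmeasure \<nu> F 1 \<mu>"
    and w: "continuous_on UNIV (w :: (nat \<Rightarrow> 'a) \<Rightarrow> real)" and l: "\<And>x. (\<lambda>n. (transfer \<nu> F ^^ n) w x) \<longlonglongrightarrow> l"
  shows "(\<integral>x. w x \<partial>\<mu>) = l"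
proof -
  obtain B where B: "\<And>x. norm (w x) \<le> B" using continuous_bounded[OF w] by blast
  have c: "continuous_on UNIV ((transfer \<nu> F ^^ n) w)" for n
    using F w by (intro continuous_iterate) (auto simp: normalized_def)
  interpret prob_space \<mu> using \<mu> by (simp add: borel_prob_def)
  have "(\<lambda>n. \<integral>x. (transfer \<nu> F ^^ n) w x \<partial>\<mu>) \<longlonglongrightarrow> (\<integral>x. l \<partial>\<mu>)"
    by (rule integral_dominated_convergence[where w = "\<lambda>_. B"])
      (use l iterate_norm_le[OF F w B] borel_prob_measurable[OF \<mu>(1) c] in auto)
  then have "(\<lambda>n. \<integral>x. w x \<partial>\<mu>) \<longlonglongrightarrow> l"
    unfolding dual_iterate[OF F \<mu>(2) w] borel_prob_integral_const[OF \<mu>(1)] .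
  then show ?thesis by (simp add: LIMSEQ_const_iff)
qed

text \<open>The limit of the iterates is a positive normalized functional of \<open>w\<close>. It is
  invariant because the iterates of \<open>transfer \<nu> F w\<close> are those of \<open>w\<close>
  moved by one step, and the Riesz measure represents it.\<close>

lemma invariant_measure_exists:
  assumes F: "F \<in> Lip" "normalized \<nu> F"
  obtains \<mu> where "borel_prob \<mu>" "dual_eigenmeasure \<nu> F 1 \<mu>"
proof -
  have cF: "continuous_on UNIV F" using F(2) by (simp add: normalized_def)
  define x0 :: "nat \<Rightarrow> 'a" where "x0 = undefined"
  define \<Lambda> where "\<Lambda> w = lim (\<lambda>n. (transfer \<nu> F ^^ n) w x0)" for w :: "(nat \<Rightarrow> 'a) \<Rightarrow> real"
  have \<Lambda>: "(\<lambda>n. (transfer \<nu> F ^^ n) w x) \<longlonglongrightarrow> \<Lambda> w" if w: "continuous_on UNIV w" for w x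
  proof -
    obtain l where l: "\<And>x. (\<lambda>n. (transfer \<nu> F ^^ n) w x) \<longlonglongrightarrow> l"
      by (rule iterate_convergent[OF F w]) blast
    then show ?thesis using limI[OF l[of x0]] by (simp add: \<Lambda>_def)
  qed
  have \<Lambda>_eqI: "\<Lambda> w = l" if "(\<lambda>n. (transfer \<nu> F ^^ n) w x0) \<longlonglongrightarrow> l" for w l
    using that by (simp add: \<Lambda>_def limI)
  interpret positive_functional \<Lambda>
  proof
    show "compact (UNIV :: (nat \<Rightarrow> 'a) set)" by (rule compact_sequences)
    fix \<phi> \<psi> :: "(nat \<Rightarrow> 'a) \<Rightarrow> real" and c :: real
    assume c: "continuous_on UNIV \<phi>"
    show "\<Lambda> (\<lambda>x. c * \<phi> x) = c * \<Lambda> \<phi>"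
      by (rule \<Lambda>_eqI) (unfold iterate_mult, intro tendsto_intros \<Lambda> c)
    show "0 \<le> \<Lambda> \<phi>" if "\<And>x. 0 \<le> \<phi> x"
      using iterate_nonneg[OF F(2) c that] by (intro LIMSEQ_le_const[OF \<Lambda>[OF c, of x0]]) auto
    assume c': "continuous_on UNIV \<psi>"
    show "\<Lambda> (\<lambda>x. \<phi> x + \<psi> x) = \<Lambda> \<phi> + \<Lambda> \<psi>"
      by (rule \<Lambda>_eqI) (unfold iterate_add[OF cF c c'], intro tendsto_intros \<Lambda> c c')
  next
    show "\<Lambda> (\<lambda>_. 1) = 1" by (rule \<Lambda>_eqI) (simp add: iterate_const[OF F(2)])
  qed
  have "dual_eigenmeasure \<nu> F 1 riesz_measure"
    unfolding dual_eigenmeasure_def ruelle_eq_transfer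
  proof (intro allI impI)
    fix w :: "(nat \<Rightarrow> 'a) \<Rightarrow> real" assume w: "continuous_on UNIV w"
    have "\<Lambda> (transfer \<nu> F w) = \<Lambda> w"
      using LIMSEQ_Suc[OF \<Lambda>[OF w, of x0]] by (intro \<Lambda>_eqI) (simp add: funpow_swap1)
    then show "(\<integral>x. transfer \<nu> F w x \<partial>riesz_measure) = 1 * (\<integral>x. w x \<partial>riesz_measure)"
      by (simp add: integral_riesz_measure w continuous_transfer[OF cF w])
  qed
  then show ?thesis using borel_prob_riesz_measure that by blast
qed

text \<open>Each invariant measure integrates \<open>w\<close> to the limit of its iterates, which
  does not involve the measure.\<close>

lemma invariant_measure_unique:
  assumes F: "F \<in> Lip" "normalized \<nu> F"
    and \<mu>: "borel_prob \<mu>" "dual_eigenmeasure \<nu> F 1 \<mu>"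
    and \<mu>': "borel_prob \<mu>'" "dual_eigenmeasure \<nu> F 1 \<mu>'"
  shows "\<mu> = \<mu>'"
proof (rule borel_prob_eqI[OF \<mu>(1) \<mu>'(1)])
  fix w :: "(nat \<Rightarrow> 'a) \<Rightarrow> real" assume w: "continuous_on UNIV w"
  obtain l where l: "\<And>x. (\<lambda>n. (transfer \<nu> F ^^ n) w x) \<longlonglongrightarrow> l"
    by (rule iterate_convergent[OF F w]) blast
  show "(\<integral>x. w x \<partial>\<mu>) = (\<integral>x. w x \<partial>\<mu>')"
    using dual_integral_limit[OF F(2) \<mu> w l] dual_integral_limit[OF F(2) \<mu>' w l] by simp
qed

section \<open>Normalization of a potential and its eigendata\<close>

lemma transfer_normalize:
  fixes \<phi> :: "(nat \<Rightarrow> 'a) \<Rightarrow> 'b::{banach,second_countable_topology}"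
  assumes w: "\<And>x. 0 < w x" and "0 < l"
    and F: "\<And>x. F x = f x + ln (w x) - ln (w (shift x)) - ln l"
  shows "transfer \<nu> f (\<lambda>x. w x *\<^sub>R \<phi> x) x = (l * w x) *\<^sub>R transfer \<nu> F \<phi> x"
proof -
  \<comment> \<open>Normalizing is conjugation by multiplication with \<open>w\<close>, followed by
    division by \<open>l\<close>.\<close>
  have "exp (f (prepend a x)) * w (prepend a x) = (l * w x) * exp (F (prepend a x))" for a
    using w[of x] w[of "prepend a x"] \<open>0 < l\<close> by (simp add: F exp_diff exp_add)
  then have "transfer \<nu> f (\<lambda>x. w x *\<^sub>R \<phi> x) x
      = (\<integral>a. (l * w x) *\<^sub>R (exp (F (prepend a x)) *\<^sub>R \<phi> (prepend a x)) \<partial>\<nu>)"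
    by (simp add: transfer_def)
  also have "\<dots> = (l * w x) *\<^sub>R transfer \<nu> F \<phi> x"
    unfolding transfer_def by (rule integral_scaleR_right)
  finally show ?thesis .
qed

lemma normalize_Lip:
  assumes f: "f \<in> Lip" and w: "w \<in> Lip" "\<And>x. 0 < w x" and l: "0 < l"
    and eig: "\<And>x. transfer \<nu> f w x = l * w x"
    and F: "\<And>x. F x = f x + ln (w x) - ln (w (shift x)) - ln l"
  shows "F \<in> Lip" "normalized \<nu> F"
proof -
  have "(\<lambda>x. f x + ln (w x) - ln (w (shift x)) - ln l) \<in> Lip"
    by (intro Lip_diff Lip_add Lip_const f Lip_shift[OF Lip_ln[OF w]] Lip_ln[OF w])
  then show lip: "F \<in> Lip" using F by presburger
  have "transfer \<nu> F (\<lambda>_. 1 :: real) x = 1" for x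
    using transfer_normalize[where w = w and F = F and f = f, OF w(2) l F, of "\<lambda>_. 1 :: real" x] eig[of x] w(2)[of x] l by simp
  then show "normalized \<nu> F" using Lip_continuous[OF lip] by (simp add: normalized_def)
qed

text \<open>Normalizing with the eigenfunction \<open>exp (V x)\<close> reduces the eigenmeasure to
  an invariant \<open>\<mu>\<close>, and dividing \<open>\<mu>\<close> by \<open>exp (V x)\<close>
  undoes the normalization. The constant \<open>Z\<close> makes \<open>\<rho>\<close> a probability
  and, moved into the eigenfunction, gives it integral \<open>1\<close>.\<close>

lemma RPF_exists:
  assumes f: "f \<in> Lip"
  shows "\<exists>p. is_RPF \<nu> f p"
proof -
  obtain l V where l: "0 < l" and V: "V \<in> Lip" and eig: "\<And>x. transfer \<nu> f (\<lambda>x. exp (V x)) x = l * exp (V x)"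
    by (rule eigenfunction_exists[OF f]) blast
  note cf = Lip_continuous[OF f] and cV = Lip_continuous[OF V]
  define F where "F x = f x + ln (exp (V x)) - ln (exp (V (shift x))) - ln l" for x
  note F = normalize_Lip[OF f Lip_exp[OF V] exp_gt_zero l eig F_def]
  obtain \<mu> where \<mu>: "borel_prob \<mu>" "dual_eigenmeasure \<nu> F 1 \<mu>" using invariant_measure_exists[OF F] .
  define Z where "Z = (\<integral>x. exp (- V x) \<partial>\<mu>)"
  have ceV: "continuous_on UNIV (\<lambda>x. exp (- V x))" using cV by (intro continuous_intros)
  have Z: "0 < Z" unfolding Z_def by (rule borel_prob_integral_pos[OF compact_sequences \<mu>(1) ceV]) simp
  define \<rho> where "\<rho> = density \<mu> (\<lambda>x. ennreal (exp (- V x) / Z))"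
  have meas: "(\<lambda>x. exp (- V x) / Z) \<in> borel_measurable \<mu>"
    using Z by (intro borel_prob_measurable[OF \<mu>(1)] continuous_intros cV) auto
  have int_\<rho>: "(\<integral>x. \<phi> x \<partial>\<rho>) = (\<integral>x. exp (- V x) * \<phi> x \<partial>\<mu>) / Z" if "continuous_on UNIV \<phi>" for \<phi> :: "_ \<Rightarrow> real"
  proof -
    have "(\<integral>x. \<phi> x \<partial>\<rho>) = (\<integral>x. (exp (- V x) / Z) *\<^sub>R \<phi> x \<partial>\<mu>)"
      unfolding \<rho>_def using Z by (intro integral_density borel_prob_measurable[OF \<mu>(1) that] meas) auto
    then show ?thesis by simp
  qed
  have "borel_prob \<rho>"
  proof -
    have "emeasure \<rho> (space \<rho>) = (\<integral>\<^sup>+x. ennreal (exp (- V x) / Z) \<partial>\<mu>)"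
      using meas by (simp add: \<rho>_def emeasure_density cong: nn_integral_cong)
    also have "\<dots> = ennreal (\<integral>x. exp (- V x) / Z \<partial>\<mu>)"
      using Z by (intro nn_integral_eq_integral integrable_continuous[OF \<mu>(1)] continuous_intros cV) auto
    also have "\<dots> = 1" using Z by (simp add: Z_def)
    finally have "prob_space \<rho>" by (rule prob_spaceI)
    then show ?thesis using \<mu>(1) by (simp add: borel_prob_def \<rho>_def)
  qed
  moreover have "dual_eigenmeasure \<nu> f l \<rho>"
    unfolding dual_eigenmeasure_def ruelle_eq_transfer
  proof (intro allI impI)
    fix \<phi> :: "(nat \<Rightarrow> 'a) \<Rightarrow> real" assume \<phi>: "continuous_on UNIV \<phi>"
    let ?\<psi> = "\<lambda>x. exp (- V x) * \<phi> x"
    have c\<psi>: "continuous_on UNIV ?\<psi>" using \<phi> cV by (intro continuous_intros)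
    have "exp (- V x) * transfer \<nu> f \<phi> x = l * transfer \<nu> F ?\<psi> x" for x
    proof -
      have "\<phi> = (\<lambda>x. exp (V x) *\<^sub>R ?\<psi> x)" by (simp flip: mult.assoc exp_add)
      then have "transfer \<nu> f \<phi> x = (l * exp (V x)) *\<^sub>R transfer \<nu> F ?\<psi> x"
        using transfer_normalize[of "\<lambda>x. exp (V x)", OF exp_gt_zero l F_def, of ?\<psi> x] by simp
      then show ?thesis by (simp add: exp_minus)
    qed
    then have "(\<integral>x. transfer \<nu> f \<phi> x \<partial>\<rho>) = (\<integral>x. l * transfer \<nu> F ?\<psi> x \<partial>\<mu>) / Z"
      by (simp add: int_\<rho>[OF continuous_transfer[OF cf \<phi>]])
    also have "\<dots> = l * (\<integral>x. ?\<psi> x \<partial>\<mu>) / Z"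
      using \<mu>(2) c\<psi> by (simp add: dual_eigenmeasure_def ruelle_eq_transfer)
    finally show "(\<integral>x. transfer \<nu> f \<phi> x \<partial>\<rho>) = l * (\<integral>x. \<phi> x \<partial>\<rho>)" by (simp add: int_\<rho>[OF \<phi>])
  qed
  moreover have "(\<integral>x. Z * exp (V x) \<partial>\<rho>) = 1"
  proof -
    have "(\<integral>x. Z * exp (V x) \<partial>\<rho>) = (\<integral>x. exp (- V x) * (Z * exp (V x)) \<partial>\<mu>) / Z"
      using cV by (intro int_\<rho> continuous_intros)
    also have "(\<lambda>x. exp (- V x) * (Z * exp (V x))) = (\<lambda>_. Z)" by (simp add: exp_minus field_simps)
    finally show ?thesis using Z borel_prob_integral_const[OF \<mu>(1), of Z] by simp
  qed
  moreover have "transfer \<nu> f (\<lambda>x. Z * exp (V x)) x = l * (Z * exp (V x))" for x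
    by (simp add: transfer_mult eig)
  ultimately have "is_RPF \<nu> f (l, \<lambda>x. Z * exp (V x), \<rho>)"
    using l Z Lip_cmult[OF Lip_exp[OF V]] by (simp add: is_RPF_def ruelle_eq_transfer)
  then show ?thesis ..
qed

text \<open>From here on, the choice is accessed only through these properties.\<close>

lemma RPF_is_RPF: "f \<in> Lip \<Longrightarrow> is_RPF \<nu> f (RPF \<nu> f)"
  unfolding RPF_def by (rule someI_ex) (rule RPF_exists)

lemma RPF_properties:
  assumes "f \<in> Lip"
  shows eigenvalue_pos: "0 < RPF_eigenvalue \<nu> f"
    and eigenfunction_Lip: "RPF_eigenfunction \<nu> f \<in> Lip"
    and eigenfunction_pos: "0 < RPF_eigenfunction \<nu> f x"
    and eigenfunction_eq: "transfer \<nu> f (RPF_eigenfunction \<nu> f) x = RPF_eigenvalue \<nu> f * RPF_eigenfunction \<nu> f x"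
  using RPF_is_RPF[OF assms]
  by (simp_all add: is_RPF_def RPF_eigenvalue_def RPF_eigenfunction_def case_prod_unfold ruelle_eq_transfer)

lemma eigenmeasure_exists:
  assumes "f \<in> Lip"
  obtains \<rho> where "borel_prob \<rho>" "dual_eigenmeasure \<nu> f (RPF_eigenvalue \<nu> f) \<rho>"
  using RPF_is_RPF[OF assms] that
  by (auto simp: is_RPF_def RPF_eigenvalue_def case_prod_unfold)

lemma normalization_properties:
  assumes "f \<in> Lip"
  shows normalization_Lip: "normalization \<nu> f \<in> Lip"
    and normalized_normalization: "normalized \<nu> (normalization \<nu> f)"
  using normalize_Lip[OF assms eigenfunction_Lip[OF assms] eigenfunction_pos[OF assms] eigenvalue_pos[OF assms]
      eigenfunction_eq[OF assms] normalization_def] by auto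

lemma gibbs_properties:
  assumes "f \<in> Lip"
  shows borel_prob_gibbs: "borel_prob (gibbs \<nu> f)"
    and dual_gibbs: "dual_eigenmeasure \<nu> (normalization \<nu> f) 1 (gibbs \<nu> f)"
proof -
  note F = normalization_properties[OF assms]
  obtain \<mu> where \<mu>: "borel_prob \<mu>" "dual_eigenmeasure \<nu> (normalization \<nu> f) 1 \<mu>"
    using invariant_measure_exists[OF F] .
  have "borel_prob (gibbs \<nu> f) \<and> dual_eigenmeasure \<nu> (normalization \<nu> f) 1 (gibbs \<nu> f)"
    unfolding gibbs_def
    by (rule theI[of _ \<mu>]) (use \<mu> invariant_measure_unique[OF F] in auto)
  then show "borel_prob (gibbs \<nu> f)" "dual_eigenmeasure \<nu> (normalization \<nu> f) 1 (gibbs \<nu> f)" by auto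
qed

lemma transfer_eigenfunction_scaleR:
  fixes \<phi> :: "(nat \<Rightarrow> 'a) \<Rightarrow> 'b::{banach,second_countable_topology}"
  assumes "f \<in> Lip"
  shows "transfer \<nu> f (\<lambda>x. RPF_eigenfunction \<nu> f x *\<^sub>R \<phi> x) x
    = (RPF_eigenvalue \<nu> f * RPF_eigenfunction \<nu> f x) *\<^sub>R transfer \<nu> (normalization \<nu> f) \<phi> x"
  by (rule transfer_normalize[where F = "normalization \<nu> f" and f = f])
    (use eigenfunction_pos[OF assms] eigenvalue_pos[OF assms] normalization_def in auto)

section \<open>Poisson's equation and the support of the invariant measure\<close>

text \<open>Neumann series: \<open>q\<close> is the sum of the iterates of \<open>w\<close>, which
  decay geometrically since their limit is the integral of \<open>w\<close>, namely
  \<open>0\<close>. The operator passes through the series by dominated convergence of the partial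
  sums.\<close>

lemma poisson_equation:
  assumes F: "F \<in> Lip" "normalized \<nu> F" and \<mu>: "borel_prob \<mu>" "dual_eigenmeasure \<nu> F 1 \<mu>"
    and w: "w \<in> Lip" "(\<integral>x. w x \<partial>\<mu>) = 0"
  obtains q where "q \<in> Lip" "\<And>x. q x - transfer \<nu> F q x = w x"
proof -
  let ?L = "\<lambda>n. transfer \<nu> F ^^ n"
  have cF: "continuous_on UNIV F" using F(2) by (simp add: normalized_def)
  note cw = Lip_continuous[OF w(1)]
  obtain C \<theta> l where C: "0 \<le> C" and \<theta>: "0 \<le> \<theta>" "\<theta> < (1::real)"
    and lip: "\<And>n x y. \<bar>?L n w x - ?L n w y\<bar> \<le> C * \<theta> ^ n * seq_dist x y"
    and l: "\<And>n x. \<bar>?L n w x - l\<bar> \<le> C * \<theta> ^ n"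
    using spectral_gap[OF F w(1)] by metis
  have lim: "(\<lambda>n. ?L n w x) \<longlonglongrightarrow> l" for x
  proof (rule LIM_zero_cancel, rule Lim_null_comparison)
    show "(\<lambda>n. C * \<theta> ^ n) \<longlonglongrightarrow> 0"
      using LIMSEQ_realpow_zero[OF \<theta>] tendsto_mult_right_zero by blast
  qed (use l in auto)
  have "l = 0" using dual_integral_limit[OF F(2) \<mu> cw lim] w(2) by simp
  then have bound: "\<bar>?L n w x\<bar> \<le> C * \<theta> ^ n" for n x using l[of n x] by simp
  have geo: "summable (\<lambda>n. C * \<theta> ^ n)" using \<theta> by (intro summable_mult summable_geometric) auto
  have sum: "summable (\<lambda>n. ?L n w x)" for x
    by (rule summable_comparison_test'[OF geo]) (use bound in auto)
  define q where "q x = (\<Sum>n. ?L n w x)" for x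
  define s where "s n x = (\<Sum>k<n. ?L k w x)" for n x
  define B where "B = (\<Sum>n. C * \<theta> ^ n)"
  have B: "(\<Sum>k<n. C * \<theta> ^ k) \<le> B" for n
    unfolding B_def using C \<theta> by (intro sum_le_suminf geo) auto
  have s_lim: "(\<lambda>n. s n x) \<longlonglongrightarrow> q x" for x
    unfolding s_def q_def by (rule summable_LIMSEQ[OF sum])
  have s_cont: "continuous_on UNIV (s n)" for n
    unfolding s_def by (intro continuous_on_sum continuous_iterate cF cw)
  have q: "q \<in> Lip"
  proof (rule LipI, rule LIMSEQ_le_const2)
    fix x y
    show "(\<lambda>n. \<bar>s n x - s n y\<bar>) \<longlonglongrightarrow> \<bar>q x - q y\<bar>" by (intro tendsto_intros s_lim)
    have "\<bar>s n x - s n y\<bar> \<le> B * seq_dist x y" for n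
    proof -
      have "\<bar>s n x - s n y\<bar> \<le> (\<Sum>k<n. C * \<theta> ^ k * seq_dist x y)"
        unfolding s_def sum_subtractf[symmetric] by (rule order_trans[OF sum_abs]) (intro sum_mono lip)
      also have "\<dots> \<le> B * seq_dist x y"
        unfolding sum_distrib_right[symmetric] by (intro mult_right_mono B seq_dist_nonneg)
      finally show ?thesis .
    qed
    then show "\<exists>N. \<forall>n\<ge>N. \<bar>s n x - s n y\<bar> \<le> B * seq_dist x y" by blast
  qed
  have s_step: "transfer \<nu> F (s n) x = s (Suc n) x - w x" for n x
  proof (induction n)
    case 0
    show ?case by (simp add: s_def transfer_const[OF F(2)])
  next
    case (Suc n)
    have "s (Suc n) = (\<lambda>x. s n x + ?L n w x)" by (simp add: s_def fun_eq_iff)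
    then have "transfer \<nu> F (s (Suc n)) x = transfer \<nu> F (s n) x + ?L (Suc n) w x"
      by (simp add: transfer_add[OF cF s_cont continuous_iterate[OF cF cw]])
    moreover have "s (Suc (Suc n)) x = s (Suc n) x + ?L (Suc n) w x" by (simp add: s_def)
    ultimately show ?case using Suc by simp
  qed
  have "transfer \<nu> F q x = q x - w x" for x
  proof (rule LIMSEQ_unique)
    show "(\<lambda>n. transfer \<nu> F (s n) x) \<longlonglongrightarrow> transfer \<nu> F q x"
    proof (rule transfer_tendsto[OF cF s_cont Lip_continuous[OF q] s_lim])
      show "norm (s n x) \<le> B" for n x
        unfolding s_def real_norm_def
        by (rule order_trans[OF sum_abs order_trans[OF sum_mono B]]) (rule bound)
    qed
    show "(\<lambda>n. transfer \<nu> F (s n) x) \<longlonglongrightarrow> q x - w x"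
      unfolding s_step by (intro tendsto_intros LIMSEQ_Suc s_lim)
  qed
  then show ?thesis using that[OF q] by simp
qed

section \<open>Cylinders and strict positivity\<close>

primrec prefix :: "nat \<Rightarrow> (nat \<Rightarrow> 'a) \<Rightarrow> (nat \<Rightarrow> 'a) \<Rightarrow> (nat \<Rightarrow> 'a)" where
  "prefix 0 x z = z"
| "prefix (Suc n) x z = prepend (x 0) (prefix n (shift x) z)"

lemma seq_dist_prefix: "seq_dist x (prefix n x z) \<le> (1/2) ^ n"
proof (induction n arbitrary: x)
  case (Suc n)
  have "seq_dist x (prefix (Suc n) x z) = seq_dist (shift x) (prefix n (shift x) z) / 2"
    by (subst prepend_shift[of x, symmetric]) (simp only: prefix.simps shift_prepend prepend_0 seq_dist_prepend)
  then show ?case using Suc[of "shift x"] by simp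
qed (simp add: seq_dist_le_1)

text \<open>A continuous nonnegative integrand that is positive at one letter is positive on an open
  set of letters, which full support gives positive mass.\<close>

lemma transfer_pos_at:
  assumes supp: "measure_support \<nu> = UNIV" and F: "continuous_on UNIV F"
    and \<phi>: "continuous_on UNIV \<phi>" "\<And>x. (0::real) \<le> \<phi> x" "0 < \<phi> (prepend a z)"
  shows "0 < transfer \<nu> F \<phi> z"
proof -
  let ?b = "\<lambda>a. exp (F (prepend a z)) *\<^sub>R \<phi> (prepend a z)"
  have nonneg: "0 \<le> transfer \<nu> F \<phi> z"
    unfolding transfer_def using \<phi> by (intro Bochner_Integration.integral_nonneg) auto
  moreover have "transfer \<nu> F \<phi> z \<noteq> 0"
  proof
    assume "transfer \<nu> F \<phi> z = 0"
    then have "AE b in \<nu>. ?b b = 0"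
      using \<phi> integral_nonneg_eq_0_iff_AE[OF integrable_branch[OF F \<phi>(1), of z]]
      by (simp add: transfer_def)
    then have ae: "AE b in \<nu>. b \<notin> {b. ?b b \<noteq> 0}" by simp
    have "open {b. ?b b \<noteq> 0}" by (intro open_Collect_neq continuous_branch F \<phi> continuous_on_const)
    moreover have "a \<in> {b. ?b b \<noteq> 0}" using \<phi>(3) by simp
    ultimately have "0 < emeasure \<nu> {b. ?b b \<noteq> 0}" using supp by (auto simp: measure_support_def)
    moreover have "{b. ?b b \<noteq> 0} \<in> sets \<nu>"
      using \<open>open {b. ?b b \<noteq> 0}\<close> borel_prob_\<nu> by (auto simp: borel_prob_def)
    ultimately show False 
      using ae AE_iff_null_sets[of "{b. ?b b \<noteq> 0}" \<nu>] by (simp add: null_sets_def)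
  qed
  ultimately show ?thesis by simp
qed

text \<open>Applying the operator \<open>n\<close> times integrates over all words of length
  \<open>n\<close> put in front of \<open>z\<close>, among them those near the first
  \<open>n\<close> letters of \<open>x\<close>.\<close>

lemma iterate_pos:
  assumes supp: "measure_support \<nu> = UNIV" and F: "normalized \<nu> F"
    and \<phi>: "continuous_on UNIV \<phi>" "\<And>x. (0::real) \<le> \<phi> x" "\<And>z. 0 < \<phi> (prefix n x z)"
  shows "0 < (transfer \<nu> F ^^ n) \<phi> z"
  using \<phi>
proof (induction n arbitrary: \<phi> x)
  case (Suc n)
  have cF: "continuous_on UNIV F" using F by (simp add: normalized_def)
  \<comment> \<open>One application consumes the first letter of the cylinder, so the induction
    hypothesis is used for \<open>transfer \<nu> F \<phi>\<close> and
    \<open>shift x\<close>.\<close>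
  have "0 < (transfer \<nu> F ^^ n) (transfer \<nu> F \<phi>) z"
  proof (rule Suc.IH)
    show "continuous_on UNIV (transfer \<nu> F \<phi>)" by (rule continuous_transfer[OF cF Suc.prems(1)])
    show "0 \<le> transfer \<nu> F \<phi> y" for y by (rule transfer_ge[OF F Suc.prems(1,2)])
    show "0 < transfer \<nu> F \<phi> (prefix n (shift x) y)" for y
      using Suc.prems(3)[of y] by (intro transfer_pos_at[OF supp cF Suc.prems(1,2), of "x 0"]) simp
  qed
  then show ?case by (simp add: funpow_swap1)
qed simp

text \<open>In effect \<open>\<mu>\<close> has full support. A positive value at \<open>x\<close>
  extends to a cylinder around \<open>x\<close>, some iterate is then positive everywhere, and by
  invariance its integral is that of \<open>\<phi>\<close>. The use is to pass from zero variance to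
  \<open>h x = 0\<close> at every point.\<close>

lemma zero_if_integral_zero:
  assumes supp: "measure_support \<nu> = UNIV" and F: "F \<in> Lip" "normalized \<nu> F"
    and \<mu>: "borel_prob \<mu>" "dual_eigenmeasure \<nu> F 1 \<mu>"
    and \<phi>: "\<phi> \<in> Lip" "\<And>x. 0 \<le> \<phi> x" "(\<integral>x. \<phi> x \<partial>\<mu>) = 0"
  shows "\<phi> x = 0"
proof (rule ccontr)
  assume "\<phi> x \<noteq> 0"
  then have pos: "0 < \<phi> x" using \<phi>(2)[of x] by simp
  obtain M where M: "M > 0" "seq_lipschitz M \<phi>" using \<phi>(1) by (rule LipE)
  obtain n where n: "(1/2) ^ n < \<phi> x / M" using real_arch_pow_inv[of "\<phi> x / M" "1/2"] pos M by auto
  have "0 < \<phi> (prefix n x z)" for z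
  proof -
    have "\<phi> x - \<phi> (prefix n x z) \<le> M * seq_dist x (prefix n x z)"
      using M(2) abs_le_D1 unfolding seq_lipschitz_def by blast
    also have "\<dots> \<le> M * (1/2) ^ n" using M by (intro mult_left_mono seq_dist_prefix) auto
    also have "\<dots> < \<phi> x" using n M by (simp add: field_simps)
    finally show ?thesis by simp
  qed
  then have "0 < (transfer \<nu> F ^^ n) \<phi> z" for z
    by (rule iterate_pos[OF supp F(2) Lip_continuous[OF \<phi>(1)] \<phi>(2)])
  then have "0 < (\<integral>z. (transfer \<nu> F ^^ n) \<phi> z \<partial>\<mu>)"
    by (intro borel_prob_integral_pos[OF compact_sequences \<mu>(1)] continuous_iterate Lip_continuous F \<phi>)
  then show False using dual_iterate[OF F(2) \<mu>(2) Lip_continuous[OF \<phi>(1)], of n] \<phi>(3) by simp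
qed

end

section \<open>Second order expansion of the perturbed operator\<close>

text \<open>Since \<open>fact (k + n) \<ge> fact k\<close>, the factor \<open>norm y ^ n\<close>
  comes out of the tail and the whole series remains.\<close>

lemma exp_remainder:
  fixes y :: "'b::{banach,real_normed_algebra_1}"
  shows "norm (exp y - (\<Sum>k<n. y ^ k /\<^sub>R fact k)) \<le> norm y ^ n * exp (norm y)"
proof -
  let ?f = "\<lambda>k. y ^ k /\<^sub>R fact k" and ?r = "\<lambda>k. norm y ^ k /\<^sub>R fact k"
  have le: "norm (?f (k + n)) \<le> norm y ^ n * ?r k" for k
  proof -
    have "norm (?f (k + n)) \<le> norm y ^ (k + n) / fact (k + n)"
      by (simp add: divide_inverse_commute mult_left_mono norm_power_ineq)
    also have "\<dots> \<le> norm y ^ (k + n) / fact k" by (intro divide_left_mono fact_mono) auto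
    finally show ?thesis by (simp add: power_add divide_inverse mult_ac)
  qed
  have sr: "summable (\<lambda>k. norm y ^ n * ?r k)" by (intro summable_mult summable_exp_generic)
  have sn: "summable (\<lambda>k. norm (?f (k + n)))"
    by (rule summable_comparison_test'[OF sr]) (use le in auto)
  have "exp y - (\<Sum>k<n. ?f k) = (\<Sum>k. ?f (k + n))"
    unfolding exp_def using suminf_split_initial_segment[OF summable_exp_generic, of y n] by simp
  also have "norm \<dots> \<le> (\<Sum>k. norm (?f (k + n)))" by (rule summable_norm[OF sn])
  also have "\<dots> \<le> (\<Sum>k. norm y ^ n * ?r k)" by (rule suminf_le[OF le sn sr])
  also have "\<dots> = norm y ^ n * exp (norm y)"
    unfolding exp_def by (rule suminf_mult[OF summable_exp_generic])
  finally show ?thesis .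
qed

text \<open>\<open>r\<close> is the small quantity, later \<open>norm z\<close> or its square, and
  \<open>K\<close> bounds the coefficient; the constants are free of \<open>r\<close>.\<close>

lemma exp_remainder_bound:
  fixes y :: "'b::{banach,real_normed_field}"
  assumes "norm y \<le> K * r" "K * r \<le> K" "0 \<le> K" "0 \<le> r"
  shows "norm (exp y - 1) \<le> K * exp K * r"
    and "norm (exp y - 1 - y) \<le> K ^ 2 * exp K * r ^ 2"
    and "norm (exp y - 1 - y - y ^ 2 / 2) \<le> K ^ 3 * exp K * r ^ 3"
proof -
  have le: "norm y ^ n * exp (norm y) \<le> K ^ n * exp K * r ^ n" for n
  proof -
    have "norm y ^ n * exp (norm y) \<le> (K * r) ^ n * exp K"
      using assms by (intro mult_mono power_mono) auto
    then show ?thesis by (simp add: power_mult_distrib mult_ac)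
  qed
  show "norm (exp y - 1) \<le> K * exp K * r"
    using order_trans[OF exp_remainder[of y 1] le[of 1]] by simp
  show "norm (exp y - 1 - y) \<le> K ^ 2 * exp K * r ^ 2"
    using order_trans[OF exp_remainder[of y 2] le[of 2]] by (simp add: numeral_2_eq_2 algebra_simps)
  have "{..<3} = {0, 1, 2 :: nat}" by auto
  then have "(\<Sum>k<3. y ^ k /\<^sub>R fact k) = 1 + y + y ^ 2 / 2"
    by (simp add: scaleR_conv_of_real)
  then show "norm (exp y - 1 - y - y ^ 2 / 2) \<le> K ^ 3 * exp K * r ^ 3"
    using order_trans[OF exp_remainder[of y 3] le[of 3]] by (simp add: diff_diff_eq)
qed

context full_shift
begin

text \<open>
  The function \<open>q\<close> makes the second order term of the expansion below constant.
\<close>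

lemma gordin_decomposition:
  assumes F: "F \<in> Lip" "normalized \<nu> F" and \<mu>: "borel_prob \<mu>" "dual_eigenmeasure \<nu> F 1 \<mu>"
    and g: "g \<in> Lip"
  obtains u h q where "u \<in> Lip" "h \<in> Lip" "q \<in> Lip"
    "\<And>x. g x = (\<integral>x. g x \<partial>\<mu>) + h x + u (shift x) - u x"
    "\<And>x. transfer \<nu> F h x = 0"
    "\<And>x. transfer \<nu> F (\<lambda>x. (h x)\<^sup>2 + q x) x = (\<integral>x. (h x)\<^sup>2 \<partial>\<mu>) + q x"
proof -
  have cF: "continuous_on UNIV F" using F(2) by (simp add: normalized_def)
  define m where "m = (\<integral>x. g x \<partial>\<mu>)"
  have center: "(\<integral>x. \<phi> x - (\<integral>x. \<phi> x \<partial>\<mu>) \<partial>\<mu>) = 0" if "\<phi> \<in> Lip" for \<phi> :: "(nat \<Rightarrow> 'a) \<Rightarrow> real"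
    using Bochner_Integration.integral_diff[OF integrable_continuous[OF \<mu>(1) Lip_continuous[OF that]]
        integrable_continuous[OF \<mu>(1) continuous_on_const], of "\<integral>x. \<phi> x \<partial>\<mu>"]
    unfolding borel_prob_integral_const[OF \<mu>(1)] by simp
  have g': "(\<lambda>x. g x - m) \<in> Lip" by (intro Lip_diff g Lip_const)
  obtain U where U: "U \<in> Lip" "\<And>x. U x - transfer \<nu> F U x = g x - m"
    by (rule poisson_equation[OF F \<mu> g']) (use center[OF g] in \<open>auto simp: m_def\<close>)
  \<comment> \<open>Thus \<open>u\<close> is the image of \<open>U\<close>. The operator sends both
    terms of \<open>h x = U x - u (shift x)\<close> to \<open>u\<close>, so \<open>h\<close> is in
    its kernel, and \<open>g x - m = U x - u x\<close> differs from \<open>h x\<close> by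
    \<open>u (shift x) - u x\<close>.\<close>
  define u where "u x = U x - (g x - m)" for x
  have u: "u \<in> Lip" unfolding u_def by (intro Lip_diff U g Lip_const)
  have u_eq: "transfer \<nu> F U x = u x" for x using U(2)[of x] by (simp add: u_def)
  define h where "h x = U x - u (shift x)" for x
  have h: "h \<in> Lip" unfolding h_def by (intro Lip_diff U Lip_shift u)
  have Lh: "transfer \<nu> F h x = 0" for x
    unfolding h_def
    using transfer_diff[OF cF Lip_continuous[OF U(1)] Lip_continuous[OF Lip_shift[OF u]], of x]
      transfer_shift[OF F(2), of u x] by (simp add: u_eq)
  define s where "s = (\<integral>x. (h x)\<^sup>2 \<partial>\<mu>)"
  have h2: "(\<lambda>x. (h x)\<^sup>2) \<in> Lip" unfolding power2_eq_square by (intro Lip_mult h)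
  have h2': "(\<lambda>x. (h x)\<^sup>2 - s) \<in> Lip" by (intro Lip_diff h2 Lip_const)
  obtain Q where Q: "Q \<in> Lip" "\<And>x. Q x - transfer \<nu> F Q x = (h x)\<^sup>2 - s"
    by (rule poisson_equation[OF F \<mu> h2']) (use center[OF h2] in \<open>auto simp: s_def\<close>)
  \<comment> \<open>\<open>q\<close> is the image of \<open>Q\<close>, and
    \<open>(h x)\<^sup>2 + q x = Q x + s\<close> has the image \<open>q x + s\<close>.\<close>
  define q where "q x = Q x - ((h x)\<^sup>2 - s)" for x
  have q: "q \<in> Lip" unfolding q_def by (intro Lip_diff Q h2 Lip_const)
  have "(\<lambda>x. (h x)\<^sup>2 + q x) = (\<lambda>x. Q x + s)" by (simp add: q_def)
  then have "transfer \<nu> F (\<lambda>x. (h x)\<^sup>2 + q x) x = s + q x" for x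
    using transfer_add[OF cF Lip_continuous[OF Q(1)] continuous_on_const, of s x]
      transfer_const[OF F(2), of s x] Q(2)[of x] by (simp add: q_def)
  then show ?thesis
    using that[OF u h q] Lh by (simp add: s_def m_def[symmetric]) (simp add: h_def u_def)
qed

section \<open>Approximate eigenfunctions of the perturbed operator\<close>

definition test_function ::
  "'b::{real_normed_field,banach} \<Rightarrow> ((nat \<Rightarrow> 'a) \<Rightarrow> real) \<Rightarrow> ((nat \<Rightarrow> 'a) \<Rightarrow> real) \<Rightarrow> (nat \<Rightarrow> 'a) \<Rightarrow> 'b"
where
  "test_function z u q x = exp (z * of_real (u x)) * (1 + z\<^sup>2 / 2 * of_real (q x))"

lemma continuous_test_function:
  assumes "u \<in> Lip" "q \<in> Lip"
  shows "continuous_on UNIV (test_function z u q)"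
  unfolding test_function_def using Lip_continuous[OF assms(1)] Lip_continuous[OF assms(2)]
  by (intro continuous_intros)

text \<open>Up to third order the argument of the operator is
  \<open>1 + z * h + z\<^sup>2 / 2 * (h\<^sup>2 + q)\<close>. The operator removes the linear term
  and turns the quadratic one into \<open>z\<^sup>2 / 2 * (s + q)\<close>; the result agrees with
  \<open>exp (z\<^sup>2 * s / 2) * (1 + z\<^sup>2 / 2 * q)\<close> even up to fourth order.\<close>

lemma perturbed_transfer_kernel:
  fixes F h q :: "(nat \<Rightarrow> 'a) \<Rightarrow> real"
  assumes F: "normalized \<nu> F" and h: "h \<in> Lip" and q: "q \<in> Lip"
    and Lh: "\<And>x. transfer \<nu> F h x = 0"
    and Lq: "\<And>x. transfer \<nu> F (\<lambda>x. (h x)\<^sup>2 + q x) x = s + q x"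
  shows "\<exists>C>0. \<forall>z :: 'b::{real_normed_field,banach,second_countable_topology}. norm z \<le> 1 \<longrightarrow>
    (\<forall>x. norm (transfer \<nu> F (\<lambda>x. exp (z * of_real (h x)) * (1 + z\<^sup>2 / 2 * of_real (q x))) x
        - exp (z\<^sup>2 * of_real (s / 2)) * (1 + z\<^sup>2 / 2 * of_real (q x))) \<le> C * norm z ^ 3)"
proof -
  have cF: "continuous_on UNIV F" using F by (simp add: normalized_def)
  note ch = Lip_continuous[OF h] and cq = Lip_continuous[OF q]
  obtain H where H: "0 < H" "\<And>x. norm (h x) \<le> H" using continuous_bounded[OF ch] by blast
  obtain Q where Q: "0 < Q" "\<And>x. norm (q x) \<le> Q" using continuous_bounded[OF cq] by blast
  define S where "S = \<bar>s\<bar> / 2"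
  have S: "0 \<le> S" by (simp add: S_def)
  define C1 where "C1 = H ^ 3 * exp H + H * exp H * Q / 2"
  define C2 where "C2 = S ^ 2 * exp S + S * exp S * Q / 2"
  have C: "0 < C1 + C2"
    unfolding C1_def C2_def using H Q S by (intro add_pos_nonneg) auto
  have main: "norm (transfer \<nu> F (\<lambda>x. exp (z * of_real (h x)) * (1 + z\<^sup>2 / 2 * of_real (q x))) x
        - exp (z\<^sup>2 * of_real (s / 2)) * (1 + z\<^sup>2 / 2 * of_real (q x))) \<le> (C1 + C2) * norm z ^ 3"
    if z: "norm z \<le> 1" for z :: 'b and x
  proof -
    let ?z2 = "z\<^sup>2 / 2"
    \<comment> \<open>Serves twice: with \<open>e\<close> the exponential of \<open>z * h\<close>,
      and with \<open>h2 = 0\<close> for the eigenvalue \<open>exp t\<close>.\<close>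
    have ring_id: "e * (1 + c * Q) - (1 + y + c * (h2 + Q)) = (e - 1 - y - c * h2) + (e - 1) * (c * Q)"
      for e c Q y h2 :: 'b
      by (simp add: algebra_simps)
    have qz: "norm (?z2 * of_real (q x)) \<le> Q / 2 * norm z ^ 2" for x
      using mult_left_mono[OF Q(2), of "norm z ^ 2" x] by (simp add: norm_mult norm_divide norm_power mult_ac)
    define P where "P x = 1 + z * of_real (h x) + ?z2 * of_real ((h x)\<^sup>2 + q x)" for x
    define R where "R x = exp (z * of_real (h x)) * (1 + ?z2 * of_real (q x)) - P x" for x
    have cP: "continuous_on UNIV P" unfolding P_def by (intro continuous_intros ch cq)
    have cR: "continuous_on UNIV R"
      unfolding R_def P_def by (intro continuous_intros ch cq)
    have R: "norm (R x) \<le> C1 * norm z ^ 3" for x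
    proof -
      let ?y = "z * of_real (h x)"
      have y: "norm ?y \<le> H * norm z" using mult_left_mono[OF H(2)[of x], of "norm z"] by (simp add: norm_mult mult_ac)
      have b: "H * norm z \<le> H" "0 \<le> H" "0 \<le> norm z" using z H by (auto simp: mult_left_le)
      have yy: "?y\<^sup>2 / 2 = ?z2 * of_real ((h x)\<^sup>2)" by (simp add: power_mult_distrib)
      have "R x = (exp ?y - 1 - ?y - ?y\<^sup>2 / 2) + (exp ?y - 1) * (?z2 * of_real (q x))"
        unfolding R_def P_def yy of_real_add by (rule ring_id)
      also have "norm \<dots> \<le> norm (exp ?y - 1 - ?y - ?y\<^sup>2 / 2) + norm (exp ?y - 1) * norm (?z2 * of_real (q x))"
        unfolding norm_mult[symmetric] by (rule norm_triangle_ineq)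
      also have "\<dots> \<le> H ^ 3 * exp H * norm z ^ 3 + (H * exp H * norm z) * (Q / 2 * norm z ^ 2)"
        using qz H by (intro add_mono mult_mono exp_remainder_bound[OF y b]) auto
      also have "\<dots> = C1 * norm z ^ 3"
        by (simp add: C1_def algebra_simps power3_eq_cube power2_eq_square)
      finally show ?thesis .
    qed
    have "transfer \<nu> F P x = transfer \<nu> F (\<lambda>_. 1) x + transfer \<nu> F (\<lambda>x. z * of_real (h x)) x
        + transfer \<nu> F (\<lambda>x. ?z2 * of_real ((h x)\<^sup>2 + q x)) x"
    proof -
      have c: "continuous_on UNIV (\<lambda>x. z * of_real (h x))" 
        "continuous_on UNIV (\<lambda>x. ?z2 * of_real ((h x)\<^sup>2 + q x))"
        "continuous_on UNIV (\<lambda>x. 1 + z * of_real (h x))"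
        by (intro continuous_intros ch cq)+
      show ?thesis
        unfolding P_def transfer_add[OF cF c(3) c(2)] transfer_add[OF cF continuous_on_const c(1)] ..
    qed
    also have "transfer \<nu> F (\<lambda>_. 1 :: 'b) x = 1" by (rule transfer_const[OF F])
    also have "transfer \<nu> F (\<lambda>x. z * of_real (h x)) x = 0"
      by (simp add: transfer_mult transfer_of_real[OF cF ch] Lh)
    also have "transfer \<nu> F (\<lambda>x. ?z2 * of_real ((h x)\<^sup>2 + q x)) x = ?z2 * of_real (s + q x)"
      unfolding transfer_mult
      by (subst transfer_of_real[OF cF]) (auto intro!: continuous_intros ch cq simp: Lq)
    finally have LP: "transfer \<nu> F P x = 1 + ?z2 * of_real (s + q x)" by simp
    have "(\<lambda>x. exp (z * of_real (h x)) * (1 + ?z2 * of_real (q x))) = (\<lambda>x. P x + R x)"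
      by (simp add: R_def)
    then have L: "transfer \<nu> F (\<lambda>x. exp (z * of_real (h x)) * (1 + ?z2 * of_real (q x))) x
        = 1 + ?z2 * of_real (s + q x) + transfer \<nu> F R x"
      by (simp add: transfer_add[OF cF cP cR] LP)
    define t where "t = z\<^sup>2 * of_real (s / 2)"
    have t: "norm t \<le> S * norm z ^ 2" by (simp add: t_def S_def norm_mult norm_power)
    have z2: "norm z ^ 2 \<le> 1" "norm z ^ 4 \<le> norm z ^ 3"
      using z by (auto simp: power_le_one intro!: power_decreasing)
    have b: "S * norm z ^ 2 \<le> S" "0 \<le> S" "0 \<le> norm z ^ 2" using z2 S by (auto simp: mult_left_le)
    have "?z2 * of_real (s + q x) = t + ?z2 * (0 + of_real (q x))"
      by (simp add: t_def distrib_left add_divide_distrib)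
    then have "exp t * (1 + ?z2 * of_real (q x)) - (1 + ?z2 * of_real (s + q x))
        = (exp t - 1 - t) + (exp t - 1) * (?z2 * of_real (q x))"
      using ring_id[of "exp t" ?z2 "of_real (q x)" t 0] by (simp only: add.assoc) simp
    also have "norm \<dots> \<le> norm (exp t - 1 - t) + norm (exp t - 1) * norm (?z2 * of_real (q x))"
      unfolding norm_mult[symmetric] by (rule norm_triangle_ineq)
    also have "\<dots> \<le> S ^ 2 * exp S * (norm z ^ 2) ^ 2 + (S * exp S * norm z ^ 2) * (Q / 2 * norm z ^ 2)"
      using qz S by (intro add_mono mult_mono exp_remainder_bound[OF t b]) auto
    also have "\<dots> = C2 * norm z ^ 4"
      by (simp add: C2_def algebra_simps flip: power_add power_mult)
    also have "\<dots> \<le> C2 * norm z ^ 3" using z2 S Q by (intro mult_left_mono) (auto simp: C2_def)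
    finally have E: "norm (exp t * (1 + ?z2 * of_real (q x)) - (1 + ?z2 * of_real (s + q x))) \<le> C2 * norm z ^ 3" .
    have LR: "norm (transfer \<nu> F R x) \<le> C1 * norm z ^ 3" by (rule transfer_norm_le[OF F cR R])
    have "norm (transfer \<nu> F R x - (exp t * (1 + ?z2 * of_real (q x)) - (1 + ?z2 * of_real (s + q x))))
        \<le> C1 * norm z ^ 3 + C2 * norm z ^ 3"
      by (rule order_trans[OF norm_triangle_ineq4 add_mono[OF LR E]])
    then show ?thesis unfolding L t_def by (simp add: algebra_simps)
  qed
  show ?thesis using C main by blast
qed

text \<open>The factor \<open>exp (z * u)\<close> of the test function cancels the term
  \<open>- u\<close> in \<open>g\<close> and leaves \<open>exp (z * u (shift x))\<close>, which
  moves out of the operator. Only \<open>exp (z * h)\<close> remains inside, and the error grows by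
  the factor \<open>exp U\<close>.\<close>

lemma perturbed_transfer:
  fixes F g u h q :: "(nat \<Rightarrow> 'a) \<Rightarrow> real"
  assumes F: "normalized \<nu> F" and u: "u \<in> Lip" and h: "h \<in> Lip" and q: "q \<in> Lip"
    and g: "\<And>x. g x = m + h x + u (shift x) - u x"
    and Lh: "\<And>x. transfer \<nu> F h x = 0"
    and Lq: "\<And>x. transfer \<nu> F (\<lambda>x. (h x)\<^sup>2 + q x) x = s + q x"
  obtains C where "0 < C"
    "\<And>(z :: 'b::{real_normed_field,banach,second_countable_topology}) x. norm z \<le> 1 \<Longrightarrow>
    norm (transfer \<nu> F (\<lambda>x. exp (z * of_real (g x - m)) * test_function z u q x) x
        - exp (z\<^sup>2 * of_real (s / 2)) * test_function z u q x) \<le> C * norm z ^ 3"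
proof -
  obtain U where U: "0 < U" "\<And>x. norm (u x) \<le> U" using continuous_bounded[OF Lip_continuous[OF u]] by blast
  obtain C where C: "0 < C" "\<And>(z :: 'b) x. norm z \<le> 1 \<Longrightarrow>
    norm (transfer \<nu> F (\<lambda>x. exp (z * of_real (h x)) * (1 + z\<^sup>2 / 2 * of_real (q x))) x
        - exp (z\<^sup>2 * of_real (s / 2)) * (1 + z\<^sup>2 / 2 * of_real (q x))) \<le> C * norm z ^ 3"
    using perturbed_transfer_kernel[OF F h q Lh Lq, where ?'b = 'b] by blast
  show ?thesis
  proof (rule that[of "exp U * C"])
    fix z :: 'b and x :: "nat \<Rightarrow> 'a" assume z: "norm z \<le> 1"
    let ?k = "\<lambda>x. exp (z * of_real (h x)) * (1 + z\<^sup>2 / 2 * of_real (q x))"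
    have "exp (z * of_real (g x - m)) * test_function z u q x = exp (z * of_real (u (shift x))) * ?k x" for x
      by (simp add: g test_function_def algebra_simps flip: exp_add)
    then have "transfer \<nu> F (\<lambda>x. exp (z * of_real (g x - m)) * test_function z u q x) x
        = exp (z * of_real (u x)) * transfer \<nu> F ?k x"
      using transfer_shift_mult[of \<nu> F "\<lambda>x. exp (z * of_real (u x))" ?k x] by simp
    then have "norm (transfer \<nu> F (\<lambda>x. exp (z * of_real (g x - m)) * test_function z u q x) x
        - exp (z\<^sup>2 * of_real (s / 2)) * test_function z u q x)
        = norm (exp (z * of_real (u x))) * norm (transfer \<nu> F ?k x - exp (z\<^sup>2 * of_real (s / 2)) * (1 + z\<^sup>2 / 2 * of_real (q x)))"
      by (simp add: test_function_def algebra_simps flip: norm_mult)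
    also have "\<dots> \<le> exp U * (C * norm z ^ 3)"
    proof (intro mult_mono C z)
      have "norm (z * of_real (u x)) \<le> 1 * U" unfolding norm_mult using z U by (intro mult_mono) auto
      then show "norm (exp (z * of_real (u x))) \<le> exp U"
        using norm_exp[of "z * of_real (u x)"] by (intro order_trans[OF norm_exp]) simp
    qed auto
    finally show "norm (transfer \<nu> F (\<lambda>x. exp (z * of_real (g x - m)) * test_function z u q x) x
        - exp (z\<^sup>2 * of_real (s / 2)) * test_function z u q x) \<le> exp U * C * norm z ^ 3" by simp
  qed (use C in simp)
qed

end

section \<open>Derivatives of the pressure\<close>

text \<open>
  For a convex function, the difference quotients on both sides of \<open>t\<close> with increment
  \<open>\<epsilon> * t\<close> enclose the derivative at \<open>t\<close>, so a second order expansion at \<open>0\<close> can be differentiated.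
\<close>

lemma convex_second_derivative:
  fixes p D :: "real \<Rightarrow> real"
  assumes convex: "convex_on UNIV p" and D: "\<And>t. (p has_real_derivative D t) (at t)"
    and \<delta>: "0 < \<delta>" and expand: "\<And>t. \<bar>t\<bar> < \<delta> \<Longrightarrow> \<bar>p t - p 0 - (D 0 * t + v * t\<^sup>2 / 2)\<bar> \<le> C * \<bar>t\<bar> ^ 3"
  shows "(D has_real_derivative v) (at 0)"
proof -
  have "0 \<le> C"
  proof -
    have "0 \<le> C * \<bar>\<delta> / 2\<bar> ^ 3" using expand[of "\<delta> / 2"] \<delta> by (auto intro: order_trans[OF abs_ge_zero])
    then show ?thesis using \<delta> by (simp add: zero_le_mult_iff)
  qed
  have tangent: "D t * (y - t) \<le> p y - p t" for t y
    using convex_on_imp_above_tangent[OF convex, of t y "D t"] D[of t] by simp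
  have est: "\<bar>D t - D 0 - v * t\<bar> \<le> (\<bar>v\<bar> * \<epsilon> / 2 + 9 * C * \<bar>t\<bar> / \<epsilon>) * \<bar>t\<bar>"
    if t: "2 * \<bar>t\<bar> < \<delta>" "t \<noteq> 0" and \<epsilon>: "0 < \<epsilon>" "\<epsilon> \<le> 1" for t \<epsilon>
  proof -
    define X where "X = D t - D 0 - v * t"
    \<comment> \<open>The tangent at \<open>t\<close>, evaluated at \<open>?y\<close>. As
      \<open>\<bar>?y\<bar> \<le> 2 * \<bar>t\<bar>\<close>, the cubic error is \<open>8 * C\<close>
      there and \<open>C\<close> at \<open>t\<close>, hence the \<open>9 * C\<close>. The two signs
      of \<open>\<eta>\<close> give the two-sided bound.\<close>
    have one_side: "X * (\<eta> * t) \<le> \<bar>v\<bar> * \<epsilon>\<^sup>2 * t\<^sup>2 / 2 + 9 * C * \<bar>t\<bar> ^ 3" if \<eta>: "\<bar>\<eta>\<bar> = \<epsilon>" for \<eta>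
    proof -
      let ?y = "t + \<eta> * t"
      have y: "\<bar>?y\<bar> \<le> 2 * \<bar>t\<bar>"
      proof -
        have "\<bar>?y\<bar> \<le> \<bar>t\<bar> + \<bar>\<eta>\<bar> * \<bar>t\<bar>" unfolding abs_mult[symmetric] by (rule abs_triangle_ineq)
        also have "\<dots> \<le> \<bar>t\<bar> + 1 * \<bar>t\<bar>" using \<eta> \<epsilon> by (intro add_left_mono mult_right_mono) auto
        finally show ?thesis by simp
      qed
      have "C * \<bar>?y\<bar> ^ 3 \<le> C * (2 * \<bar>t\<bar>) ^ 3" using y \<open>0 \<le> C\<close> by (intro mult_left_mono power_mono) auto
      then have y3: "C * \<bar>?y\<bar> ^ 3 \<le> 8 * C * \<bar>t\<bar> ^ 3" by (simp add: power_mult_distrib)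
      have "D t * (\<eta> * t) \<le> p ?y - p t" using tangent[of t ?y] by simp
      moreover have "p ?y \<le> p 0 + (D 0 * ?y + v * ?y\<^sup>2 / 2) + 8 * C * \<bar>t\<bar> ^ 3"
        using expand[of ?y] y t y3 by linarith
      moreover have "p 0 + (D 0 * t + v * t\<^sup>2 / 2) - C * \<bar>t\<bar> ^ 3 \<le> p t"
        using expand[of t] t by linarith
      ultimately have bnd: "D t * (\<eta> * t) \<le> (D 0 * ?y + v * ?y\<^sup>2 / 2) - (D 0 * t + v * t\<^sup>2 / 2) + 9 * (C * \<bar>t\<bar> ^ 3)"
        by linarith
      have "X * (\<eta> * t) \<le> v * \<eta>\<^sup>2 * t\<^sup>2 / 2 + 9 * (C * \<bar>t\<bar> ^ 3)"
      proof -
        have "(D 0 * ?y + v * ?y\<^sup>2 / 2) - (D 0 * t + v * t\<^sup>2 / 2) = D 0 * (\<eta> * t) + v * t * (\<eta> * t) + v * \<eta>\<^sup>2 * t\<^sup>2 / 2"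
          by (simp add: power2_eq_square field_simps)
        moreover have "X * (\<eta> * t) = D t * (\<eta> * t) - D 0 * (\<eta> * t) - v * t * (\<eta> * t)"
          by (simp add: X_def algebra_simps)
        ultimately show ?thesis using bnd by linarith
      qed
      also have "v * \<eta>\<^sup>2 * t\<^sup>2 \<le> \<bar>v\<bar> * \<eta>\<^sup>2 * t\<^sup>2" by (intro mult_right_mono) auto
      also have "\<eta>\<^sup>2 = \<epsilon>\<^sup>2" using \<eta> by (metis power2_abs)
      finally show ?thesis by simp
    qed
    have "\<bar>X\<bar> * (\<epsilon> * \<bar>t\<bar>) = \<bar>X * (\<epsilon> * t)\<bar>" using \<epsilon> by (simp add: abs_mult)
    also have "\<dots> \<le> \<bar>v\<bar> * \<epsilon>\<^sup>2 * t\<^sup>2 / 2 + 9 * C * \<bar>t\<bar> ^ 3"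
      using one_side[of \<epsilon>] one_side[of "- \<epsilon>"] \<epsilon> by (auto simp: abs_le_iff)
    also have "\<dots> = ((\<bar>v\<bar> * \<epsilon> / 2 + 9 * C * \<bar>t\<bar> / \<epsilon>) * \<bar>t\<bar>) * (\<epsilon> * \<bar>t\<bar>)"
      using \<epsilon> t by (simp add: field_simps power2_eq_square power3_eq_cube flip: power2_abs[of t])
    finally show ?thesis using \<epsilon> t unfolding X_def[symmetric] by (subst (asm) mult_le_cancel_right_pos) auto
  qed
  have "((\<lambda>t. (D t - D 0) / (t - 0)) \<longlongrightarrow> v) (at 0)"
  proof (rule LIM_I)
    fix e :: real assume e: "0 < e"
    \<comment> \<open>The two terms of \<open>est\<close> pull \<open>\<epsilon>\<close> in opposite
      directions: \<open>\<epsilon>\<close> is fixed first to make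
      \<open>\<bar>v\<bar> * \<epsilon> / 2\<close> small, and \<open>d\<close> then depends on it,
      so that \<open>9 * C * \<bar>t\<bar> / \<epsilon>\<close> is small as well.\<close>
    define \<epsilon> where "\<epsilon> = min 1 (e / (\<bar>v\<bar> + 1))"
    have \<epsilon>: "0 < \<epsilon>" "\<epsilon> \<le> 1" using e by (auto simp: \<epsilon>_def)
    have "\<bar>v\<bar> * \<epsilon> \<le> \<bar>v\<bar> * (e / (\<bar>v\<bar> + 1))" by (intro mult_left_mono) (auto simp: \<epsilon>_def)
    also have "\<dots> \<le> e" using e by (simp add: field_simps)
    finally have 1: "\<bar>v\<bar> * \<epsilon> / 2 \<le> e / 2" by simp
    define d where "d = min (\<delta> / 2) (e * \<epsilon> / (18 * (C + 1)))"
    have d: "0 < d" using \<delta> e \<epsilon> \<open>0 \<le> C\<close> by (auto simp: d_def)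
    have "norm ((D t - D 0) / (t - 0) - v) < e" if t: "t \<noteq> 0" "norm (t - 0) < d" for t
    proof -
      have "9 * C * \<bar>t\<bar> \<le> 9 * (C + 1) * \<bar>t\<bar>" by (intro mult_right_mono) auto
      also have "\<dots> < 9 * (C + 1) * (e * \<epsilon> / (18 * (C + 1)))"
        using t \<open>0 \<le> C\<close> by (intro mult_strict_left_mono) (auto simp: d_def)
      also have "\<dots> = e / 2 * \<epsilon>" using \<open>0 \<le> C\<close> by (simp add: field_simps)
      finally have 2: "9 * C * \<bar>t\<bar> / \<epsilon> < e / 2" using \<epsilon> by (simp add: pos_divide_less_eq)
      have "\<bar>D t - D 0 - v * t\<bar> \<le> (\<bar>v\<bar> * \<epsilon> / 2 + 9 * C * \<bar>t\<bar> / \<epsilon>) * \<bar>t\<bar>"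
        using t by (intro est \<epsilon>) (auto simp: d_def)
      also have "\<dots> < e * \<bar>t\<bar>" using 1 2 t by (intro mult_strict_right_mono) linarith+
      finally have "\<bar>D t - D 0 - v * t\<bar> / \<bar>t\<bar> < e" using t by (simp add: pos_divide_less_eq)
      moreover have "(D t - D 0) / (t - 0) - v = (D t - D 0 - v * t) / t" using t by (simp add: field_simps)
      ultimately show ?thesis by simp
    qed
    then show "\<exists>s>0. \<forall>x. x \<noteq> 0 \<and> norm (x - 0) < s \<longrightarrow> norm ((D x - D 0) / (x - 0) - v) < e"
      using d by blast
  qed
  then show ?thesis by (simp add: has_field_derivative_iff)
qed

context full_shift
begin

lemma Lip_perturb: "f \<in> Lip \<Longrightarrow> g \<in> Lip \<Longrightarrow> (\<lambda>x. f x + t * (g x :: real)) \<in> (Lip :: ((nat \<Rightarrow> 'a) \<Rightarrow> real) set)"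
  by (intro Lip_add Lip_cmult)

text \<open>For \<open>w\<close>, the geometric interpolation of the two eigenfunctions, and
  \<open>K\<close>, that of the two eigenvalues, the operator of the intermediate potential maps
  \<open>w\<close> below \<open>K * w\<close>. Integration against the eigenmeasure of that
  potential bounds its eigenvalue by \<open>K\<close>.\<close>

lemma pressure_convex:
  assumes f: "f \<in> Lip" and g: "g \<in> Lip"
  shows "convex_on UNIV (\<lambda>t. pressure \<nu> (\<lambda>x. f x + t * g x))"
proof (rule convex_onI)
  fix \<theta> a b :: real assume \<theta>: "0 < \<theta>" "\<theta> < 1"
  let ?f = "\<lambda>t x. f x + t * g x"
  define c where "c = (1 - \<theta>) *\<^sub>R a + \<theta> *\<^sub>R b"
  note fa = Lip_perturb[OF f g, of a] and fb = Lip_perturb[OF f g, of b] and fc = Lip_perturb[OF f g, of c]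
  define wa where "wa = RPF_eigenfunction \<nu> (?f a)"
  define wb where "wb = RPF_eigenfunction \<nu> (?f b)"
  define la where "la = RPF_eigenvalue \<nu> (?f a)"
  define lb where "lb = RPF_eigenvalue \<nu> (?f b)"
  have wa: "\<And>x. 0 < wa x" "continuous_on UNIV (\<lambda>x. ln (wa x))" "continuous_on UNIV wa"
    using eigenfunction_pos[OF fa] Lip_continuous[OF Lip_ln[OF eigenfunction_Lip[OF fa] eigenfunction_pos[OF fa]]]
      Lip_continuous[OF eigenfunction_Lip[OF fa]]
    by (simp_all add: wa_def)
  have wb: "\<And>x. 0 < wb x" "continuous_on UNIV (\<lambda>x. ln (wb x))" "continuous_on UNIV wb"
    using eigenfunction_pos[OF fb] Lip_continuous[OF Lip_ln[OF eigenfunction_Lip[OF fb] eigenfunction_pos[OF fb]]]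
      Lip_continuous[OF eigenfunction_Lip[OF fb]]
    by (simp_all add: wb_def)
  have la: "0 < la" "\<And>x. transfer \<nu> (?f a) wa x = la * wa x"
    using eigenvalue_pos[OF fa] eigenfunction_eq[OF fa] by (simp_all add: wa_def la_def)
  have lb: "0 < lb" "\<And>x. transfer \<nu> (?f b) wb x = lb * wb x"
    using eigenvalue_pos[OF fb] eigenfunction_eq[OF fb] by (simp_all add: wb_def lb_def)
  have lc: "0 < RPF_eigenvalue \<nu> (?f c)" by (rule eigenvalue_pos[OF fc])
  obtain \<rho> where \<rho>: "borel_prob \<rho>" "dual_eigenmeasure \<nu> (?f c) (RPF_eigenvalue \<nu> (?f c)) \<rho>"
    by (rule eigenmeasure_exists[OF fc]) blast
  define K where "K = exp ((1 - \<theta>) * ln la + \<theta> * ln lb)"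
  define w where "w x = exp ((1 - \<theta>) * ln (wa x) + \<theta> * ln (wb x))" for x
  have cw: "continuous_on UNIV w" unfolding w_def by (intro continuous_intros wa wb)
  have young: "exp ((1 - \<theta>) * s + \<theta> * t) \<le> (1 - \<theta>) * exp s + \<theta> * exp t" for s t :: real
    using convex_onD[OF exp_convex, of \<theta> s t] \<theta> by simp
  have le: "transfer \<nu> (?f c) w x \<le> K * w x" for x
  proof -
    \<comment> \<open>Each fraction integrates to \<open>1\<close>, so pointwise convexity of
      \<open>exp\<close> does the work of Hoelder's inequality.\<close>
    let ?\<phi> = "\<lambda>y. (1 - \<theta>) * (exp (?f a y) * wa y / (la * wa x)) + \<theta> * (exp (?f b y) * wb y / (lb * wb x))"
    have pt: "exp (?f c y) * w y \<le> K * w x * ?\<phi> y" for y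
    proof -
      define s where "s = ?f a y + ln (wa y) - ln la - ln (wa x)"
      define t where "t = ?f b y + ln (wb y) - ln lb - ln (wb x)"
      have "exp (?f c y) * w y = K * w x * exp ((1 - \<theta>) * s + \<theta> * t)"
        by (simp add: s_def t_def K_def w_def c_def algebra_simps flip: exp_add)
      also have "\<dots> \<le> K * w x * ((1 - \<theta>) * exp s + \<theta> * exp t)"
        by (intro mult_left_mono young) (simp add: K_def w_def)
      also have "exp s = exp (?f a y) * wa y / (la * wa x)"
        using wa(1) la(1) by (simp add: s_def exp_diff exp_add)
      also have "exp t = exp (?f b y) * wb y / (lb * wb x)"
        using wb(1) lb(1) by (simp add: t_def exp_diff exp_add)
      finally show ?thesis .
    qed
    have ia: "integrable \<nu> (\<lambda>y. exp (?f a (prepend y x)) * wa (prepend y x))"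
      using integrable_branch[OF Lip_continuous[OF fa] wa(3)] by simp
    have ib: "integrable \<nu> (\<lambda>y. exp (?f b (prepend y x)) * wb (prepend y x))"
      using integrable_branch[OF Lip_continuous[OF fb] wb(3)] by simp
    have ic: "integrable \<nu> (\<lambda>y. exp (?f c (prepend y x)) * w (prepend y x))"
      using integrable_branch[OF Lip_continuous[OF fc] cw] by simp
    have "transfer \<nu> (?f c) w x \<le> (\<integral>y. K * w x * ?\<phi> (prepend y x) \<partial>\<nu>)"
      unfolding transfer_def real_scaleR_def using pt
      by (intro integral_mono integrable_mult_right integrable_divide Bochner_Integration.integrable_add ia ib ic) auto
    also have "\<dots> = K * w x * ((1 - \<theta>) * (transfer \<nu> (?f a) wa x / (la * wa x))
        + \<theta> * (transfer \<nu> (?f b) wb x / (lb * wb x)))"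
      using ia ib by (simp add: transfer_def)
    also have "\<dots> = K * w x" using la lb wa(1)[of x] wb(1)[of x] by simp
    finally show ?thesis .
  qed
  have "RPF_eigenvalue \<nu> (?f c) * (\<integral>x. w x \<partial>\<rho>) = (\<integral>x. transfer \<nu> (?f c) w x \<partial>\<rho>)"
    using \<rho>(2) cw by (simp add: dual_eigenmeasure_def ruelle_eq_transfer)
  also have "\<dots> \<le> (\<integral>x. K * w x \<partial>\<rho>)"
    using le cw by (intro integral_mono integrable_continuous[OF \<rho>(1)] continuous_transfer Lip_continuous[OF fc] continuous_intros)
  also have "\<dots> = K * (\<integral>x. w x \<partial>\<rho>)" by simp
  finally have "RPF_eigenvalue \<nu> (?f c) \<le> K"
    using borel_prob_integral_pos[OF compact_sequences \<rho>(1) cw] by (simp add: w_def)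
  then have "ln (RPF_eigenvalue \<nu> (?f c)) \<le> ln K" using lc by (subst ln_le_cancel_iff) (auto simp: K_def)
  then show "pressure \<nu> (?f c) \<le> (1 - \<theta>) * pressure \<nu> (?f a) + \<theta> * pressure \<nu> (?f b)"
    by (simp add: pressure_def K_def la_def lb_def)
qed simp

text \<open>\<open>\<psi>\<close> is an approximate eigenfunction for \<open>f + t * g\<close>, with
  an error relative to \<open>\<psi>\<close>. As \<open>\<psi>\<close> is positive, integrating
  against the eigenmeasure of \<open>f + t * g\<close> turns the pointwise bound into one for the
  exact eigenvalue \<open>lt\<close>, without knowledge of the exact eigenfunction.\<close>

lemma pressure_expansion:
  assumes f: "f \<in> Lip" and u: "u \<in> Lip" and h: "h \<in> Lip" and q: "q \<in> Lip" and g: "g \<in> Lip"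
    and g_eq: "\<And>x. g x = m + h x + u (shift x) - u x"
    and Lh: "\<And>x. transfer \<nu> (normalization \<nu> f) h x = 0"
    and Lq: "\<And>x. transfer \<nu> (normalization \<nu> f) (\<lambda>x. (h x)\<^sup>2 + q x) x = s + q x"
    and s: "0 \<le> s"
  obtains C \<delta> where "0 < \<delta>" "\<And>t. \<bar>t\<bar> < \<delta> \<Longrightarrow>
    \<bar>pressure \<nu> (\<lambda>x. f x + t * g x) - pressure \<nu> f - (m * t + s * t\<^sup>2 / 2)\<bar> \<le> C * \<bar>t\<bar> ^ 3"
proof -
  let ?F = "normalization \<nu> f" and ?f = "\<lambda>t x. f x + t * g x"
  define w where "w = RPF_eigenfunction \<nu> f"
  define l where "l = RPF_eigenvalue \<nu> f"
  have w: "0 < w x" "continuous_on UNIV w" for x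
    using eigenfunction_pos[OF f] Lip_continuous[OF eigenfunction_Lip[OF f]] by (auto simp: w_def)
  have l: "0 < l" using eigenvalue_pos[OF f] by (simp add: l_def)
  note cu = Lip_continuous[OF u] and cq = Lip_continuous[OF q] and cg = Lip_continuous[OF g]
  obtain U where U: "0 < U" "\<And>x. norm (u x) \<le> U" using continuous_bounded[OF cu] by blast
  obtain Q where Q: "0 < Q" "\<And>x. norm (q x) \<le> Q" using continuous_bounded[OF cq] by blast
  obtain C where C: "0 < C" "\<And>(z :: real) x. norm z \<le> 1 \<Longrightarrow>
    norm (transfer \<nu> ?F (\<lambda>x. exp (z * of_real (g x - m)) * test_function z u q x) x
        - exp (z\<^sup>2 * of_real (s / 2)) * test_function z u q x) \<le> C * norm z ^ 3"
    by (rule perturbed_transfer[OF normalized_normalization[OF f] u h q g_eq Lh Lq]) blast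
  \<comment> \<open>The test function is at least \<open>exp (- U) / 2\<close>, so this factor makes
    the absolute error a relative one.\<close>
  define C' where "C' = 2 * exp U * C"
  have C': "0 < C'" using C by (simp add: C'_def)
  \<comment> \<open>In order, the bounds admit \<open>t\<close> in the operator estimate, keep
    \<open>1 + t\<^sup>2 / 2 * q x\<close> above \<open>1 / 2\<close>, and keep
    \<open>lt / k\<close> above \<open>1 / 2\<close>, where \<open>ln\<close> has Lipschitz constant
    \<open>2\<close>.\<close>
  define \<delta> where "\<delta> = min 1 (min (1 / Q) (1 / (2 * C')))"
  have \<delta>: "0 < \<delta>" using Q C' by (simp add: \<delta>_def)
  have "\<bar>pressure \<nu> (?f t) - pressure \<nu> f - (m * t + s * t\<^sup>2 / 2)\<bar> \<le> 2 * C' * \<bar>t\<bar> ^ 3" if t: "\<bar>t\<bar> < \<delta>" for t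
  proof -
    have t1: "\<bar>t\<bar> \<le> 1" "\<bar>t\<bar> * Q \<le> 1" "C' * \<bar>t\<bar> \<le> 1 / 2"
      using t Q C' by (auto simp: \<delta>_def field_simps)
    have t2: "t\<^sup>2 \<le> \<bar>t\<bar>" "\<bar>t\<bar> ^ 3 \<le> \<bar>t\<bar>"
      using t1(1) power_decreasing[of 1 2 "\<bar>t\<bar>"] power_decreasing[of 1 3 "\<bar>t\<bar>"] by auto
    note ft = Lip_perturb[OF f g, of t]
    define lt where "lt = RPF_eigenvalue \<nu> (?f t)"
    have lt: "0 < lt" using eigenvalue_pos[OF ft] by (simp add: lt_def)
    obtain \<rho> where \<rho>: "borel_prob \<rho>" "dual_eigenmeasure \<nu> (?f t) lt \<rho>"
      unfolding lt_def by (rule eigenmeasure_exists[OF ft]) blast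
    define \<Phi> where "\<Phi> = test_function t u q"
    have c\<Phi>: "continuous_on UNIV \<Phi>" unfolding \<Phi>_def by (rule continuous_test_function[OF u q])
    have \<Phi>_ge: "exp (- U) / 2 \<le> \<Phi> x" for x
    proof -
      have "\<bar>t * u x\<bar> \<le> 1 * U" unfolding abs_mult using t1 U(2)[of x] U(1) by (intro mult_mono) auto
      then have "exp (- U) \<le> exp (t * u x)" by (simp add: abs_le_iff)
      moreover have "\<bar>t\<^sup>2 * q x\<bar> \<le> \<bar>t\<bar> * Q" unfolding abs_mult using t2 Q(2)[of x] by (intro mult_mono) auto
      then have "1 / 2 \<le> 1 + t\<^sup>2 / 2 * q x" using t1 by (simp add: abs_le_iff)
      ultimately have "exp (- U) * (1 / 2) \<le> exp (t * u x) * (1 + t\<^sup>2 / 2 * q x)"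
        by (intro mult_mono) auto
      then show ?thesis by (simp add: \<Phi>_def test_function_def)
    qed
    then have \<Phi>_pos: "0 < \<Phi> x" for x by (rule less_le_trans[rotated]) simp
    define \<psi> where "\<psi> x = w x * \<Phi> x" for x
    have c\<psi>: "continuous_on UNIV \<psi>" unfolding \<psi>_def by (intro continuous_intros w c\<Phi>)
    define I where "I = (\<integral>x. \<psi> x \<partial>\<rho>)"
    have I: "0 < I" unfolding I_def
      by (rule borel_prob_integral_pos[OF compact_sequences \<rho>(1) c\<psi>]) (simp add: \<psi>_def w \<Phi>_pos)
    define e where "e = exp (t\<^sup>2 * (s / 2))"
    define k where "k = l * exp (t * m)"
    have k: "0 < k" using l by (simp add: k_def)
    have D: "\<bar>transfer \<nu> (?f t) \<psi> x - k * e * \<psi> x\<bar> \<le> k * (C' * \<bar>t\<bar> ^ 3) * \<psi> x" for x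
    proof -
      let ?\<chi> = "\<lambda>x. exp (t * (g x - m)) * \<Phi> x"
      have "transfer \<nu> (?f t) \<psi> x = transfer \<nu> f (\<lambda>x. w x *\<^sub>R (exp (t * m) * ?\<chi> x)) x"
        by (simp add: transfer_def \<psi>_def exp_add algebra_simps exp_diff)
      also have "\<dots> = l * w x * (exp (t * m) * transfer \<nu> ?F ?\<chi> x)"
        unfolding w_def l_def transfer_eigenfunction_scaleR[OF f] transfer_mult by simp
      finally have "transfer \<nu> (?f t) \<psi> x - k * e * \<psi> x = k * w x * (transfer \<nu> ?F ?\<chi> x - e * \<Phi> x)"
        by (simp add: k_def \<psi>_def algebra_simps)
      also have "\<bar>\<dots>\<bar> = k * w x * \<bar>transfer \<nu> ?F ?\<chi> x - e * \<Phi> x\<bar>"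
        using k w(1)[of x] by (simp add: abs_mult)
      also have "\<dots> \<le> k * w x * (C * \<bar>t\<bar> ^ 3)"
        using C(2)[of t x] t1 k w(1)[of x] by (intro mult_left_mono) (auto simp: \<Phi>_def e_def)
      also have "\<dots> \<le> k * w x * (C' * \<bar>t\<bar> ^ 3 * \<Phi> x)"
      proof (intro mult_left_mono)
        have "C * \<bar>t\<bar> ^ 3 * 1 \<le> C * \<bar>t\<bar> ^ 3 * (2 * exp U * \<Phi> x)"
          using \<Phi>_ge[of x] C by (intro mult_left_mono) (auto simp: exp_minus field_simps)
        then show "C * \<bar>t\<bar> ^ 3 \<le> C' * \<bar>t\<bar> ^ 3 * \<Phi> x" by (simp add: C'_def mult_ac)
      qed (use k w(1)[of x] in auto)
      finally show ?thesis by (simp add: \<psi>_def mult_ac)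
    qed
    have cT: "continuous_on UNIV (transfer \<nu> (?f t) \<psi>)" by (rule continuous_transfer[OF Lip_continuous[OF ft] c\<psi>])
    have int: "integrable \<rho> \<psi>" "integrable \<rho> (transfer \<nu> (?f t) \<psi>)"
      by (intro integrable_continuous[OF \<rho>(1)] c\<psi> cT)+
    have "\<bar>lt * I - k * e * I\<bar> = \<bar>\<integral>x. transfer \<nu> (?f t) \<psi> x - k * e * \<psi> x \<partial>\<rho>\<bar>"
      using \<rho>(2) c\<psi> int by (simp add: I_def dual_eigenmeasure_def ruelle_eq_transfer)
    also have "\<dots> \<le> (\<integral>x. \<bar>transfer \<nu> (?f t) \<psi> x - k * e * \<psi> x\<bar> \<partial>\<rho>)" by (rule integral_abs_bound)
    also have "\<dots> \<le> (\<integral>x. k * (C' * \<bar>t\<bar> ^ 3) * \<psi> x \<partial>\<rho>)"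
      using int D by (intro integral_mono) auto
    also have "\<dots> = k * (C' * \<bar>t\<bar> ^ 3) * I" by (simp add: I_def)
    finally have "\<bar>lt - k * e\<bar> * I \<le> k * (C' * \<bar>t\<bar> ^ 3) * I"
      using I by (simp add: abs_mult flip: left_diff_distrib)
    then have "\<bar>lt - k * e\<bar> \<le> k * (C' * \<bar>t\<bar> ^ 3)" using I by (simp only: mult_le_cancel_right_pos)
    then have "\<bar>(lt - k * e) / k\<bar> \<le> C' * \<bar>t\<bar> ^ 3" using k by (simp add: pos_divide_le_eq mult_ac)
    then have r: "\<bar>lt / k - e\<bar> \<le> C' * \<bar>t\<bar> ^ 3" using k by (simp add: diff_divide_distrib)
    have e1: "1 \<le> e" using s by (simp add: e_def)
    have "C' * \<bar>t\<bar> ^ 3 \<le> C' * \<bar>t\<bar>" using t2 C' by (intro mult_left_mono) auto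
    then have half: "1 / 2 \<le> lt / k" using r e1 t1 by linarith
    have "\<bar>ln (lt / k) - ln e\<bar> \<le> \<bar>lt / k - e\<bar> / (1 / 2)"
      using half e1 by (intro abs_ln_diff_le) auto
    then have "\<bar>ln (lt / k) - ln e\<bar> \<le> 2 * C' * \<bar>t\<bar> ^ 3" using r by simp
    moreover have "ln (lt / k) - ln e = pressure \<nu> (?f t) - pressure \<nu> f - (m * t + s * t\<^sup>2 / 2)"
      using lt k l by (simp add: ln_divide_pos k_def ln_mult_pos e_def pressure_def lt_def l_def algebra_simps)
    ultimately show ?thesis by simp
  qed
  then show ?thesis using that[OF \<delta>] by blast
qed

text \<open>The expansion is applied with base point \<open>f + t * g\<close> and the decomposition
  of \<open>g\<close> belonging to it, which yields the derivative at every
  \<open>t\<close>.\<close>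

lemma pressure_derivative:
  assumes f: "f \<in> Lip" and g: "g \<in> Lip"
  shows "((\<lambda>t. pressure \<nu> (\<lambda>x. f x + t * g x)) has_real_derivative
    (\<integral>x. g x \<partial>gibbs \<nu> (\<lambda>x. f x + t * g x))) (at t)"
proof -
  let ?f = "\<lambda>t x. f x + t * g x" and ?p = "\<lambda>t. pressure \<nu> (\<lambda>x. f x + t * g x)"
  note ft = Lip_perturb[OF f g, of t]
  let ?\<mu> = "gibbs \<nu> (?f t)"
  define m where "m = (\<integral>x. g x \<partial>?\<mu>)"
  obtain u h q where uhq: "u \<in> Lip" "h \<in> Lip" "q \<in> Lip" "\<And>x. g x = m + h x + u (shift x) - u x"
    "\<And>x. transfer \<nu> (normalization \<nu> (?f t)) h x = 0"
    "\<And>x. transfer \<nu> (normalization \<nu> (?f t)) (\<lambda>x. (h x)\<^sup>2 + q x) x = (\<integral>x. (h x)\<^sup>2 \<partial>?\<mu>) + q x"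
    unfolding m_def
    by (rule gordin_decomposition[OF normalization_properties[OF ft] gibbs_properties[OF ft] g]) blast
  define s where "s = (\<integral>x. (h x)\<^sup>2 \<partial>?\<mu>)"
  have s: "0 \<le> s" by (simp add: s_def)
  obtain C \<delta> where \<delta>: "0 < \<delta>" and exp: "\<And>r. \<bar>r\<bar> < \<delta> \<Longrightarrow>
    \<bar>pressure \<nu> (\<lambda>x. ?f t x + r * g x) - pressure \<nu> (?f t) - (m * r + s * r\<^sup>2 / 2)\<bar> \<le> C * \<bar>r\<bar> ^ 3"
    by (rule pressure_expansion[OF ft uhq(1-3) g uhq(4,5) uhq(6)[folded s_def] s]) blast
  have shift_base: "(\<lambda>x. ?f t x + r * g x) = ?f (t + r)" for r by (simp add: algebra_simps)
  have "(\<lambda>r. (?p (t + r) - ?p t) / r) \<midarrow>0\<rightarrow> m"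
  proof (rule LIM_zero_cancel, rule Lim_null_comparison)
    have "norm ((?p (t + r) - ?p t) / r - m) \<le> s * \<bar>r\<bar> / 2 + C * \<bar>r\<bar> ^ 2" if r: "r \<noteq> 0" "\<bar>r\<bar> < \<delta>" for r
    proof -
      have "\<bar>?p (t + r) - ?p t - m * r\<bar> \<le> s * r\<^sup>2 / 2 + C * \<bar>r\<bar> ^ 3"
      proof -
        have "0 \<le> s * r\<^sup>2 / 2" using s by simp
        then show ?thesis using exp[OF r(2)] unfolding shift_base by linarith
      qed
      also have "\<dots> = (s * \<bar>r\<bar> / 2 + C * \<bar>r\<bar> ^ 2) * \<bar>r\<bar>"
        by (simp add: algebra_simps power2_eq_square power3_eq_cube flip: power2_abs[of r])
      finally have "\<bar>?p (t + r) - ?p t - m * r\<bar> / \<bar>r\<bar> \<le> s * \<bar>r\<bar> / 2 + C * \<bar>r\<bar> ^ 2"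
        using r by (simp add: pos_divide_le_eq)
      moreover have "(?p (t + r) - ?p t) / r - m = (?p (t + r) - ?p t - m * r) / r" using r by (simp add: field_simps)
      ultimately show ?thesis by simp
    qed
    then show "\<forall>\<^sub>F r in at 0. norm ((?p (t + r) - ?p t) / r - m) \<le> s * \<bar>r\<bar> / 2 + C * \<bar>r\<bar> ^ 2"
      using \<delta> by (auto simp: eventually_at dist_real_def)
    have "(\<lambda>r. s * \<bar>r\<bar> / 2 + C * \<bar>r\<bar> ^ 2) \<midarrow>0\<rightarrow> s * \<bar>0\<bar> / 2 + C * \<bar>0\<bar> ^ 2"
      by (intro tendsto_intros) auto
    then show "(\<lambda>r. s * \<bar>r\<bar> / 2 + C * \<bar>r\<bar> ^ 2) \<midarrow>0\<rightarrow> 0" by simp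
  qed
  then show ?thesis unfolding DERIV_def m_def .
qed

text \<open>The first derivative is now known as a function \<open>D\<close> on the whole line;
  convexity and the expansion at \<open>0\<close> differentiate it once more.\<close>

lemma pressure_diff_derivatives:
  assumes f: "f \<in> Lip" and g: "g \<in> Lip" and u: "u \<in> Lip" and h: "h \<in> Lip" and q: "q \<in> Lip"
    and g_eq: "\<And>x. g x = (\<integral>x. g x \<partial>gibbs \<nu> f) + h x + u (shift x) - u x"
    and Lh: "\<And>x. transfer \<nu> (normalization \<nu> f) h x = 0"
    and Lq: "\<And>x. transfer \<nu> (normalization \<nu> f) (\<lambda>x. (h x)\<^sup>2 + q x) x = s + q x"
    and s: "0 \<le> s"
  shows "deriv (pressure_diff \<nu> f g) 0 = (\<integral>x. g x \<partial>gibbs \<nu> f)"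
    and "deriv (deriv (pressure_diff \<nu> f g)) 0 = s"
proof -
  define D where "D t = (\<integral>x. g x \<partial>gibbs \<nu> (\<lambda>x. f x + t * g x))" for t
  have D: "(pressure_diff \<nu> f g has_real_derivative D t) (at t)" for t
    unfolding pressure_diff_def D_def
    using DERIV_diff[OF pressure_derivative[OF f g, of t] DERIV_const] by simp
  have D_0: "D 0 = (\<integral>x. g x \<partial>gibbs \<nu> f)" by (simp add: D_def)
  have deriv_eq: "deriv (pressure_diff \<nu> f g) = D" using DERIV_imp_deriv[OF D] by auto
  then show "deriv (pressure_diff \<nu> f g) 0 = (\<integral>x. g x \<partial>gibbs \<nu> f)" by (simp add: D_0)
  obtain C \<delta> where \<delta>: "0 < \<delta>" "\<And>t. \<bar>t\<bar> < \<delta> \<Longrightarrow>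
    \<bar>pressure \<nu> (\<lambda>x. f x + t * g x) - pressure \<nu> f - (D 0 * t + s * t\<^sup>2 / 2)\<bar> \<le> C * \<bar>t\<bar> ^ 3"
    by (rule pressure_expansion[OF f u h q g g_eq[folded D_0] Lh Lq s]) blast
  have "(D has_real_derivative s) (at 0)"
  proof (rule convex_second_derivative[OF pressure_convex[OF f g] _ \<delta>(1)])
    show "((\<lambda>t. pressure \<nu> (\<lambda>x. f x + t * g x)) has_real_derivative D t) (at t)" for t
      unfolding D_def by (rule pressure_derivative[OF f g])
    show "\<bar>pressure \<nu> (\<lambda>x. f x + t * g x) - pressure \<nu> (\<lambda>x. f x + 0 * g x) - (D 0 * t + s * t\<^sup>2 / 2)\<bar> \<le> C * \<bar>t\<bar> ^ 3"
      if "\<bar>t\<bar> < \<delta>" for t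
      using \<delta>(2)[OF that] by simp
  qed
  then show "deriv (deriv (pressure_diff \<nu> f g)) 0 = s" unfolding deriv_eq by (rule DERIV_imp_deriv)
qed

end

section \<open>The central limit theorem\<close>

lemma measure_lborel_density_atom: "measure (density lborel \<phi>) {a :: real} = 0" if "\<phi> \<in> borel_measurable lborel"
proof -
  have "{a} \<in> null_sets lborel" by (simp add: null_sets_def)
  then have "{a} \<in> null_sets (density lborel \<phi>)"
    using absolutely_continuousI_density[OF that] by (auto simp: absolutely_continuous_def)
  then show ?thesis by (simp add: measure_def null_setsD1)
qed

text \<open>A rescaling by \<open>sqrt s\<close>; the end point may be added because a density has
  no atoms.\<close>

lemma std_normal_lessThan:
  assumes "0 < s"
  shows "measure std_normal_distribution {..<c / sqrt s} = measure (gaussian 0 s) {..c}"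
proof -
  define \<sigma> where "\<sigma> = sqrt s"
  have \<sigma>: "0 < \<sigma>" using assms by (simp add: \<sigma>_def)
  let ?G = "density lborel (normal_density 0 \<sigma>)"
  interpret G: prob_space ?G by (rule prob_space_normal_density[OF \<sigma>])
  have "distr ?G lborel (\<lambda>x. x) = ?G" by (rule distr_id2) simp
  then have "distributed ?G lborel (\<lambda>x. x) (normal_density 0 \<sigma>)"
    by (simp add: distributed_def)
  then have "distributed ?G lborel (\<lambda>x. (x - 0) / \<sigma>) std_normal_density"
    using G.normal_standard_normal_convert[OF \<sigma>, of "\<lambda>x. x" 0] by simp
  then have d: "distr ?G lborel (\<lambda>x. x / \<sigma>) = std_normal_distribution"
    by (simp add: distributed_def)
  have "measure std_normal_distribution {..<c / \<sigma>} = measure ?G ((\<lambda>x. x / \<sigma>) -` {..<c / \<sigma>} \<inter> space ?G)"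
    unfolding d[symmetric] by (rule measure_distr) auto
  also have "(\<lambda>x. x / \<sigma>) -` {..<c / \<sigma>} \<inter> space ?G = {..<c}"
    using \<sigma> by (auto simp: divide_less_cancel)
  also have "measure ?G {..<c} = measure ?G {..c}"
  proof -
    have "{..c} = {..<c} \<union> {c}" by auto
    then have "measure ?G {..c} = measure ?G {..<c} + measure ?G {c}"
      using G.finite_measure_Union[of "{..<c}" "{c}"] by simp
    then show ?thesis by (simp add: measure_lborel_density_atom)
  qed
  finally show ?thesis by (simp add: gaussian_def \<sigma>_def)
qed

context full_shift
begin

text \<open>\<open>dual_eigenmeasure\<close> speaks of real functions, so real and imaginary parts
  are treated separately.\<close>

lemma dual_complex:
  assumes F: "continuous_on UNIV F" and \<mu>: "borel_prob \<mu>" "dual_eigenmeasure \<nu> F 1 \<mu>"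
    and \<phi>: "continuous_on UNIV (\<phi> :: (nat \<Rightarrow> 'a) \<Rightarrow> complex)"
  shows "(\<integral>x. transfer \<nu> F \<phi> x \<partial>\<mu>) = (\<integral>x. \<phi> x \<partial>\<mu>)"
proof -
  have Re: "Re (transfer \<nu> F \<phi> x) = transfer \<nu> F (\<lambda>x. Re (\<phi> x)) x" for x
    unfolding transfer_def using integral_Re[OF integrable_branch[OF F \<phi>, of x]] by simp
  have Im: "Im (transfer \<nu> F \<phi> x) = transfer \<nu> F (\<lambda>x. Im (\<phi> x)) x" for x
    unfolding transfer_def using integral_Im[OF integrable_branch[OF F \<phi>, of x]] by simp
  have c: "continuous_on UNIV (\<lambda>x. Re (\<phi> x))" "continuous_on UNIV (\<lambda>x. Im (\<phi> x))"
    by (intro continuous_intros \<phi>)+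
  note int = integrable_continuous[OF \<mu>(1) \<phi>] integrable_continuous[OF \<mu>(1) continuous_transfer[OF F \<phi>]]
  show ?thesis
  proof (rule complex_eqI)
    show "Re (\<integral>x. transfer \<nu> F \<phi> x \<partial>\<mu>) = Re (\<integral>x. \<phi> x \<partial>\<mu>)"
      using \<mu>(2) c(1) by (simp add: int Re dual_eigenmeasure_def ruelle_eq_transfer flip: integral_Re)
    show "Im (\<integral>x. transfer \<nu> F \<phi> x \<partial>\<mu>) = Im (\<integral>x. \<phi> x \<partial>\<mu>)"
      using \<mu>(2) c(2) by (simp add: int Im dual_eigenmeasure_def ruelle_eq_transfer flip: integral_Im)
  qed
qed

lemma continuous_birkhoff_sum:
  assumes "continuous_on UNIV (g :: (nat \<Rightarrow> 'a) \<Rightarrow> real)"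
  shows "continuous_on UNIV (\<lambda>x. \<Sum>j<n. g ((shift ^^ j) x) - m)"
proof -
  have "continuous_on UNIV ((shift ^^ j) :: (nat \<Rightarrow> 'a) \<Rightarrow> _)" for j
    by (induction j) (auto intro: continuous_on_shiftI continuous_on_compose2[OF continuous_on_shift] simp: id_def o_def)
  then show ?thesis
    by (intro continuous_on_sum continuous_on_diff continuous_on_const continuous_on_compose2[OF assms]) auto
qed

text \<open>
  Since the test function is an approximate eigenfunction with eigenvalue \<open>\<kappa>\<close>, each step of the orbit
  multiplies the integral by \<open>\<kappa>\<close>, up to an error of third order.
\<close>

lemma characteristic_function_estimate:
  fixes g u q :: "(nat \<Rightarrow> 'a) \<Rightarrow> real"
  assumes F: "normalized \<nu> F" and \<mu>: "borel_prob \<mu>" "dual_eigenmeasure \<nu> F 1 \<mu>"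
    and u: "u \<in> Lip" and q: "q \<in> Lip" and g: "g \<in> Lip"
    and C: "\<And>x. norm (transfer \<nu> F (\<lambda>x. exp (z * of_real (g x - m)) * test_function z u q x) x
        - \<kappa> * test_function z u q x) \<le> C"
    and \<kappa>: "norm \<kappa> \<le> 1" and z: "Re z = 0"
  shows "norm ((\<integral>x. exp (z * of_real (\<Sum>j<k. g ((shift ^^ j) x) - m)) * test_function z u q x \<partial>\<mu>)
      - \<kappa> ^ k * (\<integral>x. test_function z u q x \<partial>\<mu>)) \<le> real k * C"
proof (induction k)
  case (Suc k)
  let ?S = "\<lambda>k x. \<Sum>j<k. g ((shift ^^ j) x) - m" and ?\<Phi> = "test_function z u q"
  let ?a = "\<lambda>k. \<integral>x. exp (z * of_real (?S k x)) * ?\<Phi> x \<partial>\<mu>"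
  let ?T = "transfer \<nu> F (\<lambda>x. exp (z * of_real (g x - m)) * ?\<Phi> x)"
  have cF: "continuous_on UNIV F" using F by (simp add: normalized_def)
  note cg = Lip_continuous[OF g]
  have c\<Phi>: "continuous_on UNIV ?\<Phi>" by (rule continuous_test_function[OF u q])
  have cS: "continuous_on UNIV (?S k)" for k by (rule continuous_birkhoff_sum[OF cg])
  have cE: "continuous_on UNIV (\<lambda>x. exp (z * of_real (?S k x)))" for k
    by (intro continuous_intros cS)
  have cG: "continuous_on UNIV (\<lambda>x. exp (z * of_real (g x - m)) * ?\<Phi> x)" by (intro continuous_intros cg c\<Phi>)
  have cT: "continuous_on UNIV ?T" by (rule continuous_transfer[OF cF cG])
  \<comment> \<open>The first summand is split off, not the last: the rest is a function of
    \<open>shift x\<close> and leaves the operator, which then acts on a single perturbation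
    step.\<close>
  have S_Suc: "?S (Suc k) x = (g x - m) + ?S k (shift x)" for x
    by (subst sum.lessThan_Suc_shift) (simp add: funpow_swap1)
  have "?a (Suc k) = (\<integral>x. exp (z * of_real (?S k (shift x))) * (exp (z * of_real (g x - m)) * ?\<Phi> x) \<partial>\<mu>)"
    unfolding S_Suc of_real_add distrib_left exp_add by (simp add: mult_ac)
  also have "\<dots> = (\<integral>x. transfer \<nu> F (\<lambda>x. exp (z * of_real (?S k (shift x))) * (exp (z * of_real (g x - m)) * ?\<Phi> x)) x \<partial>\<mu>)"
    by (rule dual_complex[OF cF \<mu>, symmetric]) (intro continuous_on_mult cG continuous_on_shiftI[OF cE])
  also have "\<dots> = (\<integral>x. exp (z * of_real (?S k x)) * ?T x \<partial>\<mu>)"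
    by (subst transfer_shift_mult) (rule refl)
  finally have a_Suc: "?a (Suc k) = (\<integral>x. exp (z * of_real (?S k x)) * ?T x \<partial>\<mu>)" .
  have "?a (Suc k) - \<kappa> * ?a k = (\<integral>x. exp (z * of_real (?S k x)) * (?T x - \<kappa> * ?\<Phi> x) \<partial>\<mu>)"
  proof -
    have i: "integrable \<mu> (\<lambda>x. exp (z * of_real (?S k x)) * ?T x)"
      "integrable \<mu> (\<lambda>x. \<kappa> * (exp (z * of_real (?S k x)) * ?\<Phi> x))"
      by (intro integrable_continuous[OF \<mu>(1)] continuous_on_mult cE cT c\<Phi> continuous_on_const)+
    have "?a (Suc k) - \<kappa> * ?a k
        = (\<integral>x. exp (z * of_real (?S k x)) * ?T x - \<kappa> * (exp (z * of_real (?S k x)) * ?\<Phi> x) \<partial>\<mu>)"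
      unfolding a_Suc by (subst Bochner_Integration.integral_diff[OF i]) simp
    then show ?thesis by (simp add: algebra_simps)
  qed
  \<comment> \<open>As \<open>z\<close> is imaginary, the exponential of the Birkhoff sum has
    modulus \<open>1\<close> and does not enlarge the error.\<close>
  also have "norm \<dots> \<le> C"
  proof (rule borel_prob_integral_norm_le[OF \<mu>(1)])
    show "continuous_on UNIV (\<lambda>x. exp (z * of_real (?S k x)) * (?T x - \<kappa> * ?\<Phi> x))"
      by (intro continuous_on_mult continuous_on_diff cE cT c\<Phi> continuous_on_const)
    show "norm (exp (z * of_real (?S k x)) * (?T x - \<kappa> * ?\<Phi> x)) \<le> C" for x
      using C[of x] z by (simp add: norm_mult)
  qed
  finally have 1: "norm (?a (Suc k) - \<kappa> * ?a k) \<le> C" .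
  have "norm (\<kappa> * (?a k - \<kappa> ^ k * (\<integral>x. ?\<Phi> x \<partial>\<mu>))) \<le> 1 * (real k * C)"
    unfolding norm_mult using \<kappa> Suc by (intro mult_mono) auto
  then have "norm ((?a (Suc k) - \<kappa> * ?a k) + \<kappa> * (?a k - \<kappa> ^ k * (\<integral>x. ?\<Phi> x \<partial>\<mu>))) \<le> C + real k * C"
    using 1 norm_triangle_ineq[of "?a (Suc k) - \<kappa> * ?a k" "\<kappa> * (?a k - \<kappa> ^ k * (\<integral>x. ?\<Phi> x \<partial>\<mu>))"] by linarith
  then show ?case by (simp add: algebra_simps)
qed simp

text \<open>Allows the test function to be inserted under an integral, or removed, at a cost of
  order \<open>norm z\<close>.\<close>

lemma test_function_near_1:
  assumes u: "u \<in> Lip" and q: "q \<in> Lip"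
  obtains K where "0 < K" "\<And>(z :: 'b::{real_normed_field,banach}) x. norm z \<le> 1 \<Longrightarrow>
    norm (test_function z u q x - 1) \<le> K * norm z"
proof -
  obtain U where U: "0 < U" "\<And>x. norm (u x) \<le> U" using continuous_bounded[OF Lip_continuous[OF u]] by blast
  obtain Q where Q: "0 < Q" "\<And>x. norm (q x) \<le> Q" using continuous_bounded[OF Lip_continuous[OF q]] by blast
  show ?thesis
  proof (rule that[of "U * exp U + exp U * Q"])
    fix z :: 'b and x :: "nat \<Rightarrow> 'a" assume z: "norm z \<le> 1"
    let ?y = "z * of_real (u x)"
    have y: "norm ?y \<le> U * norm z" using mult_left_mono[OF U(2)[of x], of "norm z"] by (simp add: norm_mult mult_ac)
    have b: "U * norm z \<le> U" "0 \<le> U" "0 \<le> norm z" using z U by (auto simp: mult_left_le)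
    have e1: "norm (exp ?y - 1) \<le> U * exp U * norm z" by (rule exp_remainder_bound(1)[OF y b])
    have e2: "norm (exp ?y) \<le> exp U"
      using y b by (intro order_trans[OF norm_exp]) simp
    have "norm (z\<^sup>2 / 2 * of_real (q x)) = norm z * (norm z * \<bar>q x\<bar>) / 2"
      by (simp add: norm_mult norm_divide norm_power power2_eq_square)
    also have "\<dots> \<le> norm z * (1 * Q) / 2"
      using z Q(2)[of x] by (intro divide_right_mono mult_left_mono mult_mono) auto
    also have "\<dots> \<le> norm z * Q" using Q by simp
    finally have e3: "norm (z\<^sup>2 / 2 * of_real (q x)) \<le> norm z * Q" .
    have "test_function z u q x - 1 = (exp ?y - 1) + exp ?y * (z\<^sup>2 / 2 * of_real (q x))"
      by (simp add: test_function_def distrib_left)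
    also have "norm \<dots> \<le> norm (exp ?y - 1) + norm (exp ?y) * norm (z\<^sup>2 / 2 * of_real (q x))"
      unfolding norm_mult[symmetric] by (rule norm_triangle_ineq)
    also have "\<dots> \<le> U * exp U * norm z + exp U * (norm z * Q)"
      by (intro add_mono mult_mono e1 e2 e3) auto
    finally show "norm (test_function z u q x - 1) \<le> (U * exp U + exp U * Q) * norm z"
      by (simp add: algebra_simps)
  qed (use U Q in \<open>auto intro: add_pos_pos\<close>)
qed

text \<open>As \<open>norm z\<close> is \<open>\<bar>r\<bar> / sqrt n\<close>, the \<open>n\<close>
  errors of third order add up to \<open>C * r\<^sup>2 * norm z\<close>, which tends to
  \<open>0\<close>, whereas \<open>\<kappa> ^ n\<close> equals the Gaussian value exactly for every
  \<open>n > 0\<close>.\<close>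

lemma characteristic_function_limit:
  fixes g u h q :: "(nat \<Rightarrow> 'a) \<Rightarrow> real"
  assumes F: "normalized \<nu> F" and \<mu>: "borel_prob \<mu>" "dual_eigenmeasure \<nu> F 1 \<mu>"
    and u: "u \<in> Lip" and h: "h \<in> Lip" and q: "q \<in> Lip" and g: "g \<in> Lip"
    and g_eq: "\<And>x. g x = m + h x + u (shift x) - u x"
    and Lh: "\<And>x. transfer \<nu> F h x = 0"
    and Lq: "\<And>x. transfer \<nu> F (\<lambda>x. (h x)\<^sup>2 + q x) x = s + q x"
    and s: "0 \<le> s"
  shows "(\<lambda>n. \<integral>x. exp (\<i> * of_real (r / sqrt (real n)) * of_real (\<Sum>j<n. g ((shift ^^ j) x) - m)) \<partial>\<mu>)
    \<longlonglongrightarrow> of_real (exp (- (r\<^sup>2 * s / 2)))"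
proof -
  obtain C where C: "0 < C" "\<And>(z :: complex) x. norm z \<le> 1 \<Longrightarrow>
    norm (transfer \<nu> F (\<lambda>x. exp (z * of_real (g x - m)) * test_function z u q x) x
        - exp (z\<^sup>2 * of_real (s / 2)) * test_function z u q x) \<le> C * norm z ^ 3"
    by (rule perturbed_transfer[OF F u h q g_eq Lh Lq]) blast
  obtain K where K: "0 < K" "\<And>(z :: complex) x. norm z \<le> 1 \<Longrightarrow> norm (test_function z u q x - 1) \<le> K * norm z"
    by (rule test_function_near_1[OF u q]) blast
  let ?S = "\<lambda>n x. \<Sum>j<n. g ((shift ^^ j) x) - m"
  let ?z = "\<lambda>n. \<i> * of_real (r / sqrt (real n))"
  let ?b = "\<lambda>n. \<integral>x. exp (?z n * of_real (?S n x)) \<partial>\<mu>"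
  let ?e = "of_real (exp (- (r\<^sup>2 * s / 2))) :: complex"
  have norm_z: "norm (?z n) = \<bar>r\<bar> / sqrt (real n)" for n
    by (simp add: norm_mult norm_divide)
  have z0: "(\<lambda>n. norm (?z n)) \<longlonglongrightarrow> 0"
    unfolding norm_z
    by (intro tendsto_divide_0[OF tendsto_const] filterlim_at_top_imp_at_infinity
        filterlim_compose[OF sqrt_at_top filterlim_real_sequentially])
  have bound: "norm (?b n - ?e) \<le> (2 * K + C * r\<^sup>2) * norm (?z n)" if n: "n > 0" and small: "norm (?z n) \<le> 1" for n
  proof -
    let ?z = "?z n"
    let ?\<Phi> = "test_function ?z u q"
    define a where "a = (\<integral>x. exp (?z * of_real (?S n x)) * ?\<Phi> x \<partial>\<mu>)"
    define a0 where "a0 = (\<integral>x. ?\<Phi> x \<partial>\<mu>)"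
    define \<kappa> where "\<kappa> = exp (?z\<^sup>2 * of_real (s / 2))"
    have z2: "?z\<^sup>2 = - of_real (r\<^sup>2 / real n)" using n by (simp add: power_mult_distrib power_divide flip: of_real_power)
    have \<kappa>_eq: "\<kappa> = of_real (exp (- (r\<^sup>2 / real n * (s / 2))))"
      unfolding \<kappa>_def z2 by (simp flip: exp_of_real)
    have \<kappa>: "norm \<kappa> \<le> 1" unfolding \<kappa>_eq using s by simp
    have "\<kappa> ^ n = of_real (exp (real n * - (r\<^sup>2 / real n * (s / 2))))"
      unfolding \<kappa>_eq exp_of_nat_mult by simp
    also have "real n * - (r\<^sup>2 / real n * (s / 2)) = - (r\<^sup>2 * s / 2)" using n by simp
    finally have \<kappa>_n: "\<kappa> ^ n = ?e" .
    have c\<Phi>: "continuous_on UNIV ?\<Phi>" by (rule continuous_test_function[OF u q])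
    have cE: "continuous_on UNIV (\<lambda>x. exp (?z * of_real (?S n x)))"
      by (intro continuous_intros continuous_birkhoff_sum Lip_continuous[OF g])
    have "norm (a - ?e * a0) \<le> real n * (C * norm ?z ^ 3)"
      unfolding a_def a0_def \<kappa>_n[symmetric]
      by (rule characteristic_function_estimate[OF F \<mu> u q g _ \<kappa>]) (use C(2)[OF small] in \<open>simp_all add: \<kappa>_def\<close>)
    also have "\<dots> = C * r\<^sup>2 * norm ?z"
      unfolding norm_z using n by (simp add: power3_eq_cube power2_eq_square field_simps)
    finally have 1: "norm (a - ?e * a0) \<le> C * r\<^sup>2 * norm ?z" .
    have "?b n - a = (\<integral>x. exp (?z * of_real (?S n x)) * (1 - ?\<Phi> x) \<partial>\<mu>)"
    proof -
      have "?b n - a = (\<integral>x. exp (?z * of_real (?S n x)) - exp (?z * of_real (?S n x)) * ?\<Phi> x \<partial>\<mu>)"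
        unfolding a_def
        by (intro Bochner_Integration.integral_diff[symmetric] integrable_continuous[OF \<mu>(1)] continuous_on_mult cE c\<Phi>)
      then show ?thesis by (simp add: right_diff_distrib)
    qed
    also have "norm \<dots> \<le> K * norm ?z"
    proof (rule borel_prob_integral_norm_le[OF \<mu>(1)])
      show "continuous_on UNIV (\<lambda>x. exp (?z * of_real (?S n x)) * (1 - ?\<Phi> x))"
        by (intro continuous_on_mult continuous_on_diff cE c\<Phi> continuous_on_const)
      have "norm (exp (?z * of_real (?S n x)) * (1 - ?\<Phi> x)) = norm (?\<Phi> x - 1)" for x
        by (simp add: norm_mult norm_minus_commute)
      then show "norm (exp (?z * of_real (?S n x)) * (1 - ?\<Phi> x)) \<le> K * norm ?z" for x
        using K(2)[OF small] by simp
    qed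
    finally have 2: "norm (?b n - a) \<le> K * norm ?z" .
    have "a0 - 1 = (\<integral>x. ?\<Phi> x - 1 \<partial>\<mu>)"
      using Bochner_Integration.integral_diff[OF integrable_continuous[OF \<mu>(1) c\<Phi>]
          integrable_continuous[OF \<mu>(1) continuous_on_const], of 1]
      unfolding a0_def borel_prob_integral_const[OF \<mu>(1)] by simp
    also have "norm \<dots> \<le> K * norm ?z"
      by (rule borel_prob_integral_norm_le[OF \<mu>(1) _ K(2)[OF small]]) (intro continuous_on_diff c\<Phi> continuous_on_const)
    finally have "norm (a0 - 1) \<le> K * norm ?z" .
    moreover have "norm ?e \<le> 1" using s by simp
    ultimately have "norm ?e * norm (a0 - 1) \<le> 1 * (K * norm ?z)" by (intro mult_mono) auto
    then have 3: "norm (?e * (a0 - 1)) \<le> K * norm ?z" unfolding norm_mult by simp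
    \<comment> \<open>The three errors: removing the test function, iterating, and replacing its
      integral by \<open>1\<close>.\<close>
    have "?b n - ?e = (?b n - a) + (a - ?e * a0) + ?e * (a0 - 1)" by (simp add: algebra_simps)
    then have "norm (?b n - ?e) \<le> norm (?b n - a) + norm (a - ?e * a0) + norm (?e * (a0 - 1))"
      by (metis norm_triangle_mono norm_triangle_ineq order_refl)
    then have "norm (?b n - ?e) \<le> K * norm ?z + C * r\<^sup>2 * norm ?z + K * norm ?z"
      using 1 2 3 by linarith
    then show ?thesis by (simp add: algebra_simps)
  qed
  have "(\<lambda>n. ?b n - ?e) \<longlonglongrightarrow> 0"
  proof (rule Lim_null_comparison)
    have "\<forall>\<^sub>F n in sequentially. n > 0 \<and> norm (?z n) < 1"
      by (intro eventually_conj eventually_gt_at_top order_tendstoD(2)[OF z0]) simp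
    then show "\<forall>\<^sub>F n in sequentially. norm (?b n - ?e) \<le> (2 * K + C * r\<^sup>2) * norm (?z n)"
      by (rule eventually_mono) (rule bound, auto)
    show "(\<lambda>n. (2 * K + C * r\<^sup>2) * norm (?z n)) \<longlonglongrightarrow> 0"
      using tendsto_mult_right_zero[OF z0] by simp
  qed
  then show ?thesis by (rule LIM_zero_cancel)
qed

text \<open>Levy's continuity theorem, applied after division by \<open>sqrt s\<close>. Weak
  convergence gives convergence on the half-line because the limit law has no atom at its end
  point.\<close>

lemma birkhoff_sum_weak_convergence:
  fixes g u h q :: "(nat \<Rightarrow> 'a) \<Rightarrow> real"
  assumes F: "normalized \<nu> F" and \<mu>: "borel_prob \<mu>" "dual_eigenmeasure \<nu> F 1 \<mu>"
    and u: "u \<in> Lip" and h: "h \<in> Lip" and q: "q \<in> Lip" and g: "g \<in> Lip"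
    and g_eq: "\<And>x. g x = m + h x + u (shift x) - u x"
    and Lh: "\<And>x. transfer \<nu> F h x = 0"
    and Lq: "\<And>x. transfer \<nu> F (\<lambda>x. (h x)\<^sup>2 + q x) x = s + q x"
    and s: "0 < s"
  shows "(\<lambda>n. measure \<mu> {x. 1 / sqrt (real n) * (\<Sum>j<n. g ((shift ^^ j) x) - m) < c})
    \<longlonglongrightarrow> measure (gaussian 0 s) {..c}"
proof -
  interpret prob_space \<mu> using \<mu>(1) by (simp add: borel_prob_def)
  define X where "X n x = 1 / sqrt (real n) * (\<Sum>j<n. g ((shift ^^ j) x) - m) / sqrt s" for n x
  have X: "X n \<in> borel_measurable \<mu>" for n
    unfolding X_def using s
    by (intro borel_prob_measurable[OF \<mu>(1)] continuous_intros continuous_birkhoff_sum Lip_continuous[OF g]) auto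
  have real_distr: "real_distribution (distr \<mu> borel (X n))" for n using X by simp
  have "weak_conv_m (\<lambda>n. distr \<mu> borel (X n)) std_normal_distribution"
  proof (rule levy_continuity[OF real_distr real_dist_normal_dist])
    fix t
    define r where "r = t / sqrt s"
    have "char (distr \<mu> borel (X n)) t
        = (\<integral>x. exp (\<i> * of_real (r / sqrt (real n)) * of_real (\<Sum>j<n. g ((shift ^^ j) x) - m)) \<partial>\<mu>)" for n
    proof -
      have "char (distr \<mu> borel (X n)) t = (\<integral>x. iexp (t * X n x) \<partial>\<mu>)"
        unfolding char_def by (rule integral_distr[OF X]) auto
      also have "(\<lambda>x. iexp (t * X n x))
          = (\<lambda>x. exp (\<i> * of_real (r / sqrt (real n)) * of_real (\<Sum>j<n. g ((shift ^^ j) x) - m)))"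
        unfolding mult.assoc of_real_mult[symmetric] by (simp add: X_def r_def mult_ac)
      finally show ?thesis .
    qed
    moreover have "r\<^sup>2 * s = t\<^sup>2" using s by (simp add: r_def power_divide)
    ultimately show "(\<lambda>n. char (distr \<mu> borel (X n)) t) \<longlonglongrightarrow> char std_normal_distribution t"
      using characteristic_function_limit[OF F \<mu> u h q g g_eq Lh Lq less_imp_le[OF s], of r]
      by (simp add: char_std_normal_distribution)
  qed
  then have "(\<lambda>n. measure (distr \<mu> borel (X n)) {..<c / sqrt s}) \<longlonglongrightarrow> measure std_normal_distribution {..<c / sqrt s}"
  proof (rule weak_conv_imp_continuity_set_conv[OF real_distr real_dist_normal_dist])
    have "frontier {..<c / sqrt s} = {c / sqrt s}" by (auto simp: frontier_def interior_open)
    moreover have "measure std_normal_distribution {c / sqrt s} = 0" by (rule measure_lborel_density_atom) simp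
    ultimately show "emeasure std_normal_distribution (frontier {..<c / sqrt s}) = 0"
      using real_dist_normal_dist
      by (simp add: finite_measure.emeasure_eq_measure real_distribution_def prob_space.finite_measure)
  qed simp
  moreover have "measure (distr \<mu> borel (X n)) {..<c / sqrt s}
      = measure \<mu> {x. 1 / sqrt (real n) * (\<Sum>j<n. g ((shift ^^ j) x) - m) < c}" for n
  proof -
    have "measure (distr \<mu> borel (X n)) {..<c / sqrt s} = measure \<mu> (X n -` {..<c / sqrt s} \<inter> space \<mu>)"
      by (rule measure_distr[OF X]) simp
    also have "X n -` {..<c / sqrt s} \<inter> space \<mu> = {x. 1 / sqrt (real n) * (\<Sum>j<n. g ((shift ^^ j) x) - m) < c}"
    proof -
      have "X n x < c / sqrt s \<longleftrightarrow> 1 / sqrt (real n) * (\<Sum>j<n. g ((shift ^^ j) x) - m) < c" for x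
        unfolding X_def using s by (subst divide_less_cancel) auto
      then show ?thesis by (simp add: borel_prob_space[OF \<mu>(1)] vimage_def)
    qed
    finally show ?thesis .
  qed
  ultimately show ?thesis by (simp add: std_normal_lessThan[OF s])
qed

end

theorem theorem8:
  fixes \<nu> :: "'a::metric_space measure"
    and f g :: "(nat \<Rightarrow> 'a) \<Rightarrow> real"
    and c :: real
  assumes "compact (UNIV :: 'a set)"
    and "diameter (UNIV :: 'a set) = 1"
    and "borel_prob \<nu>"
    and "measure_support \<nu> = UNIV"
    and "f \<in> Lip"
    and "g \<in> Lip"
    and "\<not> coboundary_to_constant g"
  shows "(\<lambda>n. measure (gibbs \<nu> f)
            {x. 1 / sqrt (real n) *
                (\<Sum>j<n. g ((shift ^^ j) x) - deriv (pressure_diff \<nu> f g) 0) < c})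
         \<longlonglongrightarrow> measure (gaussian 0 (deriv (deriv (pressure_diff \<nu> f g)) 0)) {..c}"
proof -
  interpret full_shift \<nu> by unfold_locales (use assms in auto)
  note f = \<open>f \<in> Lip\<close> and g = \<open>g \<in> Lip\<close>
  note F = normalization_properties[OF f] and \<mu> = gibbs_properties[OF f]
  let ?\<mu> = "gibbs \<nu> f"
  define m where "m = (\<integral>x. g x \<partial>?\<mu>)"
  obtain u h q where uhq: "u \<in> Lip" "h \<in> Lip" "q \<in> Lip"
    and g_eq: "\<And>x. g x = m + h x + u (shift x) - u x"
    and Lh: "\<And>x. transfer \<nu> (normalization \<nu> f) h x = 0"
    and Lq': "\<And>x. transfer \<nu> (normalization \<nu> f) (\<lambda>x. (h x)\<^sup>2 + q x) x = (\<integral>x. (h x)\<^sup>2 \<partial>?\<mu>) + q x"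
    unfolding m_def by (rule gordin_decomposition[OF F \<mu> g]) blast
  define s where "s = (\<integral>x. (h x)\<^sup>2 \<partial>?\<mu>)"
  note Lq = Lq'[folded s_def]
  have "s \<noteq> 0"
  proof
    assume "s = 0"
    have "(\<lambda>x. (h x)\<^sup>2) \<in> Lip" unfolding power2_eq_square by (intro Lip_mult uhq)
    from zero_if_integral_zero[OF assms(4) F \<mu> this] \<open>s = 0\<close> have "h x = 0" for x by (simp add: s_def)
    \<comment> \<open>In \<open>coboundary_to_constant\<close> the shifted term is subtracted, so
      the witness is \<open>- u\<close>.\<close>
    then have "g x = - u x - (- u (shift x)) + m" for x using g_eq[of x] by simp
    then have "coboundary_to_constant g"
      unfolding coboundary_to_constant_def using Lip_continuous[OF uhq(1)]
      by (intro exI[of _ "\<lambda>x. - u x"] exI[of _ m]) (auto intro: continuous_on_minus)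
    then show False using assms(7) by contradiction
  qed
  moreover have "0 \<le> s" by (simp add: s_def)
  ultimately have s: "0 < s" by simp
  note derivs = pressure_diff_derivatives[OF f g uhq g_eq[unfolded m_def] Lh Lq less_imp_le[OF s]]
  show ?thesis
    unfolding derivs m_def[symmetric]
    by (rule birkhoff_sum_weak_convergence[OF F(2) \<mu> uhq g g_eq Lh Lq s])
qed

end
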